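(* Let $\lambda>1$, let $J_0$ be an integer, and for each integer $J\ge J_0$ let $\mathrm{FAS}_J(\varphi^J;\{\Psi_j\}_{j=J}^\infty)$ be the frequency-based affine shear system with all generators $\{\varphi^J\}\cup\bigcup_{j\ge J}\Psi_j\subseteq L_2^{loc}(\mathbb{R}^2)$. Then the following statements are equivalent. (1) For every integer $J\ge J_0$, $\mathrm{FAS}_J(\varphi^J;\{\Psi_j\}_{j=J}^\infty)$ is a frequency-based affine shear tight frame for $L_2(\mathbb{R}^2)$, i.e., all generators are in $L_2(\mathbb{R}^2)$ and for all $f\in L_2(\mathbb{R}^2)$, $$(2\pi)^2\|f\|_2^2=\sum_{k\in\mathbb{Z}^2}|\langle f,\varphi^J_{N_\lambda^J;0,k}\rangle|^2+\sum_{j=J}^\infty\sum_{h\in\Psi_j}\sum_{k\in\mathbb{Z}^2}\big(|\langle f,h_{B_\lambda^j;0,k}\rangle|^2+|\langle f,h_{B_\lambda^jE;0,k}\rangle|^2\big).$$ (2) For all $f\in\mathscr{D}(\mathbb{R}^2)$, $$\lim_{j\to\infty}\sum_{k\in\mathbb{Z}^2}|\langle f,\varphi^j_{N_\lambda^j;0,k}\rangle|^2=(2\pi)^2\|f\|_2^2,$$ and for all integers $j\ge J_0$ and all $f\in\mathscr{D}(\mathbb{R}^2)$, $$\sum_{k\in\mathbb{Z}^2}|\langle f,\varphi^{j+1}_{N_\lambda^{j+1};0,k}\rangle|^2=\sum_{k\in\mathbb{Z}^2}|\langle f,\varphi^{j}_{N_\lambda^{j};0,k}\rangle|^2+\sum_{\ell=-s_j}^{s_j}\sum_{k\in\mathbb{Z}^2}\big(|\langle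 f,\psi^{j,\ell}_{S_\ell B_\lambda^j;0,k}\rangle|^2+|\langle f,\psi^{j,\ell}_{S_\ell B_\lambda^jE;0,k}\rangle|^2\big),$$ where $\psi^{j,\ell}:=\psi$ for $|\ell|\le r_j$. (3) For all $h\in\mathscr{D}(\mathbb{R}^2)$, $$\lim_{j\to\infty}\big\langle|\varphi^j(N_\lambda^j\cdot)|^2,h\big\rangle=\langle1,h\rangle,$$ and for all integers $j\ge J_0$ and all $k\in[M_\lambda^{j}\mathbb{Z}^2]\cup[M_\lambda^{j+1}\mathbb{Z}^2]\cup[A_\lambda^j\mathbb{Z}^2]\cup[EA_\lambda^j\mathbb{Z}^2]$, $$\mathcal{I}_{\varphi^j}^{N_\lambda^jk}(N_\lambda^j\xi)+\mathcal{I}_{\Psi_j}^{B_\lambda^jk}(B_\lambda^j\xi)+\mathcal{I}_{\Psi_j}^{B_\lambda^jEk}(B_\lambda^jE\xi)=\mathcal{I}_{\varphi^{j+1}}^{N_\lambda^{j+1}k}(N_\lambda^{j+1}\xi)\quad\text{for a.e. }\xi\in\mathbb{R}^2.$$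
   Context: Matrices: $E=\begin{bmatrix}0&1\\1&0\end{bmatrix}$, $S_\tau=\begin{bmatrix}1&0\\ \tau&1\end{bmatrix}$, $A_\lambda=\mathrm{diag}(\lambda^2,\lambda)$, $B_\lambda=\mathrm{diag}(\lambda^{-2},\lambda^{-1})$, $M_\lambda=\lambda^2I_2$, $N_\lambda=\lambda^{-2}I_2$. For a function $f$ on $\mathbb{R}^2$, an invertible real $2\times2$ matrix $U$ and $k\in\mathbb{R}^2$: $f_{U;0,k}(\xi):=|\det U|^{1/2}f(U\xi)e^{-ik\cdot U\xi}$. $\langle f,g\rangle=\int_{\mathbb{R}^2} f\overline{g}$. $L_2^{loc}(\mathbb{R}^2)$: measurable functions square integrable on every compact set. $\mathscr{D}(\mathbb{R}^2)$: compactly supported $C^\infty$ functions. Generators: for each integer $j\ge J_0$ let $0\le r_j\le s_j$ be integers; $\varphi^j$ ($j\ge J_0$), $\psi$, and $\psi^{j,\ell}$ ($j\ge J_0$, $r_j+1\le|\ell|\le s_j$) are functions in $L_2^{loc}(\mathbb{R}^2)$; put $\psi^{j,\ell}:=\psi$ for $|\ell|\le r_j$. Define $\Psi_j:=\{\psi(S_\ell\cdot):|\ell|\le r_j\}\cup\{\psi^{j,\ell}(S_\ell\cdot): r_j+1\le|\ell|\le s_j\}$ (a family indexed by $\ell=-s_j,\dots,s_j$) and $$\mathrm{FAS}_J(\varphi^J;\{\Psi_j\}_{j=J}^\infty):=\{\varphi^J_{N_\lambda^J;0,k}:k\in\mathbb{Z}^2\}\cup\{h_{B_\lambda^j;0,k},\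 h_{B_\lambda^jE;0,k}:k\in\mathbb{Z}^2,\ h\in\Psi_j\}_{j=J}^\infty.$$ For $k\in\mathbb{Z}^2$: $\mathcal{I}_{\varphi^j}^k(\xi):=\overline{\varphi^j(\xi)}\varphi^j(\xi+2\pi k)$ and $\mathcal{I}_{\Psi_j}^k(\xi):=\sum_{\ell=-s_j}^{s_j}\overline{\psi^{j,\ell}(S_\ell\xi)}\,\psi^{j,\ell}(S_\ell(\xi+2\pi k))$. For $k\in\mathbb{R}^2\setminus\mathbb{Z}^2$ both are defined to be $0$. *)

theory Defs
  imports "HOL-Analysis.Analysis"
begin

type_synonym plane = "real^2"
type_synonym matrix2 = "real^2^2"

definition E_mat :: matrix2
  where "E_mat = vector [vector [0, 1], vector [1, 0]]"

definition S_mat :: "real \<Rightarrow> matrix2"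
  where "S_mat \<tau> = vector [vector [1, 0], vector [\<tau>, 1]]"

definition A_mat :: "real \<Rightarrow> matrix2"
  where "A_mat lam = vector [vector [lam\<^sup>2, 0], vector [0, lam]]"

definition B_mat :: "real \<Rightarrow> matrix2"
  where "B_mat lam = vector [vector [lam powi (-2), 0], vector [0, lam powi (-1)]]"

definition M_mat :: "real \<Rightarrow> matrix2"
  where "M_mat lam = lam\<^sup>2 *\<^sub>R mat 1"

definition N_mat :: "real \<Rightarrow> matrix2"
  where "N_mat lam = lam powi (-2) *\<^sub>R mat 1"

text \<open>
  Integer powers with respect to the matrix product \<open>**\<close>: multiplication \<open>*\<close> on the
  type of matrices is componentwise, so \<open>^\<close> would be the wrong power.
\<close>

definition mat_powi :: "matrix2 \<Rightarrow> int \<Rightarrow> matrix2"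
  where "mat_powi U j =
    (if 0 \<le> j then ((\<lambda>X. U ** X) ^^ nat j) (mat 1)
     else ((\<lambda>X. matrix_inv U ** X) ^^ nat (- j)) (mat 1))"

definition Z2 :: "plane set"
  where "Z2 = {k. \<forall>i. k $ i \<in> \<int>}"

definition L2 :: "(plane \<Rightarrow> complex) set"
  where "L2 = {f. f \<in> borel_measurable lebesgue \<and>
    integrable lebesgue (\<lambda>x. (cmod (f x))\<^sup>2)}"

definition L2_loc :: "(plane \<Rightarrow> complex) set"
  where "L2_loc = {f. f \<in> borel_measurable lebesgue \<and>
    (\<forall>K. compact K \<longrightarrow> set_integrable lebesgue K (\<lambda>x. (cmod (f x))\<^sup>2))}"

primrec Ck :: "nat \<Rightarrow> (plane \<Rightarrow> complex) \<Rightarrow> bool"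
  where
    "Ck 0 f \<longleftrightarrow> continuous_on UNIV f"
  | "Ck (Suc n) f \<longleftrightarrow> (\<forall>x. f differentiable (at x)) \<and>
      (\<forall>v\<in>Basis. Ck n (\<lambda>x. frechet_derivative f (at x) v))"

definition test_functions :: "(plane \<Rightarrow> complex) set"
  where "test_functions = {f. (\<forall>n. Ck n f) \<and> compact (closure {x. f x \<noteq> 0})}"

definition inner_prod :: "(plane \<Rightarrow> complex) \<Rightarrow> (plane \<Rightarrow> complex) \<Rightarrow> complex"
  where "inner_prod f g = (LINT x|lebesgue. f x * cnj (g x))"

definition norm2_sq :: "(plane \<Rightarrow> complex) \<Rightarrow> real"
  where "norm2_sq f = (LINT x|lebesgue. (cmod (f x))\<^sup>2)"

text \<open>\<open>dilmod U k f\<close> is the function $f_{U;0,k}$.\<close>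

definition dilmod :: "matrix2 \<Rightarrow> plane \<Rightarrow> (plane \<Rightarrow> complex) \<Rightarrow> plane \<Rightarrow> complex"
  where "dilmod U k f \<xi> =
    complex_of_real (sqrt \<bar>det U\<bar>) * f (U *v \<xi>) *
    exp (- \<i> * complex_of_real (k \<bullet> (U *v \<xi>)))"

text \<open>
  The sum over $k \in \mathbb{Z}^2$ of $|\langle f, g_{U;0,k}\rangle|^2$. Sums of squares are
  taken in \<^typ>\<open>ennreal\<close>, where every sum exists; over the reals \<^const>\<open>infsum\<close> of a
  divergent series would be \<open>0\<close>.
\<close>

definition coeff_sum :: "(plane \<Rightarrow> complex) \<Rightarrow> matrix2 \<Rightarrow> (plane \<Rightarrow> complex) \<Rightarrow> ennreal"
  where "coeff_sum f U g =
    (\<Sum>\<^sub>\<infinity>k\<in>Z2. ennreal ((cmod (inner_prod f (dilmod U k g)))\<^sup>2))"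

text \<open>
  \<open>shear_gen r \<psi> \<psi>s j l\<close> is $\psi^{j,\ell}$, extended by $\psi^{j,\ell} = \psi$
  for $|\ell| \le r_j$.
\<close>

definition shear_gen ::
  "(int \<Rightarrow> int) \<Rightarrow> (plane \<Rightarrow> complex) \<Rightarrow> (int \<Rightarrow> int \<Rightarrow> plane \<Rightarrow> complex) \<Rightarrow>
    int \<Rightarrow> int \<Rightarrow> plane \<Rightarrow> complex"
  where "shear_gen r \<psi> \<psi>s j l = (if \<bar>l\<bar> \<le> r j then \<psi> else \<psi>s j l)"

text \<open>
  From here on \<open>g j l\<close> stands for $\psi^{j,\ell}$, already extended to all $|\ell| \le s_j$.
  \<open>Psi g j l\<close>, with $-s_j \le \ell \le s_j$, is the member with index $\ell$ of the indexed
  family $\Psi_j$; members with different indices count separately even if they are equal.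
\<close>

definition Psi :: "(int \<Rightarrow> int \<Rightarrow> plane \<Rightarrow> complex) \<Rightarrow> int \<Rightarrow> int \<Rightarrow> plane \<Rightarrow> complex"
  where "Psi g j l = (\<lambda>\<xi>. g j l (S_mat (of_int l) *v \<xi>))"

definition FAS_tight_frame ::
  "real \<Rightarrow> (int \<Rightarrow> int) \<Rightarrow> (int \<Rightarrow> plane \<Rightarrow> complex) \<Rightarrow>
    (int \<Rightarrow> int \<Rightarrow> plane \<Rightarrow> complex) \<Rightarrow> int \<Rightarrow> bool"
  where "FAS_tight_frame lam s \<phi> g J \<longleftrightarrow>
    \<phi> J \<in> L2 \<and> (\<forall>j\<ge>J. \<forall>l\<in>{- s j..s j}. Psi g j l \<in> L2) \<and>
    (\<forall>f\<in>L2. ennreal ((2 * pi)\<^sup>2 * norm2_sq f) =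
      coeff_sum f (mat_powi (N_mat lam) J) (\<phi> J) +
      (\<Sum>\<^sub>\<infinity>j\<in>{J..}. \<Sum>l\<in>{- s j..s j}. \<Sum>\<^sub>\<infinity>k\<in>Z2.
        ennreal ((cmod (inner_prod f (dilmod (mat_powi (B_mat lam) j) k (Psi g j l))))\<^sup>2 +
          (cmod (inner_prod f (dilmod (mat_powi (B_mat lam) j ** E_mat) k (Psi g j l))))\<^sup>2)))"

definition I_phi :: "(int \<Rightarrow> plane \<Rightarrow> complex) \<Rightarrow> int \<Rightarrow> plane \<Rightarrow> plane \<Rightarrow> complex"
  where "I_phi \<phi> j k \<xi> =
    (if k \<in> Z2 then cnj (\<phi> j \<xi>) * \<phi> j (\<xi> + (2 * pi) *\<^sub>R k) else 0)"

definition I_Psi ::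
  "(int \<Rightarrow> int) \<Rightarrow> (int \<Rightarrow> int \<Rightarrow> plane \<Rightarrow> complex) \<Rightarrow> int \<Rightarrow> plane \<Rightarrow> plane \<Rightarrow> complex"
  where "I_Psi s g j k \<xi> =
    (if k \<in> Z2 then
       \<Sum>l\<in>{- s j..s j}. cnj (g j l (S_mat (of_int l) *v \<xi>)) *
         g j l (S_mat (of_int l) *v (\<xi> + (2 * pi) *\<^sub>R k))
     else 0)"

end

theory Submission
  imports Defs
begin

text \<open>
  The link between sums of squared inner products and pointwise identities is Parseval's identity
  on the torus. For a test function $f$, an invertible matrix $U$ and a locally square-integrable
  $g$, the numbers $\langle f, g_{U;0,k}\rangle$ are Fourier coefficients of a square-integrable
  function of bounded support, and Parseval's identity becomes
  \[ \sum_{k\in\mathbb{Z}^2} |\langle f, g_{U;0,k}\rangle|^2 = (2\pi)^2 \sum_{k\in U^{-1}\mathbb{Z}^2}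
     \int \overline{f(\xi)}\, f(\xi + 2\pi k)\, \overline{\mathcal{I}_g^{Uk}(U\xi)}\, d\xi, \]
  where only finitely many \<open>k\<close> contribute (\<open>coeff_sum_eq_pairing\<close>). Everything else is read
  off from this formula.

  The relation between consecutive levels in the second statement says that a sesquilinear form in
  $f$ vanishes on the diagonal, and the kernel of this form on the shift by $2\pi k$ is the
  difference of the two sides of the pointwise identity of the third statement. Polarizing, and
  testing with pairs of functions supported near a point and near its translate, isolates the
  kernel for a single $k$ and shows that it vanishes almost everywhere
  (\<open>energy_identity_iff_AE\<close>). For the limit relations, the lattice of the scaling functions
  becomes sparse as the level tends to infinity, so that only $k = 0$ survives and the energies
  are integrals of $|f|^2$ against the dilated squares $|\varphi^j|^2$ of the third statement
  (\<open>energy_limit_iff\<close>).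

  The first two statements are related by telescoping, which settles their equivalence on test
  functions (\<open>tight_frames_iff_mra\<close>). Two facts bridge the gap between test functions and
  square-integrable ones. A generator is square-integrable because its coefficient at $k = 0$
  alone is a bounded functional on test functions (\<open>Bessel_bound_L2\<close>). An identity between a
  sum of squared coefficients and a continuous quadratic expression passes to the closure by
  completeness of $\ell^2$ (\<open>square_sum_identity_extends\<close>).

  The latter theorem is used a second time to reduce Parseval's identity to test functions
  $F$. There it is proved by summing the Fourier series with a nonnegative trigonometric kernel
  that concentrates at the origin. The averages against the kernel converge to the autocorrelation
  sum of $F$; the weights that the kernel puts on the nonnegative squared coefficients are
  nonnegative, bounded by a common value and converge to it, so that the weighted sums converge to
  the full sum (\<open>parseval_test_function\<close>).
\<close>

section \<open>Smooth functions and bumps\<close>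

lemma Ck_SucI:
  assumes "\<And>x. (f has_derivative f' x) (at x)"
    and "\<And>v. v \<in> Basis \<Longrightarrow> Ck n (\<lambda>x. f' x v)"
  shows "Ck (Suc n) f"
proof -
  have "frechet_derivative f (at x) = f' x" for x
    using frechet_derivative_at[OF assms(1)] by simp
  then show ?thesis
    using assms by (auto simp: differentiable_def)
qed

lemma Ck_Suc_has_derivative:
  "Ck (Suc n) f \<Longrightarrow> (f has_derivative frechet_derivative f (at x)) (at x)"
  using frechet_derivative_works by auto

lemma Ck_SucD: "Ck (Suc n) f \<Longrightarrow> Ck n f"
proof (induction n arbitrary: f)
  case 0
  then show ?case
    by (auto intro!: continuous_at_imp_continuous_on differentiable_imp_continuous_within)
next
  case (Suc n)
  show ?case
    using Suc.prems by (simp only: Ck.simps(2)[of _ f]) (blast intro: Suc.IH)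
qed

lemma Ck_const: "Ck n (\<lambda>x. c)"
proof (induction n arbitrary: c)
  case (Suc n)
  show ?case
    by (rule Ck_SucI[where f' = "\<lambda>x v. 0"]) (auto intro: Suc)
qed simp

lemma Ck_add: "Ck n f \<Longrightarrow> Ck n g \<Longrightarrow> Ck n (\<lambda>x. f x + g x)"
proof (induction n arbitrary: f g)
  case 0
  then show ?case by (auto intro: continuous_intros)
next
  case (Suc n)
  show ?case
  proof (rule Ck_SucI)
    show "((\<lambda>x. f x + g x) has_derivative
        (\<lambda>v. frechet_derivative f (at x) v + frechet_derivative g (at x) v)) (at x)" for x
      using Suc.prems by (intro has_derivative_add Ck_Suc_has_derivative)
  qed (use Suc in auto)
qed

lemma Ck_mult: "Ck n f \<Longrightarrow> Ck n g \<Longrightarrow> Ck n (\<lambda>x. f x * g x)"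
proof (induction n arbitrary: f g)
  case 0
  then show ?case by (auto intro: continuous_intros)
next
  case (Suc n)
  show ?case
  proof (rule Ck_SucI)
    show "((\<lambda>x. f x * g x) has_derivative
        (\<lambda>v. f x * frechet_derivative g (at x) v + frechet_derivative f (at x) v * g x)) (at x)" for x
      using Suc.prems by (intro has_derivative_mult Ck_Suc_has_derivative)
    show "Ck n (\<lambda>x. f x * frechet_derivative g (at x) v + frechet_derivative f (at x) v * g x)"
      if "v \<in> Basis" for v
      using Suc.prems that by (intro Ck_add Suc.IH) (auto intro: Ck_SucD simp del: Ck.simps, auto)
  qed
qed

lemma Ck_inverse: "Ck n f \<Longrightarrow> (\<And>x. f x \<noteq> 0) \<Longrightarrow> Ck n (\<lambda>x. inverse (f x))"
proof (induction n arbitrary: f)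
  case 0
  then show ?case by (auto intro: continuous_intros)
next
  case (Suc n)
  have f: "Ck n (\<lambda>x. inverse (f x))"
    using Suc.IH[OF Ck_SucD[OF Suc.prems(1)] Suc.prems(2)] .
  show ?case
  proof (rule Ck_SucI)
    show "((\<lambda>x. inverse (f x)) has_derivative
        (\<lambda>v. - (inverse (f x) * frechet_derivative f (at x) v * inverse (f x)))) (at x)" for x
      using Suc.prems by (intro Deriv.has_derivative_inverse Ck_Suc_has_derivative)
    show "Ck n (\<lambda>x. - (inverse (f x) * frechet_derivative f (at x) v * inverse (f x)))"
      if "v \<in> Basis" for v
    proof -
      have "Ck n (\<lambda>x. - 1 * (inverse (f x) * frechet_derivative f (at x) v * inverse (f x)))"
        using Suc.prems that by (intro Ck_mult f Ck_const) auto
      then show ?thesis by simp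
    qed
  qed
qed

lemma Ck_prod:
  assumes "finite I" "\<And>i. i \<in> I \<Longrightarrow> Ck n (f i)"
  shows "Ck n (\<lambda>x. \<Prod>i\<in>I. f i x)"
  using assms by (induction I rule: finite_induct) (auto intro: Ck_const Ck_mult)

lemma Ck_linear_real:
  assumes "bounded_linear (f :: plane \<Rightarrow> real)"
  shows "Ck n (\<lambda>x. complex_of_real (f x))"
proof -
  have d: "((\<lambda>x. complex_of_real (f x)) has_derivative (\<lambda>v. complex_of_real (f v))) (at x)" for x
    by (intro has_derivative_of_real bounded_linear_imp_has_derivative assms)
  show ?thesis
  proof (cases n)
    case 0
    then show ?thesis
      using has_derivative_continuous[OF d] continuous_at_imp_continuous_on[of UNIV "\<lambda>x. complex_of_real (f x)"]
      by (simp only: Ck.simps) blast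
  next
    case (Suc m)
    show ?thesis
      unfolding Suc by (rule Ck_SucI[OF d]) (rule Ck_const)
  qed
qed

lemma Ck_polynomial_function:
  assumes "polynomial_function (f :: plane \<Rightarrow> complex)"
  shows "Ck n f"
proof -
  have real: "Ck n (\<lambda>x. complex_of_real (p x))" if "real_polynomial_function p" for p
    using that
    by (induction rule: real_polynomial_function.induct)
      (auto intro: Ck_linear_real Ck_const Ck_add Ck_mult)
  have "real_polynomial_function (\<lambda>x. Re (f x))" "real_polynomial_function (\<lambda>x. Im (f x))"
    using assms bounded_linear_Re bounded_linear_Im
    unfolding polynomial_function_def by (auto simp: o_def)
  then have "Ck n (\<lambda>x. complex_of_real (Re (f x)) + \<i> * complex_of_real (Im (f x)))"
    by (intro Ck_add Ck_mult Ck_const real)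
  then show ?thesis
    by (simp flip: complex_eq)
qed

text \<open>
  The functions $p(1/x)\,e^{-1/x}$ on the positive half-line, continued by zero. The polynomial
  \<open>p\<close> is kept as a parameter because the family as a whole is closed under differentiation.
\<close>

definition flat_exp :: "real poly \<Rightarrow> real \<Rightarrow> real"
  where "flat_exp p x = (if 0 < x then poly p (inverse x) * exp (- inverse x) else 0)"

lemma flat_exp_tendsto_0: "(flat_exp p \<longlongrightarrow> 0) (at 0)"
proof -
  have "((\<lambda>x. \<Sum>i\<le>degree p. coeff p i * (x ^ i / exp x)) \<longlongrightarrow> (\<Sum>i\<le>degree p. coeff p i * 0)) at_top"
    by (intro tendsto_intros tendsto_power_div_exp_0)
  then have "((\<lambda>x. poly p x * exp (- x)) \<longlongrightarrow> 0) at_top"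
    by (simp add: poly_altdef exp_minus divide_inverse sum_distrib_right mult.assoc)
  from filterlim_compose[OF this filterlim_inverse_at_top_right]
  have "((\<lambda>x. poly p (inverse x) * exp (- inverse x)) \<longlongrightarrow> 0) (at_right 0)" .
  then have r: "(flat_exp p \<longlongrightarrow> 0) (at_right 0)"
    by (rule Lim_transform_eventually)
      (auto simp: flat_exp_def eventually_at_right_less eventually_at_filter)
  have "eventually (\<lambda>x::real. 0 = flat_exp p x) (at_left 0)"
    by (auto simp: flat_exp_def eventually_at_filter)
  then have l: "(flat_exp p \<longlongrightarrow> 0) (at_left 0)"
    by (rule Lim_transform_eventually[OF tendsto_const])
  show ?thesis
    using r l by (simp add: filterlim_split_at)
qed

text \<open>
  The chain rule turns $p(1/x)\,e^{-1/x}$ into $q(1/x)\,e^{-1/x}$ with $q = X^2 (p - p')$.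
\<close>

definition flat_deriv :: "real poly \<Rightarrow> real poly"
  where "flat_deriv p = [:0, 0, 1:] * (p - pderiv p)"

text \<open>
  The only delicate point is $0$. There the difference quotient of the member belonging to
  \<open>p\<close> is the member belonging to $X p$, and every member tends to $0$ at $0$.
\<close>

lemma flat_exp_has_derivative:
  "(flat_exp p has_real_derivative flat_exp (flat_deriv p) x) (at x)"
proof (cases x "0::real" rule: linorder_cases)
  case less
  have "((\<lambda>x. 0) has_real_derivative 0) (at x)" by simp
  then have "(flat_exp p has_real_derivative 0) (at x)"
    by (rule has_field_derivative_transform_within_open[where S = "{..<0}"])
      (use less in \<open>auto simp: flat_exp_def\<close>)
  then show ?thesis using less by (simp add: flat_exp_def)
next
  case greater
  have "((\<lambda>x. poly p (inverse x) * exp (- inverse x)) has_real_derivative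
      poly (flat_deriv p) (inverse x) * exp (- inverse x)) (at x)"
    using greater
    by (auto intro!: derivative_eq_intros DERIV_chain2[OF poly_DERIV]
        simp: flat_deriv_def power2_eq_square algebra_simps)
  then have "(flat_exp p has_real_derivative poly (flat_deriv p) (inverse x) * exp (- inverse x)) (at x)"
    by (rule has_field_derivative_transform_within_open[where S = "{0<..}"])
      (use greater in \<open>auto simp: flat_exp_def\<close>)
  then show ?thesis using greater by (simp add: flat_exp_def)
next
  case equal
  have "(\<lambda>y. (flat_exp p y - flat_exp p 0) / (y - 0)) = flat_exp ([:0, 1:] * p)"
    by (auto simp: flat_exp_def fun_eq_iff field_simps)
  then have "(flat_exp p has_real_derivative 0) (at 0)"
    using flat_exp_tendsto_0 by (simp add: has_field_derivative_iff)
  then show ?thesis using equal by (simp add: flat_exp_def)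
qed

text \<open>
  A partial derivative is a constant multiple of the member belonging to \<open>flat_deriv p\<close>, so
  the induction on \<open>n\<close> has to run over all polynomials at once.
\<close>

lemma Ck_flat_exp: "Ck n (\<lambda>x. complex_of_real (flat_exp p (c * x $ i + d)))"
proof (induction n arbitrary: p)
  case 0
  have "continuous_on UNIV (flat_exp p)"
    using flat_exp_has_derivative DERIV_isCont by (blast intro: continuous_at_imp_continuous_on)
  then have "continuous_on UNIV (\<lambda>x::plane. flat_exp p (c * x $ i + d))"
    by (rule continuous_on_compose2) (auto intro!: continuous_intros)
  then show ?case by (auto intro: continuous_intros)
next
  case (Suc n)
  show ?case
  proof (rule Ck_SucI)
    fix x :: plane
    have "((\<lambda>x::plane. c * x $ i + d) has_derivative (\<lambda>v. c * v $ i)) (at x)"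
      by (auto intro!: derivative_eq_intros bounded_linear_imp_has_derivative bounded_linear_vec_nth)
    from has_derivative_compose[OF this flat_exp_has_derivative[unfolded has_field_derivative_def]]
    show "((\<lambda>x. complex_of_real (flat_exp p (c * x $ i + d))) has_derivative
        (\<lambda>v. complex_of_real (flat_exp (flat_deriv p) (c * x $ i + d)) *
           complex_of_real (c * v $ i))) (at x)"
      by (intro has_derivative_of_real[THEN has_derivative_eq_rhs]) auto
  qed (intro Ck_mult Suc Ck_const)
qed

definition smooth_step :: "real \<Rightarrow> real"
  where "smooth_step t = flat_exp 1 t / (flat_exp 1 t + flat_exp 1 (1 - t))"

lemma flat_exp_1: "0 \<le> flat_exp 1 t" "0 < t \<Longrightarrow> 0 < flat_exp 1 t" "t \<le> 0 \<Longrightarrow> flat_exp 1 t = 0"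
  by (auto simp: flat_exp_def)

lemma smooth_step_denominator: "0 < flat_exp 1 t + flat_exp 1 (1 - t)"
  using flat_exp_1[of t] flat_exp_1[of "1 - t"] by (cases "0 < t") (auto intro: add_pos_nonneg add_nonneg_pos)

lemma smooth_step_eqs: "1 \<le> t \<Longrightarrow> smooth_step t = 1" "t \<le> 0 \<Longrightarrow> smooth_step t = 0"
  using flat_exp_1(2)[of t] by (force simp: smooth_step_def flat_exp_1(3))+

lemma smooth_step_bounds: "0 \<le> smooth_step t" "smooth_step t \<le> 1"
  using smooth_step_denominator[of t] flat_exp_1(1)[of t] flat_exp_1(1)[of "1 - t"]
  by (auto simp: smooth_step_def divide_simps)

lemma Ck_smooth_step: "Ck n (\<lambda>x. complex_of_real (smooth_step (c * x $ i + d)))"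
proof -
  have "Ck n (\<lambda>x. complex_of_real (flat_exp 1 (c * x $ i + d)) *
      inverse (complex_of_real (flat_exp 1 (c * x $ i + d)) +
        complex_of_real (flat_exp 1 ((- c) * x $ i + (1 - d)))))"
  proof (intro Ck_mult Ck_inverse Ck_add Ck_flat_exp)
    fix x :: plane
    show "complex_of_real (flat_exp 1 (c * x $ i + d)) +
        complex_of_real (flat_exp 1 ((- c) * x $ i + (1 - d))) \<noteq> 0"
      using smooth_step_denominator[of "c * x $ i + d"]
      by (simp flip: of_real_add add: algebra_simps del: of_real_add)
  qed
  then show ?thesis
    by (simp add: smooth_step_def divide_inverse algebra_simps)
qed

text \<open>
  This one family serves both purposes of bump functions. For growing \<open>c\<close> it approximates the
  indicator of the open box, and for a fixed \<open>c\<close> it equals $1$ at every point of the box whose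
  distance from each face is at least $1/c$.
\<close>

definition box_bump :: "real \<Rightarrow> plane \<Rightarrow> plane \<Rightarrow> plane \<Rightarrow> real"
  where "box_bump c a b x =
    (\<Prod>i\<in>UNIV. smooth_step (c * (x $ i - a $ i)) * smooth_step (c * (b $ i - x $ i)))"

lemma Ck_box_bump: "Ck n (\<lambda>x. complex_of_real (box_bump c a b x))"
proof -
  have "Ck n (\<lambda>x. \<Prod>i\<in>UNIV. complex_of_real (smooth_step (c * x $ i + (- c * a $ i))) *
      complex_of_real (smooth_step ((- c) * x $ i + c * b $ i)))"
    by (intro Ck_prod Ck_mult Ck_smooth_step) auto
  then show ?thesis
    by (simp add: box_bump_def algebra_simps)
qed

lemma box_bump_bounds: "0 \<le> box_bump c a b x" "box_bump c a b x \<le> 1"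
  unfolding box_bump_def
  by (intro prod_nonneg prod_le_1 ballI conjI mult_nonneg_nonneg mult_le_one smooth_step_bounds)+

lemma box_bump_eq_0:
  assumes "0 \<le> c" "x \<notin> box a b"
  shows "box_bump c a b x = 0"
proof -
  obtain i where "x $ i \<le> a $ i \<or> b $ i \<le> x $ i"
    using assms(2) by (auto simp: mem_box_cart not_less)
  then have "smooth_step (c * (x $ i - a $ i)) * smooth_step (c * (b $ i - x $ i)) = 0"
    using assms(1) by (auto simp: smooth_step_eqs mult_nonneg_nonpos)
  then show ?thesis
    unfolding box_bump_def by (intro prod_zero) auto
qed

lemma box_bump_eq_1:
  assumes "\<And>i. 1 \<le> c * (x $ i - a $ i)" "\<And>i. 1 \<le> c * (b $ i - x $ i)"
  shows "box_bump c a b x = 1"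
  using assms by (simp add: box_bump_def smooth_step_eqs)

lemma box_bump_tendsto_1:
  assumes "x \<in> box a b"
  shows "(\<lambda>n. box_bump (real n) a b x) \<longlonglongrightarrow> 1"
proof -
  have ev: "eventually (\<lambda>n. 1 \<le> real n * t) sequentially" if "0 < t" for t :: real
    using that by real_asymp
  have "eventually (\<lambda>n. \<forall>i\<in>UNIV. 1 \<le> real n * (x $ i - a $ i) \<and> 1 \<le> real n * (b $ i - x $ i)) sequentially"
    using assms by (intro eventually_ball_finite ballI eventually_conj ev) (auto simp: mem_box_cart)
  then have "eventually (\<lambda>n. 1 = box_bump (real n) a b x) sequentially"
    by eventually_elim (simp add: box_bump_eq_1)
  then show ?thesis
    by (rule Lim_transform_eventually[OF tendsto_const])
qed

lemma test_functionI:
  assumes "\<And>n. Ck n f" "\<And>x. x \<notin> cbox a b \<Longrightarrow> f x = 0"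
  shows "f \<in> test_functions"
proof -
  have "closure {x. f x \<noteq> 0} \<subseteq> cbox a b"
    by (rule closure_minimal) (use assms(2) in auto)
  then have "compact (closure {x. f x \<noteq> 0})"
    by (meson bounded_cbox bounded_subset closed_closure compact_eq_bounded_closed)
  then show ?thesis using assms by (simp add: test_functions_def)
qed

lemma test_function_box_bound:
  assumes "f \<in> test_functions"
  obtains a b where "\<And>x. x \<notin> box a b \<Longrightarrow> f x = 0"
proof -
  have "bounded {x. f x \<noteq> 0}"
    using assms bounded_subset[OF compact_imp_bounded closure_subset]
    by (auto simp: test_functions_def)
  then obtain a where "{x. f x \<noteq> 0} \<subseteq> box (- a) a"
    using bounded_subset_box_symmetric by blast
  then show ?thesis by (intro that[of "- a" a]) auto
qed

lemma box_bump_test_function: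
  assumes "0 \<le> c"
  shows "(\<lambda>x. complex_of_real (box_bump c a b x)) \<in> test_functions"
  using box_bump_eq_0[OF assms] box_subset_cbox[of a b]
  by (intro test_functionI[where a = a and b = b] Ck_box_bump) auto

lemma test_functions_add:
  assumes "f \<in> test_functions" "g \<in> test_functions"
  shows "(\<lambda>x. f x + g x) \<in> test_functions"
proof -
  have "closure {x. f x + g x \<noteq> 0} \<subseteq> closure {x. f x \<noteq> 0} \<union> closure {x. g x \<noteq> 0}"
    unfolding closure_Un[symmetric] by (rule closure_mono) auto
  then have "compact (closure {x. f x + g x \<noteq> 0})"
    using assms compact_Un
    by (metis (mono_tags, lifting) bounded_subset closed_closure compact_eq_bounded_closed mem_Collect_eq test_functions_def)
  then show ?thesis
    using assms by (auto simp: test_functions_def intro: Ck_add)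
qed

lemma test_functions_mult:
  assumes "f \<in> test_functions" "\<And>n. Ck n g"
  shows "(\<lambda>x. f x * g x) \<in> test_functions"
proof -
  obtain a b where "\<And>x. x \<notin> box a b \<Longrightarrow> f x = 0" using test_function_box_bound[OF assms(1)] by blast
  then show ?thesis
    using assms box_subset_cbox[of a b]
    by (intro test_functionI[where a = a and b = b] Ck_mult) (auto simp: test_functions_def)
qed

lemma test_functions_cmult: "f \<in> test_functions \<Longrightarrow> (\<lambda>x. c * f x) \<in> test_functions"
  using test_functions_mult[OF _ Ck_const, of f c] by (simp add: mult.commute)

lemma test_functions_diff:
  assumes "f \<in> test_functions" "g \<in> test_functions"
  shows "(\<lambda>x. f x - g x) \<in> test_functions"
  using test_functions_add[OF assms(1) test_functions_cmult[OF assms(2), of "-1"]] by simp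

lemma Ck_cnj: "Ck n f \<Longrightarrow> Ck n (\<lambda>x. cnj (f x))"
proof (induction n arbitrary: f)
  case 0
  then show ?case by (auto intro: continuous_intros)
next
  case (Suc n)
  show ?case
    by (rule Ck_SucI[OF has_derivative_cnj[OF Ck_Suc_has_derivative[OF Suc.prems]]])
      (use Suc in auto)
qed

lemma test_function_continuous: "f \<in> test_functions \<Longrightarrow> continuous_on UNIV f"
  unfolding test_functions_def using Ck.simps(1) by blast

section \<open>Linear changes of variable\<close>

lemma matrix_inv_mult:
  fixes U :: matrix2
  assumes "invertible U"
  shows "U ** matrix_inv U = mat 1" "matrix_inv U ** U = mat 1"
  using assms someI_ex[of "\<lambda>V. U ** V = mat 1 \<and> V ** U = mat 1"]
  unfolding invertible_def matrix_inv_def by auto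

lemma borel_measurable_cnj [measurable]: "cnj \<in> borel \<rightarrow>\<^sub>M borel"
  by (intro borel_measurable_continuous_onI continuous_intros)

lemma borel_measurable_id_lebesgue [measurable]: "(\<lambda>x::plane. x) \<in> borel_measurable lebesgue"
  by (intro measurable_completion) simp

lemma measurable_mult_vec_borel [measurable]: "(*v) (U :: matrix2) \<in> borel \<rightarrow>\<^sub>M borel"
  by (intro borel_measurable_continuous_onI linear_continuous_on matrix_vector_mul_bounded_linear)

text \<open>
  The two measures agree on boxes: the preimage of a box under \<open>U\<close> is its image under the
  inverse matrix, and linear images scale volume by the absolute value of the determinant.
\<close>

lemma lborel_linear:
  fixes U :: matrix2
  assumes U: "invertible U"
  shows "lborel = density (distr lborel borel ((*v) U)) (\<lambda>_. ennreal \<bar>det U\<bar>)"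
proof (rule lborel_eqI)
  fix l u :: plane
  assume lu: "\<And>b. b \<in> Basis \<Longrightarrow> l \<bullet> b \<le> u \<bullet> b"
  have inv: "U ** matrix_inv U = mat 1" "matrix_inv U ** U = mat 1"
    using matrix_inv_mult[OF U] by auto
  have det: "\<bar>det U\<bar> * \<bar>det (matrix_inv U)\<bar> = 1"
    using arg_cong[OF inv(1), of det] by (simp add: det_mul det_I flip: abs_mult)
  have "(*v) U -` box l u = (*v) (matrix_inv U) ` box l u"
  proof (intro set_eqI iffI)
    fix x assume "x \<in> (*v) U -` box l u"
    then have "U *v x \<in> box l u" "x = matrix_inv U *v (U *v x)"
      by (auto simp: matrix_vector_mul_assoc inv)
    then show "x \<in> (*v) (matrix_inv U) ` box l u" by blast
  qed (auto simp: matrix_vector_mul_assoc inv)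
  then have "emeasure lborel ((*v) U -` box l u) = emeasure lebesgue ((*v) (matrix_inv U) ` box l u)"
    using measurable_sets[OF measurable_mult_vec_borel[of U], of "box l u"] by simp
  also have "\<dots> = ennreal (measure lebesgue ((*v) (matrix_inv U) ` box l u))"
    using measurable_linear_image[of "(*v) (matrix_inv U)" "box l u"]
    by (intro emeasure_eq_measure2) simp_all
  also have "\<dots> = ennreal (\<bar>det (matrix_inv U)\<bar> * measure lebesgue (box l u))"
    by (subst measure_linear_image) (auto simp: matrix_of_matrix_vector_mul)
  finally have "ennreal \<bar>det U\<bar> * emeasure lborel ((*v) U -` box l u) =
      ennreal (\<bar>det U\<bar> * \<bar>det (matrix_inv U)\<bar> * measure lebesgue (box l u))"
    by (simp add: ennreal_mult[symmetric] mult.assoc del: ennreal_mult')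
  also have "\<dots> = (\<Prod>b\<in>Basis. (u - l) \<bullet> b)"
    using lu by (simp add: det measure_lborel_box)
  finally show "emeasure (density (distr lborel borel ((*v) U)) (\<lambda>_. ennreal \<bar>det U\<bar>)) (box l u)
      = (\<Prod>b\<in>Basis. (u - l) \<bullet> b)"
    by (simp add: emeasure_density_const emeasure_distr)
qed simp

lemma
  fixes U :: matrix2
  assumes U: "invertible U"
  shows lebesgue_linear:
      "lebesgue = density (distr lebesgue lebesgue ((*v) U)) (\<lambda>_. ennreal \<bar>det U\<bar>)" (is "_ = ?D")
    and measurable_linear_lebesgue: "(*v) U \<in> lebesgue \<rightarrow>\<^sub>M lebesgue"
proof -
  let ?T = "(*v) U"
  have d: "0 < \<bar>det U\<bar>" using U by (simp add: invertible_det_nz)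
  { fix A :: "plane set" assume A: "A \<in> sets borel"
    then have "emeasure lborel A = 0 \<longleftrightarrow> emeasure (density (distr lborel borel ?T) (\<lambda>_. ennreal \<bar>det U\<bar>)) A = 0"
      by (subst lborel_linear[OF U]) auto
    also have "\<dots> \<longleftrightarrow> emeasure (distr lebesgue lborel ?T) A = 0"
      using A d by (simp add: distr_completion emeasure_density nn_integral_cmult cong: distr_cong)
    finally have "emeasure lborel A = 0 \<longleftrightarrow> emeasure (distr lebesgue lborel ?T) A = 0" . }
  then have eq: "null_sets lborel = null_sets (distr lebesgue lborel ?T)"
    by (auto simp: null_sets_def)
  show "?T \<in> lebesgue \<rightarrow>\<^sub>M lebesgue"
    by (simp add: completion.measurable_completion2 eq measurable_completion)
  have "lebesgue = completion (density (distr lborel borel ?T) (\<lambda>_. ennreal \<bar>det U\<bar>))"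
    by (subst lborel_linear[OF U]) simp_all
  also have "\<dots> = density (completion (distr lebesgue lborel ?T)) (\<lambda>_. ennreal \<bar>det U\<bar>)"
    using d by (auto intro!: always_eventually completion_density_eq simp: distr_completion cong: distr_cong)
  also have "\<dots> = density (distr lebesgue lebesgue ?T) (\<lambda>_. ennreal \<bar>det U\<bar>)"
    by (subst completion.completion_distr_eq) (auto simp: eq measurable_completion)
  finally show "lebesgue = ?D" .
qed

lemma borel_measurable_linear:
  fixes f :: "plane \<Rightarrow> 'b::topological_space" and U :: matrix2
  assumes "invertible U" "f \<in> borel_measurable lebesgue"
  shows "(\<lambda>x. f (U *v x)) \<in> borel_measurable lebesgue"
  using measurable_compose[OF measurable_linear_lebesgue[OF assms(1)] assms(2)] .

lemma
  fixes f :: "plane \<Rightarrow> 'b::{banach, second_countable_topology}" and U :: matrix2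
  assumes U: "invertible U" and f: "f \<in> borel_measurable lebesgue"
  shows integrable_linear_iff: "integrable lebesgue (\<lambda>x. f (U *v x)) \<longleftrightarrow> integrable lebesgue f"
    and integral_linear: "(LINT x|lebesgue. f x) = \<bar>det U\<bar> *\<^sub>R (LINT x|lebesgue. f (U *v x))"
proof -
  have d: "det U \<noteq> 0" using U by (simp add: invertible_det_nz)
  note [measurable] = f measurable_linear_lebesgue[OF U]
  have "integrable lebesgue f \<longleftrightarrow>
      integrable (density (distr lebesgue lebesgue ((*v) U)) (\<lambda>_. ennreal \<bar>det U\<bar>)) f"
    using lebesgue_linear[OF U] by simp
  also have "\<dots> \<longleftrightarrow> integrable lebesgue (\<lambda>x. f (U *v x))"
  proof -
    have "integrable lebesgue (\<lambda>x. \<bar>det U\<bar> *\<^sub>R f (U *v x)) \<longleftrightarrow> integrable lebesgue (\<lambda>x. f (U *v x))"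
      using integrable_scaleR_right[of "inverse \<bar>det U\<bar>" lebesgue "\<lambda>x. \<bar>det U\<bar> *\<^sub>R f (U *v x)"] d
      by auto
    then show ?thesis by (simp add: integrable_density integrable_distr_eq)
  qed
  finally show "integrable lebesgue (\<lambda>x. f (U *v x)) \<longleftrightarrow> integrable lebesgue f" ..
  have "(LINT x|lebesgue. f x) =
      (LINT x|density (distr lebesgue lebesgue ((*v) U)) (\<lambda>_. ennreal \<bar>det U\<bar>). f x)"
    using lebesgue_linear[OF U] by simp
  also have "\<dots> = \<bar>det U\<bar> *\<^sub>R (LINT x|lebesgue. f (U *v x))"
    by (simp add: integral_density integral_distr)
  finally show "(LINT x|lebesgue. f x) = \<bar>det U\<bar> *\<^sub>R (LINT x|lebesgue. f (U *v x))" .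
qed

lemma
  fixes t :: plane
  shows lebesgue_translation: "lebesgue = distr lebesgue lebesgue (\<lambda>x. x + t)"
    and measurable_translation_lebesgue: "(\<lambda>x. x + t) \<in> lebesgue \<rightarrow>\<^sub>M lebesgue"
  using lebesgue_affine_euclidean[of "\<lambda>_. 1" t] lebesgue_affine_measurable[of "\<lambda>_. 1" t]
  by (simp_all add: euclidean_representation density_1 add.commute)

lemma borel_measurable_translation:
  fixes f :: "plane \<Rightarrow> 'b::topological_space"
  assumes "f \<in> borel_measurable lebesgue"
  shows "(\<lambda>x. f (x + t)) \<in> borel_measurable lebesgue"
  using measurable_compose[OF measurable_translation_lebesgue assms] .

lemma
  fixes f :: "plane \<Rightarrow> 'b::{banach, second_countable_topology}"
  assumes f: "f \<in> borel_measurable lebesgue"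
  shows integrable_translation_iff: "integrable lebesgue (\<lambda>x. f (x + t)) \<longleftrightarrow> integrable lebesgue f"
    and integral_translation: "(LINT x|lebesgue. f (x + t)) = (LINT x|lebesgue. f x)"
  using integrable_distr_eq[OF measurable_translation_lebesgue f, of t]
    integral_distr[OF measurable_translation_lebesgue f, of t]
  by (simp_all flip: lebesgue_translation)

lemma AE_translation:
  fixes t :: plane
  assumes "AE x in lebesgue. P x"
  shows "AE x in lebesgue. P (x + t)"
proof (rule AE_distrD[OF measurable_translation_lebesgue])
  show "AE x in distr lebesgue lebesgue (\<lambda>x. x + t). P x"
    by (subst lebesgue_translation[symmetric]) (rule assms)
qed

section \<open>Square-integrable functions\<close>

lemma L2D:
  assumes "f \<in> L2"
  shows "f \<in> borel_measurable lebesgue" "integrable lebesgue (\<lambda>x. (cmod (f x))\<^sup>2)"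
  using assms by (auto simp: L2_def)

lemma L2_dominated:
  assumes "f \<in> borel_measurable lebesgue" "integrable lebesgue (\<lambda>x. (D x)\<^sup>2)" "\<And>x. cmod (f x) \<le> D x"
  shows "f \<in> L2"
proof -
  have "integrable lebesgue (\<lambda>x. (cmod (f x))\<^sup>2)"
    by (rule Bochner_Integration.integrable_bound[OF assms(2)])
      (use assms in \<open>auto intro!: AE_I2 power_mono\<close>)
  then show ?thesis using assms by (simp add: L2_def)
qed

lemma cmod_diff_square_le: "(cmod (z - w))\<^sup>2 \<le> 2 * (cmod z)\<^sup>2 + 2 * (cmod w)\<^sup>2"
proof -
  have "(cmod (z - w))\<^sup>2 \<le> (cmod z + cmod w)\<^sup>2"
    by (intro power_mono norm_triangle_ineq4) auto
  also have "\<dots> \<le> 2 * (cmod z)\<^sup>2 + 2 * (cmod w)\<^sup>2"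
    using sum_squares_bound[of "cmod z" "cmod w"] by (simp add: power2_sum)
  finally show ?thesis .
qed

lemma L2_diff:
  assumes "f \<in> L2" "g \<in> L2"
  shows "(\<lambda>x. f x - g x) \<in> L2"
proof -
  note [measurable] = L2D(1)[OF assms(1)] L2D(1)[OF assms(2)]
  have "integrable lebesgue (\<lambda>x. 2 * (cmod (f x))\<^sup>2 + 2 * (cmod (g x))\<^sup>2)"
    using L2D(2)[OF assms(1)] L2D(2)[OF assms(2)] by simp
  then have "integrable lebesgue (\<lambda>x. (cmod (f x - g x))\<^sup>2)"
    by (rule Bochner_Integration.integrable_bound) (auto intro!: AE_I2 cmod_diff_square_le)
  then show ?thesis by (simp add: L2_def)
qed

lemma integrable_mult_square:
  fixes u v :: "'a \<Rightarrow> real"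
  assumes "integrable M (\<lambda>x. (u x)\<^sup>2)" "integrable M (\<lambda>x. (v x)\<^sup>2)"
    and [measurable]: "u \<in> borel_measurable M" "v \<in> borel_measurable M"
  shows "integrable M (\<lambda>x. u x * v x)"
proof (rule Bochner_Integration.integrable_bound)
  show "integrable M (\<lambda>x. (u x)\<^sup>2 + (v x)\<^sup>2)" using assms by auto
  have "\<bar>u x * v x\<bar> \<le> (u x)\<^sup>2 + (v x)\<^sup>2" for x
    using sum_squares_bound[of "\<bar>u x\<bar>" "\<bar>v x\<bar>"] zero_le_power2[of "u x"] zero_le_power2[of "v x"]
    unfolding abs_mult power2_abs by linarith
  then show "AE x in M. norm (u x * v x) \<le> norm ((u x)\<^sup>2 + (v x)\<^sup>2)"
    by (auto intro!: AE_I2)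
qed measurable

lemma L2_integrable_mult:
  assumes "f \<in> L2" "g \<in> L2"
  shows "integrable lebesgue (\<lambda>x. f x * cnj (g x))"
proof -
  note [measurable] = L2D(1)[OF assms(1)] L2D(1)[OF assms(2)]
  have "integrable lebesgue (\<lambda>x. cmod (f x) * cmod (g x))"
    using L2D[OF assms(1)] L2D[OF assms(2)] by (intro integrable_mult_square) auto
  then show ?thesis
    by (rule Bochner_Integration.integrable_bound) (auto simp: norm_mult)
qed

lemma integrable_bounded_box:
  fixes f :: "plane \<Rightarrow> 'b::{banach, second_countable_topology}"
  assumes "f \<in> borel_measurable lebesgue" "\<And>x. norm (f x) \<le> B" "\<And>x. x \<notin> box a b \<Longrightarrow> f x = 0"
  shows "integrable lebesgue f"
proof -
  have "integrable lebesgue (\<lambda>x. indicat_real (box a b) x *\<^sub>R B)"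
    by (simp add: emeasure_lborel_box_eq)
  then show ?thesis
    by (rule Bochner_Integration.integrable_bound)
      (use assms in \<open>auto intro!: AE_I2 split: split_indicator intro: order_trans[OF _ abs_ge_self]\<close>)
qed

lemma test_function_bounded:
  assumes "f \<in> test_functions"
  obtains B where "\<And>x. cmod (f x) \<le> B"
proof -
  have "compact (closure {x. f x \<noteq> 0})"
    using assms unfolding test_functions_def by blast
  then have "bounded (f ` closure {x. f x \<noteq> 0})"
    by (rule compact_imp_bounded[OF compact_continuous_image[OF continuous_on_subset[OF test_function_continuous[OF assms] subset_UNIV]]])
  then obtain B where B: "\<forall>z\<in>f ` closure {x. f x \<noteq> 0}. cmod z \<le> B"
    unfolding bounded_iff by (elim exE)
  have "cmod (f x) \<le> max B 0" for x
  proof (cases "f x = 0")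
    case False
    then have "f x \<in> f ` closure {x. f x \<noteq> 0}"
      by (intro imageI subsetD[OF closure_subset]) simp
    from bspec[OF B this] show ?thesis by (rule max.coboundedI1)
  qed simp
  then show ?thesis by (rule that)
qed

lemma test_function_measurable: "f \<in> test_functions \<Longrightarrow> f \<in> borel_measurable lebesgue"
  by (intro measurable_completion) (simp add: borel_measurable_continuous_onI test_function_continuous)

lemma bounded_box_L2:
  assumes "f \<in> borel_measurable lebesgue" "\<And>x. cmod (f x) \<le> B" "\<And>x. x \<notin> box a b \<Longrightarrow> f x = 0"
  shows "f \<in> L2"
proof -
  note [measurable] = assms(1)
  have "integrable lebesgue (\<lambda>x. (cmod (f x))\<^sup>2)"
    by (rule integrable_bounded_box[where B = "B\<^sup>2" and a = a and b = b])
      (use assms in \<open>auto intro!: power_mono\<close>)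
  then show ?thesis using assms by (simp add: L2_def)
qed

lemma test_function_L2:
  assumes "f \<in> test_functions"
  shows "f \<in> L2"
proof -
  obtain a b where ab: "\<And>x. x \<notin> box a b \<Longrightarrow> f x = 0"
    using test_function_box_bound[OF assms] by blast
  obtain B where "\<And>x. cmod (f x) \<le> B"
    using test_function_bounded[OF assms] by blast
  then show ?thesis
    by (rule bounded_box_L2[OF test_function_measurable[OF assms] _ ab])
qed

text \<open>
  All extension arguments below pass to limits in this sense. With a square-integrable majorant,
  dominated convergence gives convergence of inner products with square-integrable functions, of
  norms, and of correlations, and a single majorant serves for all of them.
\<close>

definition dominated_limit ::
  "(nat \<Rightarrow> plane \<Rightarrow> complex) \<Rightarrow> (plane \<Rightarrow> complex) \<Rightarrow> (plane \<Rightarrow> real) \<Rightarrow> bool"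
  where "dominated_limit F f D \<longleftrightarrow>
    (\<forall>n. F n \<in> borel_measurable lebesgue) \<and> f \<in> borel_measurable lebesgue \<and>
    D \<in> borel_measurable lebesgue \<and> integrable lebesgue (\<lambda>x. (D x)\<^sup>2) \<and>
    (\<forall>n x. cmod (F n x) \<le> D x) \<and> (\<forall>x. cmod (f x) \<le> D x) \<and>
    (AE x in lebesgue. (\<lambda>n. F n x) \<longlonglongrightarrow> f x)"

lemma dominated_limitD:
  assumes "dominated_limit F f D"
  shows "F n \<in> borel_measurable lebesgue" "f \<in> borel_measurable lebesgue"
    "D \<in> borel_measurable lebesgue" "integrable lebesgue (\<lambda>x. (D x)\<^sup>2)"
    "cmod (F n x) \<le> D x" "cmod (f x) \<le> D x" "AE x in lebesgue. (\<lambda>n. F n x) \<longlonglongrightarrow> f x" "0 \<le> D x"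
  using assms by (auto simp: dominated_limit_def intro: order_trans[OF norm_ge_zero])

lemma dominated_limit_L2: "dominated_limit F f D \<Longrightarrow> F n \<in> L2" "dominated_limit F f D \<Longrightarrow> f \<in> L2"
  unfolding dominated_limit_def by (auto intro: L2_dominated)

lemma dominated_limit_norm2_sq:
  assumes "dominated_limit F f D"
  shows "(\<lambda>n. norm2_sq (F n)) \<longlonglongrightarrow> norm2_sq f"
  unfolding norm2_sq_def
proof (rule integral_dominated_convergence[where w = "\<lambda>x. (D x)\<^sup>2"])
  show "AE x in lebesgue. (\<lambda>n. (cmod (F n x))\<^sup>2) \<longlonglongrightarrow> (cmod (f x))\<^sup>2"
    using dominated_limitD(7)[OF assms] by eventually_elim (intro tendsto_intros)
qed (use dominated_limitD[OF assms] in \<open>auto intro!: AE_I2 power_mono\<close>)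

lemma dominated_limit_norm2_sq_diff:
  assumes "dominated_limit F f D"
  shows "(\<lambda>n. norm2_sq (\<lambda>x. F n x - f x)) \<longlonglongrightarrow> 0"
proof -
  have "dominated_limit (\<lambda>n x. F n x - f x) (\<lambda>x. 0) (\<lambda>x. 2 * D x)"
    unfolding dominated_limit_def
  proof (intro conjI allI)
    show "AE x in lebesgue. (\<lambda>n. F n x - f x) \<longlonglongrightarrow> 0"
      using dominated_limitD(7)[OF assms] by eventually_elim (simp add: LIM_zero)
    note * = dominated_limitD(5,6)[OF assms]
    show "cmod (F n x - f x) \<le> 2 * D x" for n x
      using norm_triangle_ineq4[of "F n x" "f x"] *(1)[of n x] *(2)[of x] by linarith
    show "cmod 0 \<le> 2 * D x" for x
      using dominated_limitD(8)[OF assms] by simp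
  qed (use dominated_limitD[OF assms] in \<open>auto simp: power_mult_distrib\<close>)
  from dominated_limit_norm2_sq[OF this] show ?thesis
    by (simp add: norm2_sq_def)
qed

lemma dominated_limit_inner_prod:
  assumes "dominated_limit F f D" "h \<in> L2"
  shows "(\<lambda>n. inner_prod (F n) h) \<longlonglongrightarrow> inner_prod f h"
  unfolding inner_prod_def
proof (rule integral_dominated_convergence[where w = "\<lambda>x. D x * cmod (h x)"])
  show "AE x in lebesgue. (\<lambda>n. F n x * cnj (h x)) \<longlonglongrightarrow> f x * cnj (h x)"
    using dominated_limitD(7)[OF assms(1)] by eventually_elim (intro tendsto_intros)
  show "integrable lebesgue (\<lambda>x. D x * cmod (h x))"
    using dominated_limitD[OF assms(1)] L2D[OF assms(2)] by (intro integrable_mult_square) auto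
  have [measurable]: "F n \<in> borel_measurable lebesgue" "f \<in> borel_measurable lebesgue"
    "h \<in> borel_measurable lebesgue" for n
    using dominated_limitD[OF assms(1)] L2D[OF assms(2)] by auto
  show "(\<lambda>x. f x * cnj (h x)) \<in> borel_measurable lebesgue"
    "(\<lambda>x. F n x * cnj (h x)) \<in> borel_measurable lebesgue" for n
    by measurable
qed (use dominated_limitD[OF assms(1)] in \<open>auto simp: norm_mult intro!: AE_I2 mult_right_mono\<close>)

lemma norm2_sq_nonneg: "0 \<le> norm2_sq f"
  unfolding norm2_sq_def by (rule Bochner_Integration.integral_nonneg) simp

lemma norm2_sq_diff_le:
  assumes "f \<in> L2" "g \<in> L2"
  shows "norm2_sq (\<lambda>x. f x - g x) \<le> 2 * norm2_sq f + 2 * norm2_sq g"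
proof -
  have "norm2_sq (\<lambda>x. f x - g x) \<le> (LINT x|lebesgue. 2 * (cmod (f x))\<^sup>2 + 2 * (cmod (g x))\<^sup>2)"
    unfolding norm2_sq_def
    using L2D(2)[OF assms(1)] L2D(2)[OF assms(2)] L2D(2)[OF L2_diff[OF assms]]
    by (intro integral_mono cmod_diff_square_le) auto
  also have "\<dots> = 2 * norm2_sq f + 2 * norm2_sq g"
    unfolding norm2_sq_def using L2D(2)[OF assms(1)] L2D(2)[OF assms(2)]
    by (subst Bochner_Integration.integral_add) auto
  finally show ?thesis .
qed

section \<open>Density of test functions\<close>

text \<open>
  A measurable function is almost everywhere a limit of continuous functions. Projecting their
  values to the disc of radius \<open>B\<close> keeps them bounded, the Stone-Weierstrass theorem replaces
  them by polynomials on the closed box, and multiplication by \<^const>\<open>box_bump\<close> makes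
  them test functions supported in the open box.
\<close>

lemma bounded_box_approx:
  assumes u: "u \<in> borel_measurable lebesgue" and B: "\<And>x. cmod (u x) \<le> B"
    and supp: "\<And>x. x \<notin> box a b \<Longrightarrow> u x = 0"
  obtains f where "\<And>n. f n \<in> test_functions" "\<And>n x. x \<notin> box a b \<Longrightarrow> f n x = 0"
    "\<And>n x. cmod (f n x) \<le> B + 1" "AE x in lebesgue. (\<lambda>n. f n x) \<longlonglongrightarrow> u x"
proof -
  have B0: "0 \<le> B" using B[of 0] norm_ge_zero[of "u 0"] by linarith
  have "u measurable_on UNIV"
    using u by (intro lebesgue_measurable_imp_measurable_on) auto
  then obtain N g where N: "negligible N" and g: "\<And>n. continuous_on UNIV (g n)"
    and gu: "\<And>x. x \<notin> N \<Longrightarrow> (\<lambda>n. g n x) \<longlonglongrightarrow> u x"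
    unfolding measurable_on_def by auto
  \<comment> \<open>the nearest-point projection is continuous and fixes the values of \<open>u\<close>\<close>
  define c where "c = closest_point (cball (0::complex) B)"
  have c: "continuous_on UNIV c"
    unfolding c_def using B0 by (intro continuous_on_closest_point) auto
  have cB: "cmod (c z) \<le> B" for z
    using closest_point_in_set[of "cball (0::complex) B" z] B0 by (simp add: c_def)
  have cu: "c (u x) = u x" for x
    using B[of x] by (simp add: c_def closest_point_self)
  have "\<exists>p. polynomial_function p \<and> (\<forall>x\<in>cbox a b. cmod (c (g n x) - p x) < inverse (real (Suc n)))" for n
    using continuous_on_compose2[OF c g[of n]]
    by (intro Stone_Weierstrass_polynomial_function) (auto intro: continuous_on_subset)
  then obtain p where p: "\<And>n. polynomial_function (p n)"
    "\<And>n x. x \<in> cbox a b \<Longrightarrow> cmod (c (g n x) - p n x) < inverse (real (Suc n))"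
    by metis
  define f where "f n x = complex_of_real (box_bump (real n) a b x) * p n x" for n x
  have f0: "f n x = 0" if "x \<notin> box a b" for n x
    using box_bump_eq_0[OF _ that] by (simp add: f_def)
  show ?thesis
  proof
    show "f n \<in> test_functions" for n
      unfolding f_def
      by (intro test_functions_mult box_bump_test_function Ck_polynomial_function p) auto
    show "f n x = 0" if "x \<notin> box a b" for n x by (rule f0[OF that])
    show "cmod (f n x) \<le> B + 1" for n x
    proof (cases "x \<in> box a b")
      case True
      then have "x \<in> cbox a b" using box_subset_cbox by blast
      then have "cmod (c (g n x) - p n x) < 1"
        using p(2)[of x n] by (smt (verit) inverse_le_1_iff of_nat_le_1_iff of_nat_Suc of_nat_0_le_iff)
      then have "cmod (p n x) \<le> B + 1"
        using cB[of "g n x"] norm_triangle_ineq4[of "c (g n x)" "c (g n x) - p n x"] by simp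
      then have "\<bar>box_bump (real n) a b x\<bar> * cmod (p n x) \<le> 1 * (B + 1)"
        using box_bump_bounds[of "real n" a b x] by (intro mult_mono) auto
      then show ?thesis by (simp add: f_def norm_mult)
    qed (use f0 B0 in auto)
    have "AE x in lebesgue. x \<notin> N"
      using N by (simp add: negligible_iff_null_sets AE_not_in)
    then show "AE x in lebesgue. (\<lambda>n. f n x) \<longlonglongrightarrow> u x"
    proof eventually_elim
      case (elim x)
      show ?case
      proof (cases "x \<in> box a b")
        case True
        then have x: "x \<in> cbox a b" using box_subset_cbox by blast
        have "(\<lambda>n. c (g n x)) \<longlonglongrightarrow> c (u x)"
          using c gu[OF elim] by (intro isCont_tendsto_compose[of _ c]) (auto simp: continuous_on_eq_continuous_at)
        moreover have "(\<lambda>n. c (g n x) - p n x) \<longlonglongrightarrow> 0"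
          by (rule Lim_null_comparison[OF _ LIMSEQ_inverse_real_of_nat])
            (use p(2)[OF x] in \<open>auto intro!: always_eventually less_imp_le\<close>)
        ultimately have "(\<lambda>n. c (g n x) - (c (g n x) - p n x)) \<longlonglongrightarrow> c (u x) - 0"
          by (rule tendsto_diff)
        then have "(\<lambda>n. p n x) \<longlonglongrightarrow> u x" by (simp add: cu)
        from tendsto_mult[OF tendsto_of_real[OF box_bump_tendsto_1[OF True]] this]
        show ?thesis by (simp add: f_def)
      qed (use f0 supp in auto)
    qed
  qed
qed

lemma bounded_box_dominated_limit:
  assumes u: "u \<in> borel_measurable lebesgue" and B: "\<And>x. cmod (u x) \<le> B"
    and supp: "\<And>x. x \<notin> box a b \<Longrightarrow> u x = 0"
  obtains f D where "\<And>n. f n \<in> test_functions" "\<And>n x. x \<notin> box a b \<Longrightarrow> f n x = 0"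
    "dominated_limit f u D" "\<And>x. x \<notin> box a b \<Longrightarrow> D x = 0"
proof -
  obtain f where f: "\<And>n. f n \<in> test_functions" "\<And>n x. x \<notin> box a b \<Longrightarrow> f n x = 0"
    "\<And>n x. cmod (f n x) \<le> B + 1" "AE x in lebesgue. (\<lambda>n. f n x) \<longlonglongrightarrow> u x"
    using bounded_box_approx[OF assms] by blast
  have B0: "0 \<le> B" using B[of 0] norm_ge_zero[of "u 0"] by linarith
  define D where "D x = (if x \<in> box a b then B + 1 else 0)" for x
  have [measurable]: "D \<in> borel_measurable lebesgue"
    unfolding D_def by measurable
  have "integrable lebesgue (\<lambda>x. (D x)\<^sup>2)"
    by (rule integrable_bounded_box[where B = "(B + 1)\<^sup>2" and a = a and b = b])
      (auto simp: D_def)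
  then have "dominated_limit f u D"
    unfolding dominated_limit_def using u f supp test_function_measurable[OF f(1)] B0
    by (auto simp: D_def intro: order_trans[OF B])
  then show ?thesis
    using f B0 by (intro that[of f D]) (auto simp: D_def)
qed

definition sym_box :: "nat \<Rightarrow> plane set"
  where "sym_box n = box (- (real n *\<^sub>R 1)) (real n *\<^sub>R 1)"

lemma mem_sym_box: "x \<in> sym_box n \<longleftrightarrow> (\<forall>i. \<bar>x $ i\<bar> < real n)"
  by (auto simp: sym_box_def mem_box_cart abs_less_iff minus_less_iff)

text \<open>
  Truncations are bounded and have bounded support, hence are within reach of
  \<open>bounded_box_approx\<close>. Test functions thus approximate an arbitrary square-integrable
  function in two steps, each of which is a dominated limit.
\<close>

definition truncation :: "(plane \<Rightarrow> complex) \<Rightarrow> nat \<Rightarrow> plane \<Rightarrow> complex"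
  where "truncation f n x = (if cmod (f x) \<le> real n \<and> x \<in> sym_box n then f x else 0)"

lemma truncation_measurable:
  assumes [measurable]: "f \<in> borel_measurable lebesgue"
  shows "truncation f n \<in> borel_measurable lebesgue"
  unfolding truncation_def sym_box_def by measurable

lemma cmod_truncation_le: "cmod (truncation f n x) \<le> real n"
  by (simp add: truncation_def)

lemma cmod_truncation_mono:
  assumes "n \<le> m"
  shows "cmod (truncation f n x) \<le> cmod (truncation f m x)"
proof (cases "cmod (f x) \<le> real n \<and> x \<in> sym_box n")
  case True
  have "real n \<le> real m" using assms by simp
  then have "cmod (f x) \<le> real m \<and> x \<in> sym_box m"
    using True by (auto simp: mem_sym_box intro: less_le_trans)
  then show ?thesis by (simp add: truncation_def)
next
  case False
  then have "truncation f n x = 0" by (auto simp: truncation_def)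
  then show ?thesis by simp
qed

lemma truncation_tendsto: "(\<lambda>n. truncation f n x) \<longlonglongrightarrow> f x"
proof -
  obtain m :: nat where "max (cmod (f x)) (max \<bar>x $ 1\<bar> \<bar>x $ 2\<bar>) < real m"
    using reals_Archimedean2 by blast
  then have m: "cmod (f x) \<le> real m" "\<bar>x $ 1\<bar> < real m" "\<bar>x $ 2\<bar> < real m"
    by auto
  have "eventually (\<lambda>n. truncation f n x = f x) sequentially"
    using eventually_ge_at_top[of m]
  proof eventually_elim
    case (elim n)
    then have "real m \<le> real n" by simp
    then have "cmod (f x) \<le> real n" "\<bar>x $ 1\<bar> < real n" "\<bar>x $ 2\<bar> < real n"
      using m by linarith+
    then show ?case by (auto simp: truncation_def mem_sym_box forall_2)
  qed
  then show ?thesis by (rule tendsto_eventually)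
qed

lemma L2_truncation:
  assumes f: "f \<in> L2"
  shows "dominated_limit (truncation f) f (\<lambda>x. cmod (f x))"
  using L2D[OF f] truncation_tendsto[of f] truncation_measurable[OF L2D(1)[OF f]]
  by (auto simp: dominated_limit_def truncation_def)

section \<open>Infinite sums of squares\<close>

lemma infsum_ennreal_le_iff:
  fixes f :: "'i \<Rightarrow> ennreal"
  shows "infsum f A \<le> c \<longleftrightarrow> (\<forall>F. finite F \<and> F \<subseteq> A \<longrightarrow> sum f F \<le> c)"
  by (subst nonneg_infsum_complete) (auto simp: SUP_le_iff)

lemma sum_le_infsum_ennreal:
  fixes f :: "'i \<Rightarrow> ennreal"
  assumes "finite F" "F \<subseteq> A"
  shows "sum f F \<le> infsum f A"
  using infsum_ennreal_le_iff[of f A "infsum f A"] assms by blast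

text \<open>
  Sums in \<^typ>\<open>ennreal\<close> are suprema over finite sets of indices, so both inequalities
  reduce to finite sums.
\<close>

lemma infsum_Sigma_ennreal:
  fixes g :: "'i \<times> 'j \<Rightarrow> ennreal"
  shows "infsum g (Sigma A B) = (\<Sum>\<^sub>\<infinity>x\<in>A. \<Sum>\<^sub>\<infinity>y\<in>B x. g (x, y))"
proof -
  define f where "f x y = g (x, y)" for x y
  have "infsum (\<lambda>x. infsum (f x) (B x)) A = infsum (\<lambda>(x, y). f x y) (Sigma A B)"
  proof (rule antisym)
    show "infsum (\<lambda>x. infsum (f x) (B x)) A \<le> infsum (\<lambda>(x, y). f x y) (Sigma A B)"
      unfolding infsum_ennreal_le_iff[where A = A]
    proof safe
      fix G assume G: "finite G" "G \<subseteq> A"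
      have "(\<Sum>x\<in>G. infsum (f x) (B x)) = infsum (\<lambda>(x, y). f x y) (Sigma G B)"
        using G(1)
      proof (induction G rule: finite_induct)
        case (insert a G)
        have "infsum (\<lambda>(x, y). f x y) (Sigma (insert a G) B) =
            infsum (\<lambda>(x, y). f x y) (Pair a ` B a \<union> Sigma G B)"
          by (rule arg_cong[where f = "infsum _"]) auto
        also have "\<dots> = infsum (\<lambda>(x, y). f x y) (Pair a ` B a) + infsum (\<lambda>(x, y). f x y) (Sigma G B)"
          using insert.hyps by (intro infsum_Un_disjoint nonneg_summable_on_complete) auto
        also have "infsum (\<lambda>(x, y). f x y) (Pair a ` B a) = infsum (f a) (B a)"
          by (subst infsum_reindex) (auto simp: inj_on_def o_def)
        finally show ?case using insert by simp
      qed simp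
      also have "\<dots> \<le> infsum (\<lambda>(x, y). f x y) (Sigma A B)"
        using G by (intro infsum_mono_neutral nonneg_summable_on_complete) auto
      finally show "(\<Sum>x\<in>G. infsum (f x) (B x)) \<le> infsum (\<lambda>(x, y). f x y) (Sigma A B)" .
    qed
    show "infsum (\<lambda>(x, y). f x y) (Sigma A B) \<le> infsum (\<lambda>x. infsum (f x) (B x)) A"
      unfolding infsum_ennreal_le_iff[where A = "Sigma A B"]
    proof safe
      fix G assume G: "finite G" "G \<subseteq> Sigma A B"
      have "(\<Sum>(x, y)\<in>G. f x y) \<le> (\<Sum>(x, y)\<in>Sigma (fst ` G) (\<lambda>x. {y. (x, y) \<in> G}). f x y)"
      proof (rule sum_mono2)
        have "{y. (x, y) \<in> G} \<subseteq> snd ` G" for x by force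
        then show "finite (SIGMA x:fst ` G. {y. (x, y) \<in> G})"
          using G(1) finite_subset by (intro finite_SigmaI) (auto intro: finite_subset[OF _ finite_imageI])
      qed force+
      also have "\<dots> = (\<Sum>x\<in>fst ` G. \<Sum>y\<in>{y. (x, y) \<in> G}. f x y)"
      proof (rule sum.Sigma[symmetric])
        have "{y. (x, y) \<in> G} \<subseteq> snd ` G" for x by force
        then show "\<forall>x\<in>fst ` G. finite {y. (x, y) \<in> G}"
          using G(1) finite_subset by blast
      qed (use G in auto)
      also have "\<dots> \<le> (\<Sum>x\<in>fst ` G. infsum (f x) (B x))"
      proof (intro sum_mono sum_le_infsum_ennreal)
        fix x
        have "{y. (x, y) \<in> G} \<subseteq> snd ` G" by force
        then show "finite {y. (x, y) \<in> G}" using G(1) finite_subset by blast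
      qed (use G in auto)
      also have "\<dots> \<le> infsum (\<lambda>x. infsum (f x) (B x)) A"
        using G by (intro sum_le_infsum_ennreal) auto
      finally show "(\<Sum>(x, y)\<in>G. f x y) \<le> infsum (\<lambda>x. infsum (f x) (B x)) A" .
    qed
  qed
  then show ?thesis by (simp add: f_def[abs_def] case_prod_eta)
qed

text \<open>
  A weighted triangle inequality: the factor in front of the first term can be brought as close
  to $1$ as desired, at the price of a large factor in front of the second. In
  \<open>square_sum_limit\<close> this takes the place of Minkowski's inequality.
\<close>

lemma cmod_square_add_le:
  assumes "0 < \<delta>"
  shows "(cmod (z + w))\<^sup>2 \<le> (1 + \<delta>) * (cmod z)\<^sup>2 + (1 + 1 / \<delta>) * (cmod w)\<^sup>2"
proof -
  have "(cmod (z + w))\<^sup>2 \<le> (cmod z + cmod w)\<^sup>2"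
    by (intro power_mono norm_triangle_ineq) auto
  also have "\<dots> = (cmod z)\<^sup>2 + (cmod w)\<^sup>2 + 2 * (sqrt \<delta> * cmod z) * (cmod w / sqrt \<delta>)"
    using assms by (simp add: power2_sum)
  also have "\<dots> \<le> (cmod z)\<^sup>2 + (cmod w)\<^sup>2 + ((sqrt \<delta> * cmod z)\<^sup>2 + (cmod w / sqrt \<delta>)\<^sup>2)"
    using sum_squares_bound[of "sqrt \<delta> * cmod z" "cmod w / sqrt \<delta>"] by (intro add_left_mono) auto
  also have "\<dots> = (1 + \<delta>) * (cmod z)\<^sup>2 + (1 + 1 / \<delta>) * (cmod w)\<^sup>2"
    using assms by (simp add: power_mult_distrib power_divide algebra_simps)
  finally show ?thesis .
qed

text \<open>
  Completeness of $\ell^2$ for the sequences \<open>T n\<close>. Fatou's lemma, in the form of finite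
  partial sums, shows that the sum of the limits is at most \<open>Q\<close> and that \<open>T n\<close> is within
  \<open>e n\<close> of the limit \<open>t\<close> in the square of the norm. Then \<open>cmod_square_add_le\<close> bounds
  \<open>q n\<close> by $(1+\delta)$ times the sum of the limits up to an error that vanishes as \<open>n\<close>
  grows, and finally \<open>\<delta>\<close> tends to $0$.
\<close>

lemma square_sum_limit:
  fixes T :: "nat \<Rightarrow> 'i \<Rightarrow> complex" and t :: "'i \<Rightarrow> complex"
  assumes lim: "\<And>i. i \<in> I \<Longrightarrow> (\<lambda>n. T n i) \<longlonglongrightarrow> t i"
    and sum: "\<And>n. (\<Sum>\<^sub>\<infinity>i\<in>I. ennreal ((cmod (T n i))\<^sup>2)) = ennreal (q n)"
    and q0: "\<And>n. 0 \<le> q n" and q: "q \<longlonglongrightarrow> Q"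
    and cauchy: "\<And>n m. (\<Sum>\<^sub>\<infinity>i\<in>I. ennreal ((cmod (T n i - T m i))\<^sup>2)) \<le> ennreal (e n + e m)"
    and e0: "\<And>n. 0 \<le> e n" and e: "e \<longlonglongrightarrow> 0"
  shows "(\<Sum>\<^sub>\<infinity>i\<in>I. ennreal ((cmod (t i))\<^sup>2)) = ennreal Q"
proof -
  have Q0: "0 \<le> Q" using q q0 by (intro LIMSEQ_le_const) auto
  have fin_q: "(\<Sum>i\<in>F. (cmod (T n i))\<^sup>2) \<le> q n" if "finite F" "F \<subseteq> I" for F n
    using sum_le_infsum_ennreal[OF that, of "\<lambda>i. ennreal ((cmod (T n i))\<^sup>2)"] q0[of n]
    by (simp add: sum_ennreal sum)
  have le: "(\<Sum>i\<in>F. (cmod (t i))\<^sup>2) \<le> Q" if "finite F" "F \<subseteq> I" for F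
  proof (rule tendsto_le[OF _ q])
    show "(\<lambda>n. \<Sum>i\<in>F. (cmod (T n i))\<^sup>2) \<longlonglongrightarrow> (\<Sum>i\<in>F. (cmod (t i))\<^sup>2)"
      using lim that by (intro tendsto_intros) auto
  qed (use fin_q[OF that] in auto)
  have close: "(\<Sum>i\<in>F. (cmod (T n i - t i))\<^sup>2) \<le> e n" if "finite F" "F \<subseteq> I" for F n
  proof (rule tendsto_le)
    show "(\<lambda>m. \<Sum>i\<in>F. (cmod (T n i - T m i))\<^sup>2) \<longlonglongrightarrow> (\<Sum>i\<in>F. (cmod (T n i - t i))\<^sup>2)"
      using lim that by (intro tendsto_intros) auto
    show "(\<lambda>m. e n + e m) \<longlonglongrightarrow> e n"
      using tendsto_add[OF tendsto_const e, of "e n"] by simp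
    have "(\<Sum>i\<in>F. (cmod (T n i - T m i))\<^sup>2) \<le> e n + e m" for m
    proof -
      have "ennreal (\<Sum>i\<in>F. (cmod (T n i - T m i))\<^sup>2) \<le> ennreal (e n + e m)"
        using order_trans[OF sum_le_infsum_ennreal[OF that, of "\<lambda>i. ennreal ((cmod (T n i - T m i))\<^sup>2)"] cauchy]
        by (simp add: sum_ennreal)
      then show ?thesis using e0[of n] e0[of m] by (simp add: ennreal_le_iff del: ennreal_plus)
    qed
    then show "eventually (\<lambda>m. (\<Sum>i\<in>F. (cmod (T n i - T m i))\<^sup>2) \<le> e n + e m) sequentially"
      by simp
  qed simp
  define s where "s = (\<Sum>\<^sub>\<infinity>i\<in>I. ennreal ((cmod (t i))\<^sup>2))"
  have sQ: "s \<le> ennreal Q"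
    unfolding s_def infsum_ennreal_le_iff using le by (auto simp: sum_ennreal intro!: ennreal_leI)
  obtain s' where s': "0 \<le> s'" "s = ennreal s'"
    using sQ by (cases s) (auto simp: top_unique)
  have fin_s: "(\<Sum>i\<in>F. (cmod (t i))\<^sup>2) \<le> s'" if "finite F" "F \<subseteq> I" for F
    using sum_le_infsum_ennreal[OF that, of "\<lambda>i. ennreal ((cmod (t i))\<^sup>2)"] s'
    by (simp add: sum_ennreal flip: s_def)
  have upper: "Q \<le> (1 + \<delta>) * s'" if \<delta>: "0 < \<delta>" for \<delta>
  proof (rule tendsto_le[OF _ _ q])
    show "(\<lambda>n. (1 + \<delta>) * s' + (1 + 1 / \<delta>) * e n) \<longlonglongrightarrow> (1 + \<delta>) * s'"
      using tendsto_add[OF tendsto_const tendsto_mult[OF tendsto_const e], of "(1 + \<delta>) * s'" "1 + 1 / \<delta>"]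
      by simp
    have "q n \<le> (1 + \<delta>) * s' + (1 + 1 / \<delta>) * e n" for n
    proof -
      have "(\<Sum>i\<in>F. (cmod (T n i))\<^sup>2) \<le> (1 + \<delta>) * s' + (1 + 1 / \<delta>) * e n"
        if F: "finite F" "F \<subseteq> I" for F
      proof -
        have "(\<Sum>i\<in>F. (cmod (T n i))\<^sup>2) \<le>
            (\<Sum>i\<in>F. (1 + \<delta>) * (cmod (t i))\<^sup>2 + (1 + 1 / \<delta>) * (cmod (T n i - t i))\<^sup>2)"
          using cmod_square_add_le[OF \<delta>, of "t i" "T n i - t i" for i] by (intro sum_mono) simp
        also have "\<dots> = (1 + \<delta>) * (\<Sum>i\<in>F. (cmod (t i))\<^sup>2) +
            (1 + 1 / \<delta>) * (\<Sum>i\<in>F. (cmod (T n i - t i))\<^sup>2)"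
          by (simp add: sum.distrib sum_distrib_left)
        also have "\<dots> \<le> (1 + \<delta>) * s' + (1 + 1 / \<delta>) * e n"
          using \<delta> by (intro add_mono mult_left_mono fin_s close F) auto
        finally show ?thesis .
      qed
      then have "ennreal (q n) \<le> ennreal ((1 + \<delta>) * s' + (1 + 1 / \<delta>) * e n)"
        unfolding sum[symmetric] infsum_ennreal_le_iff by (auto simp: sum_ennreal intro!: ennreal_leI)
      moreover have "0 \<le> (1 + \<delta>) * s' + (1 + 1 / \<delta>) * e n"
        using \<delta> s' e0[of n] by auto
      ultimately show ?thesis by simp
    qed
    then show "eventually (\<lambda>n. q n \<le> (1 + \<delta>) * s' + (1 + 1 / \<delta>) * e n) sequentially" by simp
  qed simp
  have "Q \<le> s'"
  proof (rule tendsto_le[OF trivial_limit_at_right_real])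
    show "((\<lambda>\<delta>. (1 + \<delta>) * s') \<longlongrightarrow> s') (at_right 0)"
      by (auto intro!: tendsto_eq_intros)
    show "eventually (\<lambda>\<delta>. Q \<le> (1 + \<delta>) * s') (at_right 0)"
      using upper by (auto simp: eventually_at_filter)
    show "((\<lambda>_. Q) \<longlongrightarrow> Q) (at_right 0)" by simp
  qed
  then have "ennreal Q \<le> s" using s' by (simp add: ennreal_leI)
  then show ?thesis using sQ by (simp add: s_def)
qed

lemma inner_prod_diff_left:
  assumes "f \<in> L2" "g \<in> L2" "h \<in> L2"
  shows "inner_prod (\<lambda>x. f x - g x) h = inner_prod f h - inner_prod g h"
  unfolding inner_prod_def
  using L2_integrable_mult[OF assms(1,3)] L2_integrable_mult[OF assms(2,3)]
  by (subst Bochner_Integration.integral_diff[symmetric]) (simp_all add: algebra_simps)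

lemma square_sum_dominated_limit:
  assumes h: "\<And>i. i \<in> I \<Longrightarrow> h i \<in> L2"
    and F: "dominated_limit F f D"
    and sum: "\<And>n. (\<Sum>\<^sub>\<infinity>i\<in>I. ennreal ((cmod (inner_prod (F n) (h i)))\<^sup>2)) = ennreal (cmod (q (F n)))"
    and real: "\<And>n. q (F n) = complex_of_real (cmod (q (F n)))"
    and diff: "\<And>n m. (\<Sum>\<^sub>\<infinity>i\<in>I. ennreal ((cmod (inner_prod (\<lambda>x. F n x - F m x) (h i)))\<^sup>2)) =
        ennreal (cmod (q (\<lambda>x. F n x - F m x)))"
    and q: "(\<lambda>n. q (F n)) \<longlonglongrightarrow> q f"
    and bound: "\<And>n m. cmod (q (\<lambda>x. F n x - F m x)) \<le> C * norm2_sq (\<lambda>x. F n x - F m x)"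
    and C: "0 \<le> C"
  shows "(\<Sum>\<^sub>\<infinity>i\<in>I. ennreal ((cmod (inner_prod f (h i)))\<^sup>2)) = ennreal (cmod (q f)) \<and>
    q f = complex_of_real (cmod (q f))"
proof
  show "q f = complex_of_real (cmod (q f))"
    using real q tendsto_of_real[OF tendsto_norm[OF q], where 'a = complex]
    by (intro LIMSEQ_unique[OF q]) simp
  show "(\<Sum>\<^sub>\<infinity>i\<in>I. ennreal ((cmod (inner_prod f (h i)))\<^sup>2)) = ennreal (cmod (q f))"
  proof (rule square_sum_limit[where e = "\<lambda>n. 2 * C * norm2_sq (\<lambda>x. F n x - f x)"])
    note L2 = dominated_limit_L2(1)[OF F] dominated_limit_L2(2)[OF F]
    show "(\<lambda>n. inner_prod (F n) (h i)) \<longlonglongrightarrow> inner_prod f (h i)" if "i \<in> I" for i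
      by (rule dominated_limit_inner_prod[OF F h[OF that]])
    show "(\<lambda>n. 2 * C * norm2_sq (\<lambda>x. F n x - f x)) \<longlonglongrightarrow> 0"
      using tendsto_mult[OF tendsto_const dominated_limit_norm2_sq_diff[OF F], of "2 * C"] by simp
    show "(\<Sum>\<^sub>\<infinity>i\<in>I. ennreal ((cmod (inner_prod (F n) (h i) - inner_prod (F m) (h i)))\<^sup>2))
        \<le> ennreal (2 * C * norm2_sq (\<lambda>x. F n x - f x) + 2 * C * norm2_sq (\<lambda>x. F m x - f x))" for n m
    proof -
      have "(\<Sum>\<^sub>\<infinity>i\<in>I. ennreal ((cmod (inner_prod (F n) (h i) - inner_prod (F m) (h i)))\<^sup>2)) =
          ennreal (cmod (q (\<lambda>x. F n x - F m x)))"
        using L2 h by (subst diff[symmetric], intro infsum_cong) (simp add: inner_prod_diff_left)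
      also have "\<dots> \<le> ennreal (C * norm2_sq (\<lambda>x. F n x - F m x))"
        by (intro ennreal_leI bound)
      also have "norm2_sq (\<lambda>x. F n x - F m x) = norm2_sq (\<lambda>x. (F n x - f x) - (F m x - f x))" by simp
      also have "C * \<dots> \<le> C * (2 * norm2_sq (\<lambda>x. F n x - f x) + 2 * norm2_sq (\<lambda>x. F m x - f x))"
        using C L2 by (intro mult_left_mono norm2_sq_diff_le L2_diff)
      finally show ?thesis by (simp add: algebra_simps ennreal_leI)
    qed
  qed (use sum tendsto_norm[OF q] C norm2_sq_nonneg in auto)
qed

text \<open>
  An identity between a sum of squared coefficients and a quadratic expression \<open>q\<close> passes from
  test functions to all of \<^const>\<open>L2\<close>: first to bounded functions of bounded support, then
  to their limits under truncation. The test functions are closed under differences, and so are the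
  bounded functions of bounded support; hence the identity for differences provides the Cauchy
  property in \<open>square_sum_limit\<close>.

  The set \<open>S\<close> confines the supports. It will be the whole plane or a box, and what matters is
  that it cuts every centred box in a box, so that the approximations can be chosen inside
  \<open>S\<close>. Letting \<open>q\<close> be complex and stating $q(f) = |q(f)|$ records that \<open>q\<close> takes
  nonnegative real values, a closed condition that survives the limit.
\<close>

theorem square_sum_identity_extends:
  assumes h: "\<And>i. i \<in> I \<Longrightarrow> h i \<in> L2"
    and S: "\<And>c. \<exists>a b. S \<inter> box (- c) c = box a b"
    and base: "\<And>f. f \<in> test_functions \<Longrightarrow> (\<And>x. x \<notin> S \<Longrightarrow> f x = 0) \<Longrightarrow>
        (\<Sum>\<^sub>\<infinity>i\<in>I. ennreal ((cmod (inner_prod f (h i)))\<^sup>2)) = ennreal (cmod (q f)) \<and>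
        q f = complex_of_real (cmod (q f))"
    and cont: "\<And>F f D. dominated_limit F f D \<Longrightarrow> (\<And>n x. x \<notin> S \<Longrightarrow> F n x = 0) \<Longrightarrow>
        (\<And>x. x \<notin> S \<Longrightarrow> f x = 0) \<Longrightarrow> (\<And>x. x \<notin> S \<Longrightarrow> D x = 0) \<Longrightarrow> (\<lambda>n. q (F n)) \<longlonglongrightarrow> q f"
    and bound: "\<And>f. f \<in> L2 \<Longrightarrow> (\<And>x. x \<notin> S \<Longrightarrow> f x = 0) \<Longrightarrow> cmod (q f) \<le> C * norm2_sq f"
    and C: "0 \<le> C"
    and f: "f \<in> L2" "\<And>x. x \<notin> S \<Longrightarrow> f x = 0"
  shows "(\<Sum>\<^sub>\<infinity>i\<in>I. ennreal ((cmod (inner_prod f (h i)))\<^sup>2)) = ennreal (cmod (q f)) \<and>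
    q f = complex_of_real (cmod (q f))"
proof -
  have bdd: "(\<Sum>\<^sub>\<infinity>i\<in>I. ennreal ((cmod (inner_prod u (h i)))\<^sup>2)) = ennreal (cmod (q u)) \<and>
      q u = complex_of_real (cmod (q u))"
    if u: "u \<in> borel_measurable lebesgue" "\<And>x. cmod (u x) \<le> B" "\<And>x. x \<notin> S \<inter> box (- c) c \<Longrightarrow> u x = 0"
    for u B c
  proof -
    obtain a b where ab: "S \<inter> box (- c) c = box a b" using S by blast
    obtain F D where F: "\<And>n. F n \<in> test_functions" "\<And>n x. x \<notin> box a b \<Longrightarrow> F n x = 0"
      "dominated_limit F u D" "\<And>x. x \<notin> box a b \<Longrightarrow> D x = 0"
      using bounded_box_dominated_limit[of u B a b] u unfolding ab by metis
    have F0: "F n x = 0" "u x = 0" "D x = 0" if "x \<notin> S" for n x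
      using F(2,4)[of x] u(3)[of x] that ab by blast+
    show ?thesis
    proof (rule square_sum_dominated_limit[OF h F(3) _ _ _ _ _ C])
      show "(\<Sum>\<^sub>\<infinity>i\<in>I. ennreal ((cmod (inner_prod (F n) (h i)))\<^sup>2)) = ennreal (cmod (q (F n)))"
        "q (F n) = complex_of_real (cmod (q (F n)))" for n
        using base[OF F(1) F0(1)] by blast+
      show "(\<Sum>\<^sub>\<infinity>i\<in>I. ennreal ((cmod (inner_prod (\<lambda>x. F n x - F m x) (h i)))\<^sup>2)) =
        ennreal (cmod (q (\<lambda>x. F n x - F m x)))" for n m
        using base[OF test_functions_diff[OF F(1) F(1)], of n m] by (simp add: F0)
      show "(\<lambda>n. q (F n)) \<longlonglongrightarrow> q u" by (rule cont[OF F(3) F0])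
      show "cmod (q (\<lambda>x. F n x - F m x)) \<le> C * norm2_sq (\<lambda>x. F n x - F m x)" for n m
        by (rule bound[OF test_function_L2[OF test_functions_diff[OF F(1) F(1)]]]) (simp add: F0)
    qed
  qed
  define F where "F = truncation f"
  have F: "dominated_limit F f (\<lambda>x. cmod (f x))"
    unfolding F_def using L2_truncation[OF f(1)] .
  have F0: "F n x = 0" if "x \<notin> S" for n x using f(2)[OF that] by (simp add: F_def truncation_def)
  have Fm: "F n \<in> borel_measurable lebesgue" for n using F by (simp add: dominated_limit_def)
  have Fb: "cmod (F n x) \<le> real n" for n x by (simp add: F_def cmod_truncation_le)
  have Fs: "F n x = 0" if "x \<notin> S \<inter> box (- (real m *\<^sub>R 1)) (real m *\<^sub>R 1)" "n \<le> m" for n m x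
  proof (cases "x \<in> S")
    case True
    then have "truncation f m x = 0" using that(1) by (simp add: truncation_def sym_box_def)
    then show ?thesis using cmod_truncation_mono[OF that(2), of f x] by (simp add: F_def)
  qed (rule F0)
  show ?thesis
  proof (rule square_sum_dominated_limit[OF h F _ _ _ _ _ C])
    show "(\<Sum>\<^sub>\<infinity>i\<in>I. ennreal ((cmod (inner_prod (F n) (h i)))\<^sup>2)) = ennreal (cmod (q (F n)))"
      "q (F n) = complex_of_real (cmod (q (F n)))" for n
      using bdd[OF Fm Fb Fs[where m = n]] by blast+
    have "(\<lambda>x. F n x - F m x) \<in> borel_measurable lebesgue" for n m using Fm by measurable
    moreover have "cmod (F n x - F m x) \<le> real n + real m" for x n m
        using norm_triangle_ineq4[of "F n x" "F m x"] Fb[of n x] Fb[of m x] by linarith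
    moreover have "F n x - F m x = 0"
        if "x \<notin> S \<inter> box (- (real (max n m) *\<^sub>R 1)) (real (max n m) *\<^sub>R 1)" for x n m
        using Fs[OF that] by simp
    ultimately show "(\<Sum>\<^sub>\<infinity>i\<in>I. ennreal ((cmod (inner_prod (\<lambda>x. F n x - F m x) (h i)))\<^sup>2)) =
      ennreal (cmod (q (\<lambda>x. F n x - F m x)))" for n m
      using bdd[of "\<lambda>x. F n x - F m x"] by blast
    show "(\<lambda>n. q (F n)) \<longlonglongrightarrow> q f" by (rule cont[OF F F0 f(2)]) (simp_all add: f(2))
    show "cmod (q (\<lambda>x. F n x - F m x)) \<le> C * norm2_sq (\<lambda>x. F n x - F m x)" for n m
      by (rule bound[OF L2_diff[OF dominated_limit_L2(1)[OF F] dominated_limit_L2(1)[OF F]]]) (simp add: F0)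
  qed
qed

section \<open>The lattice and its fundamental cell\<close>

lemma Z2_0 [simp]: "0 \<in> Z2"
  by (simp add: Z2_def)

lemma Z2_minus: "k \<in> Z2 \<Longrightarrow> - k \<in> Z2"
  by (simp add: Z2_def)

lemma Z2_diff: "k \<in> Z2 \<Longrightarrow> m \<in> Z2 \<Longrightarrow> k - m \<in> Z2"
  by (simp add: Z2_def)

lemma finite_Z2_bounded:
  assumes "bounded B"
  shows "finite (Z2 \<inter> B)"
proof -
  obtain R where R: "\<And>x. x \<in> B \<Longrightarrow> norm x \<le> R"
    using assms by (auto simp: bounded_iff)
  define V :: "real set" where "V = of_int ` {- \<lceil>R\<rceil>..\<lceil>R\<rceil>}"
  define pt :: "real \<times> real \<Rightarrow> plane" where "pt = (\<lambda>(a, b). vector [a, b])"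
  have "Z2 \<inter> B \<subseteq> pt ` (V \<times> V)"
  proof
    fix k assume k: "k \<in> Z2 \<inter> B"
    have "k $ i \<in> V" for i
    proof -
      obtain z where z: "k $ i = of_int z"
        using k by (auto simp: Z2_def elim: Ints_cases)
      have "\<bar>k $ i\<bar> \<le> R"
        using k R component_le_norm_cart[of k i] by (meson IntD2 order_trans)
      then have "\<bar>z\<bar> \<le> \<lceil>R\<rceil>"
        unfolding z by (simp add: le_ceiling_iff flip: of_int_abs)
      then show ?thesis unfolding z V_def by (intro imageI) (simp add: abs_le_iff)
    qed
    then have "(k $ 1, k $ 2) \<in> V \<times> V" by simp
    moreover have "k = pt (k $ 1, k $ 2)" by (simp add: pt_def vec_eq_iff forall_2)
    ultimately show "k \<in> pt ` (V \<times> V)" by blast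
  qed
  then show ?thesis
    by (rule finite_subset) (simp add: V_def)
qed

lemma bounded_overlapping_shifts:
  assumes "bounded (B :: plane set)"
  shows "bounded {k. \<exists>x\<in>B. x + (2 * pi) *\<^sub>R k \<in> B}"
proof -
  obtain R where R: "\<And>x. x \<in> B \<Longrightarrow> norm x \<le> R"
    using assms by (auto simp: bounded_iff)
  have "norm k \<le> 2 * R" if k: "x \<in> B" "x + (2 * pi) *\<^sub>R k \<in> B" for x k
  proof -
    have "norm ((2 * pi) *\<^sub>R k) \<le> norm (x + (2 * pi) *\<^sub>R k) + norm x"
      using norm_triangle_ineq4[of "x + (2 * pi) *\<^sub>R k" x] by simp
    then have "2 * pi * norm k \<le> 2 * R" using R[OF k(1)] R[OF k(2)] by simp
    moreover have "norm k \<le> 2 * pi * norm k"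
      using mult_right_mono[of 1 "2 * pi" "norm k"] pi_gt3 by simp
    ultimately show ?thesis by linarith
  qed
  then show ?thesis
    by (auto simp: bounded_iff)
qed

text \<open>
  The lattice shifts for which \<open>C\<close> and its translate overlap. Only these contribute to sums
  over the lattice of products $\overline{F(x)}\,F(x + 2\pi m)$ with \<open>F\<close> supported in \<open>C\<close>.
\<close>

definition overlaps :: "plane set \<Rightarrow> plane set"
  where "overlaps C = Z2 \<inter> {m. \<exists>x\<in>C. x + (2 * pi) *\<^sub>R m \<in> C}"

lemma finite_overlaps: "bounded C \<Longrightarrow> finite (overlaps C)"
  unfolding overlaps_def by (intro finite_Z2_bounded bounded_overlapping_shifts)

lemma overlaps_subset: "overlaps C \<subseteq> Z2"
  by (auto simp: overlaps_def)

lemma overlapsI: "m \<in> Z2 \<Longrightarrow> x \<in> C \<Longrightarrow> x + (2 * pi) *\<^sub>R m \<in> C \<Longrightarrow> m \<in> overlaps C"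
  by (auto simp: overlaps_def)

lemma uminus_overlaps:
  assumes "m \<in> overlaps C"
  shows "- m \<in> overlaps C"
proof -
  obtain x where x: "m \<in> Z2" "x \<in> C" "x + (2 * pi) *\<^sub>R m \<in> C" using assms by (auto simp: overlaps_def)
  show ?thesis by (rule overlapsI[OF Z2_minus[OF x(1)] x(3)]) (simp add: x(2))
qed

definition cell :: "plane set"
  where "cell = {x. \<forall>i. - pi \<le> x $ i \<and> x $ i < pi}"

lemma borel_measurable_component [measurable]: "(\<lambda>x::plane. x $ i) \<in> borel_measurable borel"
  by (intro borel_measurable_continuous_onI continuous_intros)

lemma cell_borel [measurable]: "cell \<in> sets borel"
proof -
  have "cell = (\<Inter>i\<in>UNIV. {x \<in> space borel. - pi \<le> x $ i \<and> x $ i < pi})"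
    by (auto simp: cell_def)
  also have "\<dots> \<in> sets borel"
    by (intro sets.finite_INT) auto
  finally show ?thesis .
qed

lemma cell_lebesgue [measurable]: "cell \<in> sets lebesgue"
  using cell_borel by simp

lemma cell_subset: "box (- pi *\<^sub>R 1) (pi *\<^sub>R 1) \<subseteq> cell" "cell \<subseteq> cbox (- pi *\<^sub>R 1) (pi *\<^sub>R 1)"
  by (auto simp: cell_def mem_box_cart less_imp_le)

lemma measure_cell: "emeasure lebesgue cell = ennreal ((2 * pi)\<^sup>2)"
proof -
  have B: "(\<Prod>b\<in>Basis. (pi *\<^sub>R 1 - - pi *\<^sub>R (1::plane)) \<bullet> b) = (2 * pi)\<^sup>2"
  proof -
    have "(pi *\<^sub>R 1 - - pi *\<^sub>R (1::plane)) \<bullet> b = 2 * pi" if "b \<in> Basis" for b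
      using that by (auto simp: Basis_vec_def inner_axis)
    then show ?thesis by simp
  qed
  have le: "(- pi *\<^sub>R (1::plane)) \<bullet> b \<le> (pi *\<^sub>R 1) \<bullet> b" if "b \<in> Basis" for b
    using that by (auto simp: Basis_vec_def inner_axis)
  have "emeasure lborel (box (- pi *\<^sub>R (1::plane)) (pi *\<^sub>R 1)) = ennreal ((2 * pi)\<^sup>2)"
    using emeasure_lborel_box[OF le] unfolding B .
  moreover have "emeasure lborel (cbox (- pi *\<^sub>R (1::plane)) (pi *\<^sub>R 1)) = ennreal ((2 * pi)\<^sup>2)"
    using emeasure_lborel_cbox[OF le] unfolding B .
  ultimately have "emeasure lborel cell = ennreal ((2 * pi)\<^sup>2)"
    using emeasure_mono[OF cell_subset(1), of lborel] emeasure_mono[OF cell_subset(2), of lborel]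
    by (intro antisym) auto
  then show ?thesis by simp
qed

lemma norm_cell: "x \<in> cell \<Longrightarrow> norm x \<le> 2 * pi"
  using norm_le_l1_cart[of x] by (simp add: cell_def forall_2 sum_2) linarith

lemma cell_translate_ex1:
  shows "\<exists>!m. m \<in> Z2 \<and> x - (2 * pi) *\<^sub>R m \<in> cell"
proof (rule ex1I)
  define m :: plane where "m = (\<chi> i. of_int \<lfloor>(x $ i + pi) / (2 * pi)\<rfloor>)"
  have eq: "- pi \<le> y - 2 * pi * of_int z \<and> y - 2 * pi * of_int z < pi \<longleftrightarrow> z = \<lfloor>(y + pi) / (2 * pi)\<rfloor>"
    for y :: real and z :: int
  proof -
    have "z = \<lfloor>(y + pi) / (2 * pi)\<rfloor> \<longleftrightarrow> of_int z \<le> (y + pi) / (2 * pi) \<and> (y + pi) / (2 * pi) < of_int z + 1"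
      by (metis floor_eq_iff)
    also have "\<dots> \<longleftrightarrow> - pi \<le> y - 2 * pi * of_int z \<and> y - 2 * pi * of_int z < pi"
      by (simp add: pos_le_divide_eq pos_divide_less_eq algebra_simps)
    finally show ?thesis ..
  qed
  show "m \<in> Z2 \<and> x - (2 * pi) *\<^sub>R m \<in> cell"
    using eq by (simp add: m_def Z2_def cell_def)
  fix m' assume m': "m' \<in> Z2 \<and> x - (2 * pi) *\<^sub>R m' \<in> cell"
  show "m' = m"
  proof (subst vec_eq_iff, intro allI)
    fix i
    obtain z where z: "m' $ i = of_int z" using m' by (auto simp: Z2_def elim: Ints_cases)
    have "- pi \<le> x $ i - 2 * pi * of_int z \<and> x $ i - 2 * pi * of_int z < pi"
      using m' z by (auto simp: cell_def dest!: spec[of _ i])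
    then show "m' $ i = m $ i" using eq z by (simp add: m_def)
  qed
qed

lemma sum_indicator_cell:
  assumes "finite S" "S \<subseteq> Z2" "\<And>m. m \<in> Z2 \<Longrightarrow> x - (2 * pi) *\<^sub>R m \<in> cell \<Longrightarrow> m \<notin> S \<Longrightarrow> c = 0"
  shows "(\<Sum>m\<in>S. indicat_real cell (x - (2 * pi) *\<^sub>R m) *\<^sub>R c) = (c::complex)"
proof -
  obtain m0 where m0: "m0 \<in> Z2" "x - (2 * pi) *\<^sub>R m0 \<in> cell"
    and unique: "\<And>m. m \<in> Z2 \<Longrightarrow> x - (2 * pi) *\<^sub>R m \<in> cell \<Longrightarrow> m = m0"
    using cell_translate_ex1[of x] by blast
  have ind: "indicat_real cell (x - (2 * pi) *\<^sub>R m) *\<^sub>R c = (if m = m0 then c else 0)" if "m \<in> S" for m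
  proof (cases "m = m0")
    case False
    then have "x - (2 * pi) *\<^sub>R m \<notin> cell"
      using unique assms(2) that by blast
    then show ?thesis using False by simp
  qed (use m0 in simp)
  have "(\<Sum>m\<in>S. indicat_real cell (x - (2 * pi) *\<^sub>R m) *\<^sub>R c) = (\<Sum>m\<in>S. if m = m0 then c else 0)"
    by (rule sum.cong[OF refl ind])
  also have "\<dots> = c"
    using assms(1) assms(3)[OF m0] by auto
  finally show ?thesis .
qed

lemma integral_cell_tiling:
  fixes G :: "plane \<Rightarrow> complex"
  assumes G: "integrable lebesgue G" and S: "finite S" "S \<subseteq> Z2"
    and supp: "\<And>x m. x \<in> cell \<Longrightarrow> m \<in> Z2 \<Longrightarrow> m \<notin> S \<Longrightarrow> G (x + (2 * pi) *\<^sub>R m) = 0"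
  shows "(LINT x|lebesgue. G x) = (\<Sum>m\<in>S. (LINT x:cell|lebesgue. G (x + (2 * pi) *\<^sub>R m)))"
proof -
  have [measurable]: "G \<in> borel_measurable lebesgue" using G by auto
  have meas: "(\<lambda>x. indicat_real cell (x - (2 * pi) *\<^sub>R m) *\<^sub>R G x) \<in> borel_measurable lebesgue" for m
  proof -
    have [measurable]: "(\<lambda>x. indicat_real cell (x - (2 * pi) *\<^sub>R m)) \<in> borel_measurable lebesgue"
      using borel_measurable_translation[of "indicat_real cell" "- (2 * pi) *\<^sub>R m"] by simp
    show ?thesis by measurable
  qed
  have int: "integrable lebesgue (\<lambda>x. indicat_real cell (x - (2 * pi) *\<^sub>R m) *\<^sub>R G x)" for m
    by (rule Bochner_Integration.integrable_bound[OF G meas]) (auto simp: indicator_def)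
  have "G x = (\<Sum>m\<in>S. indicat_real cell (x - (2 * pi) *\<^sub>R m) *\<^sub>R G x)" for x
    using supp[of "x - (2 * pi) *\<^sub>R m" m for m] by (intro sum_indicator_cell[symmetric] S) auto
  then have "(LINT x|lebesgue. G x) =
      (LINT x|lebesgue. (\<Sum>m\<in>S. indicat_real cell (x - (2 * pi) *\<^sub>R m) *\<^sub>R G x))"
    by simp
  also have "\<dots> = (\<Sum>m\<in>S. (LINT x|lebesgue. indicat_real cell (x - (2 * pi) *\<^sub>R m) *\<^sub>R G x))"
    by (rule Bochner_Integration.integral_sum) (rule int)
  also have "\<dots> = (\<Sum>m\<in>S. (LINT x:cell|lebesgue. G (x + (2 * pi) *\<^sub>R m)))"
    unfolding set_lebesgue_integral_def
  proof (rule sum.cong[OF refl])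
    fix m
    show "(LINT x|lebesgue. indicat_real cell (x - (2 * pi) *\<^sub>R m) *\<^sub>R G x) =
        (LINT x|lebesgue. indicat_real cell x *\<^sub>R G (x + (2 * pi) *\<^sub>R m))"
      using integral_translation[OF meas[of m], of "(2 * pi) *\<^sub>R m"] by simp
  qed
  finally show ?thesis .
qed

lemma set_integrable_cell_continuous:
  fixes u :: "plane \<Rightarrow> 'b::{banach, second_countable_topology}"
  assumes "continuous_on UNIV u"
  shows "set_integrable lebesgue cell u"
proof -
  have "set_integrable lborel (cbox (- pi *\<^sub>R 1) (pi *\<^sub>R 1)) u"
    unfolding set_integrable_def
    using borel_integrable_compact[OF compact_cbox continuous_on_subset[OF assms subset_UNIV]] .
  then have "set_integrable lborel cell u"
    by (rule set_integrable_subset) (use cell_subset in auto)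
  then show ?thesis
    unfolding set_integrable_def by (intro integrable_completion[THEN iffD2]) auto
qed

section \<open>Trigonometric characters\<close>

definition character :: "plane \<Rightarrow> plane \<Rightarrow> complex"
  where "character k x = exp (- \<i> * complex_of_real (k \<bullet> x))"

lemma character_add: "character k (x + y) = character k x * character k y"
  by (simp add: character_def inner_add_right ring_distribs exp_add[symmetric])

lemma character_add_left: "character (k + m) x = character k x * character m x"
  by (simp add: character_def inner_add_left ring_distribs exp_add[symmetric])

lemma cnj_character: "cnj (character k x) = character (- k) x" "cnj (character k x) = character k (- x)"
  by (simp_all add: character_def exp_cnj)

lemma character_0 [simp]: "character 0 x = 1" "character k 0 = 1"
  by (simp_all add: character_def)

lemma cmod_character [simp]: "cmod (character k x) = 1"
  by (simp add: character_def)

lemma continuous_character [continuous_intros]: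
  "continuous_on A f \<Longrightarrow> continuous_on A (\<lambda>x. character k (f x))"
  unfolding character_def by (intro continuous_intros)

lemma borel_measurable_character [measurable]: "character k \<in> borel_measurable lebesgue"
  by (intro measurable_completion) (simp add: borel_measurable_continuous_onI continuous_intros)

lemma character_period:
  assumes "k \<in> Z2" "m \<in> Z2"
  shows "character k (x + (2 * pi) *\<^sub>R m) = character k x"
proof -
  have "k \<bullet> m \<in> \<int>"
    using assms by (auto simp: inner_vec_def Z2_def intro!: Ints_sum Ints_mult)
  then obtain z where z: "k \<bullet> m = of_int z" by (auto elim: Ints_cases)
  have "character k ((2 * pi) *\<^sub>R m) = exp (of_int (2 * (- z)) * of_real pi * \<i>)"
    by (simp add: character_def z algebra_simps)
  also have "\<dots> = 1"
    using exp_integer_2pi[of "of_int (- z)"] by (simp add: algebra_simps)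
  finally show ?thesis by (simp add: character_add)
qed

text \<open>
  For $k \neq 0$ choose \<open>v\<close> with $e^{-i k\cdot v} = -1$. Shifting the integrand by \<open>v\<close>
  changes the sign of the integral. On the other hand the integral of a periodic function over a
  translate of the cell is its integral over the cell, because the lattice translates of either
  tile the plane. So the integral is its own negative.
\<close>

lemma integral_character_cell:
  assumes k: "k \<in> Z2"
  shows "(LINT x:cell|lebesgue. character k x) = (if k = 0 then (2 * pi)\<^sup>2 else 0)"
proof (cases "k = 0")
  case True
  have "(LINT x:cell|lebesgue. (1::complex)) = complex_of_real (measure lebesgue cell)"
    unfolding set_lebesgue_integral_def by (subst integral_scaleR_left)
      (auto simp: measure_cell scaleR_conv_of_real)
  also have "\<dots> = (2 * pi)\<^sup>2"
    by (simp add: measure_def measure_cell)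
  finally show ?thesis using True by simp
next
  case False
  then obtain i where i: "k $ i \<noteq> 0" by (auto simp: vec_eq_iff)
  define v :: plane where "v = (pi / k $ i) *\<^sub>R axis i 1"
  have kv: "character k v = - 1"
    using i by (simp add: v_def character_def inner_axis exp_minus flip: cis_conv_exp)
  define C :: "plane set" where "C = cball 0 (2 * pi + norm v)"
  have cellC: "x \<in> C" "x + v \<in> C" "x - v \<in> C" if "x \<in> cell" for x
    using norm_cell[OF that] norm_triangle_ineq[of x v] norm_triangle_ineq4[of x v] norm_ge_zero[of v]
    unfolding C_def mem_cball_0 by linarith+
  define S where "S = overlaps C"
  have S: "finite S" "S \<subseteq> Z2"
    unfolding S_def by (simp_all add: finite_overlaps overlaps_subset C_def)
  define G where "G x = indicat_real cell (x + v) *\<^sub>R character k x" for x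
  have int: "integrable lebesgue (\<lambda>x. indicat_real cell x *\<^sub>R character k x)"
    using set_integrable_cell_continuous[of "character k"]
    by (simp add: set_integrable_def continuous_intros)
  have eq: "indicat_real cell (x + v) *\<^sub>R character k (x + v) = - G x" for x
    by (simp add: G_def character_add kv)
  have intG: "integrable lebesgue G"
  proof -
    have "integrable lebesgue (\<lambda>x. indicat_real cell (x + v) *\<^sub>R character k (x + v))"
      using integrable_translation_iff[of "\<lambda>x. indicat_real cell x *\<^sub>R character k x" v] int by simp
    then show ?thesis unfolding eq by simp
  qed
  have "(LINT x:cell|lebesgue. character k x) =
      (LINT x|lebesgue. indicat_real cell (x + v) *\<^sub>R character k (x + v))"
    unfolding set_lebesgue_integral_def
    using integral_translation[of "\<lambda>x. indicat_real cell x *\<^sub>R character k x" v] int by simp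
  also have "\<dots> = - (LINT x|lebesgue. G x)"
    unfolding eq by simp
  also have "(LINT x|lebesgue. G x) = (\<Sum>m\<in>S. (LINT x:cell|lebesgue. G (x + (2 * pi) *\<^sub>R m)))"
  proof (rule integral_cell_tiling[OF intG S])
    fix x m assume xm: "x \<in> cell" "m \<in> Z2" "m \<notin> S"
    have "x + (2 * pi) *\<^sub>R m + v \<notin> cell"
    proof
      assume "x + (2 * pi) *\<^sub>R m + v \<in> cell"
      from cellC(3)[OF this] have "x + (2 * pi) *\<^sub>R m \<in> C" by simp
      then have "m \<in> S" unfolding S_def by (rule overlapsI[OF xm(2) cellC(1)[OF xm(1)]])
      then show False using xm(3) by simp
    qed
    then show "G (x + (2 * pi) *\<^sub>R m) = 0" by (simp add: G_def)
  qed
  also have "\<dots> = (\<Sum>m\<in>S. (LINT x|lebesgue. indicat_real cell (x + v - (2 * pi) *\<^sub>R (- m)) *\<^sub>R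
      (indicat_real cell x *\<^sub>R character k x)))"
    unfolding set_lebesgue_integral_def G_def
    using S k by (intro sum.cong Bochner_Integration.integral_cong) (auto simp: character_period subsetD[OF S(2)] add_ac)
  also have "\<dots> = (LINT x|lebesgue. (\<Sum>m\<in>S. indicat_real cell (x + v - (2 * pi) *\<^sub>R (- m)) *\<^sub>R
      (indicat_real cell x *\<^sub>R character k x)))"
  proof (rule Bochner_Integration.integral_sum[symmetric])
    fix m
    have [measurable]: "(\<lambda>x. indicat_real cell (x + (v - (2 * pi) *\<^sub>R (- m)))) \<in> borel_measurable lebesgue"
      by (rule borel_measurable_translation) measurable
    have "(\<lambda>x. indicat_real cell (x + (v - (2 * pi) *\<^sub>R (- m))) *\<^sub>R
        (indicat_real cell x *\<^sub>R character k x)) \<in> borel_measurable lebesgue"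
      by measurable
    then show "integrable lebesgue (\<lambda>x. indicat_real cell (x + v - (2 * pi) *\<^sub>R (- m)) *\<^sub>R
        (indicat_real cell x *\<^sub>R character k x))"
      unfolding add_diff_eq
      by (rule Bochner_Integration.integrable_bound[OF int]) (auto simp: indicator_def)
  qed
  also have "\<dots> = (LINT x|lebesgue. indicat_real cell x *\<^sub>R character k x)"
  proof (rule Bochner_Integration.integral_cong[OF refl])
    fix x
    have "(\<Sum>m\<in>S. indicat_real cell (x + v - (2 * pi) *\<^sub>R (- m)) *\<^sub>R (indicat_real cell x *\<^sub>R character k x)) =
        (\<Sum>m\<in>S. indicat_real cell (x + v - (2 * pi) *\<^sub>R m) *\<^sub>R (indicat_real cell x *\<^sub>R character k x))"
      by (rule sum.reindex_bij_witness[where i = uminus and j = uminus]) (auto simp: S_def uminus_overlaps)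
    also have "\<dots> = indicat_real cell x *\<^sub>R character k x"
    proof (rule sum_indicator_cell[OF S])
      fix m assume m: "m \<in> Z2" "x + v - (2 * pi) *\<^sub>R m \<in> cell" "m \<notin> S"
      have "x \<notin> cell"
      proof
        assume "x \<in> cell"
        from cellC(2)[OF this] have "x + v - (2 * pi) *\<^sub>R m + (2 * pi) *\<^sub>R m \<in> C" by simp
        then have "m \<in> S" unfolding S_def by (rule overlapsI[OF m(1) cellC(1)[OF m(2)]])
        then show False using m(3) by simp
      qed
      then show "indicat_real cell x *\<^sub>R character k x = 0" by simp
    qed
    finally show "(\<Sum>m\<in>S. indicat_real cell (x + v - (2 * pi) *\<^sub>R (- m)) *\<^sub>R
        (indicat_real cell x *\<^sub>R character k x)) = indicat_real cell x *\<^sub>R character k x" .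
  qed
  finally have "(LINT x:cell|lebesgue. character k x) = - (LINT x:cell|lebesgue. character k x)"
    by (simp add: set_lebesgue_integral_def)
  then show ?thesis using False by (simp add: eq_neg_iff_add_eq_0)
qed

section \<open>A nonnegative summability kernel\<close>

text \<open>
  Powers of $\cos^2(t_1/2)\cos^2(t_2/2)$, which on the closed cell attains its maximum $1$ at the
  origin only. They are nonnegative trigonometric polynomials with nonnegative coefficients; after
  normalization they form a summability kernel.
\<close>

definition kern :: "nat \<Rightarrow> plane \<Rightarrow> real"
  where "kern n t = (\<Prod>i\<in>UNIV. (cos (t $ i / 2))\<^sup>2) ^ n"

definition freq_index :: "nat \<Rightarrow> (nat \<times> nat) set"
  where "freq_index n = {..2 * n} \<times> {..2 * n}"

definition freq :: "nat \<Rightarrow> nat \<times> nat \<Rightarrow> plane"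
  where "freq n p = vector [real (fst p) - real n, real (snd p) - real n]"

definition weight :: "nat \<Rightarrow> nat \<times> nat \<Rightarrow> real"
  where "weight n p = real ((2 * n) choose fst p) * real ((2 * n) choose snd p) / 16 ^ n"

lemma freq_Z2: "freq n p \<in> Z2"
  by (auto simp: freq_def Z2_def forall_2)

lemma weight_nonneg: "0 \<le> weight n p"
  by (simp add: weight_def)

lemma finite_freq_index [simp]: "finite (freq_index n)"
  by (simp add: freq_index_def)

lemma kern_nonneg: "0 \<le> kern n t"
  unfolding kern_def by (intro zero_le_power prod_nonneg ballI zero_le_power2)

lemma continuous_kern [continuous_intros]: "continuous_on A (kern n)"
  unfolding kern_def by (intro continuous_intros) auto

text \<open>
  The binomial theorem for $\bigl(\tfrac12(e^{-ix/2} + e^{ix/2})\bigr)^{2n}$.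
\<close>

lemma cos_half_power_expansion:
  "complex_of_real (((cos (x / 2))\<^sup>2) ^ n) =
    (\<Sum>j\<le>2 * n. complex_of_real (real ((2 * n) choose j) / 4 ^ n) * exp (- \<i> * complex_of_real ((real j - real n) * x)))"
proof -
  define a where "a = exp (- \<i> * complex_of_real (x / 2))"
  define b where "b = exp (\<i> * complex_of_real (x / 2))"
  have ab: "complex_of_real (cos (x / 2)) = (a + b) / 2"
    unfolding a_def b_def cos_of_real[symmetric] cos_exp_eq by (simp add: add.commute)
  have "complex_of_real (((cos (x / 2))\<^sup>2) ^ n) = (a + b) ^ (2 * n) / 2 ^ (2 * n)"
    by (simp add: ab power_divide flip: power_mult)
  also have "(a + b) ^ (2 * n) = (\<Sum>j\<le>2 * n. of_nat ((2 * n) choose j) * a ^ j * b ^ (2 * n - j))"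
    by (rule binomial_ring)
  also have "\<dots> = (\<Sum>j\<le>2 * n. of_nat ((2 * n) choose j) * exp (- \<i> * complex_of_real ((real j - real n) * x)))"
  proof (rule sum.cong[OF refl])
    fix j assume j: "j \<in> {..2 * n}"
    have "a ^ j * b ^ (2 * n - j) = exp (of_nat j * (- \<i> * complex_of_real (x / 2)) +
        of_nat (2 * n - j) * (\<i> * complex_of_real (x / 2)))"
      unfolding exp_add exp_of_nat_mult a_def b_def ..
    also have "of_nat j * (- \<i> * complex_of_real (x / 2)) + of_nat (2 * n - j) * (\<i> * complex_of_real (x / 2))
        = - \<i> * complex_of_real ((real j - real n) * x)"
      using j by (simp add: of_nat_diff field_simps)
    finally show "of_nat ((2 * n) choose j) * a ^ j * b ^ (2 * n - j) =
        of_nat ((2 * n) choose j) * exp (- \<i> * complex_of_real ((real j - real n) * x))"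
      by (simp add: mult.assoc)
  qed
  finally show ?thesis
    by (simp add: sum_divide_distrib power_mult)
qed

lemma kern_expansion:
  "complex_of_real (kern n t) = (\<Sum>p\<in>freq_index n. complex_of_real (weight n p) * character (freq n p) t)"
proof -
  have "complex_of_real (kern n t) =
      complex_of_real (((cos (t $ 1 / 2))\<^sup>2) ^ n) * complex_of_real (((cos (t $ 2 / 2))\<^sup>2) ^ n)"
    by (simp add: kern_def UNIV_2 power_mult_distrib)
  also have "\<dots> = (\<Sum>p\<in>freq_index n. complex_of_real (weight n p) * character (freq n p) t)"
    unfolding cos_half_power_expansion sum_product sum.cartesian_product freq_index_def
    by (rule sum.cong[OF refl])
      (auto simp: weight_def character_def freq_def inner_vec_def sum_2 algebra_simps exp_add exp_diff
        power_mult_distrib[symmetric] simp flip: exp_add)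
  finally show ?thesis .
qed

definition kern_mass :: "nat \<Rightarrow> real"
  where "kern_mass n = (LINT t:cell|lebesgue. kern n t)"

lemma kern_1_less_1:
  assumes "t \<in> cbox (- pi *\<^sub>R 1) (pi *\<^sub>R 1)" "t \<noteq> 0"
  shows "kern 1 t < 1"
proof -
  have le: "(cos y)\<^sup>2 \<le> 1" for y :: real by (simp add: abs_square_le_1)
  have lt: "(cos (t $ i / 2))\<^sup>2 < 1" if "t $ i \<noteq> 0" for i
  proof -
    have t: "\<bar>t $ i\<bar> \<le> pi" using assms(1) by (auto simp: mem_box_cart abs_le_iff) (metis minus_le_iff)
    then have "cos \<bar>t $ i / 2\<bar> < 1"
      using that cos_monotone_0_pi[of 0 "\<bar>t $ i / 2\<bar>"] by simp
    moreover have "0 \<le> cos \<bar>t $ i / 2\<bar>"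
      using t by (intro cos_ge_zero) auto
    moreover have "(cos (t $ i / 2))\<^sup>2 = (cos \<bar>t $ i / 2\<bar>)\<^sup>2" by (simp only: cos_abs_real)
    ultimately show ?thesis
      by (metis abs_of_nonneg abs_square_less_1)
  qed
  obtain i where "t $ i \<noteq> 0" using assms(2) by (auto simp: vec_eq_iff)
  then consider "t $ 1 \<noteq> 0" | "t $ 2 \<noteq> 0" using exhaust_2 by metis
  then have "(cos (t $ 1 / 2))\<^sup>2 * (cos (t $ 2 / 2))\<^sup>2 < 1"
  proof cases
    case 1
    have "(cos (t $ 1 / 2))\<^sup>2 * (cos (t $ 2 / 2))\<^sup>2 \<le> (cos (t $ 1 / 2))\<^sup>2"
      using le by (intro mult_left_le) auto
    then show ?thesis using lt[OF 1] by linarith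
  next
    case 2
    have "(cos (t $ 1 / 2))\<^sup>2 * (cos (t $ 2 / 2))\<^sup>2 \<le> (cos (t $ 2 / 2))\<^sup>2"
      using le by (intro mult_left_le_one_le) auto
    then show ?thesis using lt[OF 2] by linarith
  qed
  then show ?thesis by (simp add: kern_def UNIV_2)
qed

lemma kern_power: "kern n t = kern 1 t ^ n"
  by (simp add: kern_def)

lemma set_integral_of_real_complex:
  "(LINT t:A|M. complex_of_real (f t)) = complex_of_real (LINT t:A|M. f t)"
  unfolding set_lebesgue_integral_def
  by (subst integral_complex_of_real[symmetric]) (simp add: scaleR_conv_of_real)

text \<open>
  Outside a ball around the origin the kernel is at most $\rho^n$ with $\rho < 1$. Its mass over
  the cell is at least a constant times $r^n$ for any given $r < 1$, since the base of the power is
  close to $1$ near the origin. With $\rho < r < 1$ the normalized mass outside the ball tends to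
  $0$.
\<close>

lemma kern_concentration:
  fixes u :: "plane \<Rightarrow> complex"
  assumes u: "continuous_on UNIV u"
  shows "(\<lambda>n. (LINT t:cell|lebesgue. complex_of_real (kern n t) * u t) / complex_of_real (kern_mass n)) \<longlonglongrightarrow> u 0"
    and kern_mass_pos: "0 < kern_mass n"
proof -
  define C where "C = cbox (- pi *\<^sub>R (1::plane)) (pi *\<^sub>R 1)"
  have C: "compact C" "cell \<subseteq> C" using cell_subset by (auto simp: C_def)
  have kern_cont: "continuous_on A (\<lambda>t. kern n (t::plane))" for A n
    by (intro continuous_intros)
  have int: "set_integrable lebesgue cell (kern n)" for n
    by (intro set_integrable_cell_continuous kern_cont)
  have lower: "\<exists>v>0. \<forall>n. r ^ n * v \<le> kern_mass n" if r: "0 \<le> r" "r < 1" for r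
  proof -
    have "isCont (kern 1) 0"
      using kern_cont[of UNIV 1] by (simp add: continuous_on_eq_continuous_at)
    moreover have "kern 1 0 = 1" by (simp add: kern_def)
    ultimately obtain d where d: "d > 0" "\<And>t. norm t < d \<Longrightarrow> \<bar>kern 1 t - 1\<bar> < 1 - r"
      using r unfolding continuous_at_eps_delta dist_norm
      by (metis diff_gt_0_iff_gt diff_zero real_norm_def)
    define d' where "d' = min d pi"
    have d': "d' > 0" using d(1) by (simp add: d'_def)
    have sub: "ball 0 d' \<subseteq> cell"
    proof
      fix t assume "t \<in> ball (0::plane) d'"
      then have "norm t < pi" by (simp add: d'_def)
      then have "\<bar>t $ i\<bar> < pi" for i using component_le_norm_cart[of t i] by linarith
      then show "t \<in> cell" by (simp add: cell_def abs_less_iff less_imp_le) (metis less_imp_le minus_less_iff)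
    qed
    define v where "v = measure lebesgue (ball (0::plane) d')"
    have v: "v > 0" using content_ball_pos[OF d', of "0::plane"] by (simp add: v_def)
    have "r ^ n * v \<le> kern_mass n" for n
    proof -
      have "r ^ n * v = (LINT t|lebesgue. indicat_real (ball (0::plane) d') t * r ^ n)"
        by (subst integral_mult_left_zero) (simp add: v_def mult.commute)
      also have "\<dots> \<le> kern_mass n"
        unfolding kern_mass_def set_lebesgue_integral_def
      proof (rule integral_mono)
        show "integrable lebesgue (\<lambda>t. indicat_real cell t *\<^sub>R kern n t)"
          using int by (simp add: set_integrable_def)
        show "integrable lebesgue (\<lambda>t. indicat_real (ball (0::plane) d') t * r ^ n)"
          by (intro integrable_mult_left integrable_real_indicator)
            (auto intro: emeasure_lborel_ball_finite[THEN less_le_trans])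
        fix t :: plane
        show "indicat_real (ball (0::plane) d') t * r ^ n \<le> indicat_real cell t *\<^sub>R kern n t"
        proof (cases "t \<in> ball 0 d'")
          case True
          then have "r \<le> kern 1 t" using d(2)[of t] by (auto simp: d'_def)
          then have "r ^ n \<le> kern n t" unfolding kern_power[of n] using r by (intro power_mono)
          then show ?thesis using True sub by auto
        qed (auto simp: kern_nonneg)
      qed
      finally show ?thesis .
    qed
    then show ?thesis using v by blast
  qed
  show pos: "0 < kern_mass n" for n
  proof -
    obtain v where v: "v > 0" "(1 / 2) ^ n * v \<le> kern_mass n" using lower[of "1/2"] by auto
    then have "0 < (1 / 2) ^ n * v" by simp
    then show ?thesis using v(2) by linarith
  qed
  have V: "measure lebesgue cell = (2 * pi)\<^sup>2" by (simp add: measure_def measure_cell)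
  show "(\<lambda>n. (LINT t:cell|lebesgue. complex_of_real (kern n t) * u t) / complex_of_real (kern_mass n)) \<longlonglongrightarrow> u 0"
  proof (rule tendstoI)
    fix e :: real assume e: "0 < e"
    have "isCont u 0" using u by (simp add: continuous_on_eq_continuous_at)
    then obtain d where d: "d > 0" "\<And>t. norm t < d \<Longrightarrow> cmod (u t - u 0) < e / 2"
      unfolding continuous_at_eps_delta dist_norm using e by (metis diff_zero half_gt_zero)
    have "bounded ((\<lambda>t. u t - u 0) ` C)"
      by (intro compact_imp_bounded compact_continuous_image C continuous_intros continuous_on_subset[OF u]) auto
    then obtain B where B: "B > 0" "\<And>t. t \<in> C \<Longrightarrow> cmod (u t - u 0) \<le> B"
      unfolding bounded_pos by blast
    obtain \<rho> where \<rho>: "0 \<le> \<rho>" "\<rho> < 1" "\<And>t. t \<in> C - ball 0 d \<Longrightarrow> kern 1 t \<le> \<rho>"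
    proof (cases "C - ball 0 d = {}")
      case True
      then show ?thesis by (intro that[of 0]) auto
    next
      case False
      have "compact (C - ball 0 d)" using C(1) by (intro compact_diff) auto
      from continuous_attains_sup[OF this False kern_cont]
      obtain t where t: "t \<in> C - ball 0 d" "\<And>y. y \<in> C - ball 0 d \<Longrightarrow> kern 1 y \<le> kern 1 t" by blast
      show ?thesis
      proof (rule that[of "kern 1 t"])
        have "t \<noteq> 0" using t(1) d(1) by auto
        then show "kern 1 t < 1" using t(1) by (intro kern_1_less_1) (auto simp: C_def)
      qed (use t(2) kern_nonneg in auto)
    qed
    \<comment> \<open>any value strictly between \<open>\<rho>\<close> and $1$\<close>
    define r where "r = (1 + \<rho>) / 2"
    have r: "0 < r" "r < 1" "\<rho> < r" using \<rho> by (auto simp: r_def)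
    obtain v where v: "v > 0" "\<And>n. r ^ n * v \<le> kern_mass n" using lower[of r] r by auto
    have bound: "cmod ((LINT t:cell|lebesgue. complex_of_real (kern n t) * u t) / complex_of_real (kern_mass n) - u 0)
        \<le> e / 2 + B * (2 * pi)\<^sup>2 / v * (\<rho> / r) ^ n" for n
    proof -
      have i1: "set_integrable lebesgue cell (\<lambda>t. complex_of_real (kern n t) * u t)"
        and i2: "set_integrable lebesgue cell (\<lambda>t. complex_of_real (kern n t) * u 0)"
        and i3: "set_integrable lebesgue cell (\<lambda>t. complex_of_real (kern n t) * (u t - u 0))"
        by (intro set_integrable_cell_continuous continuous_intros kern_cont u)+
      have "(LINT t:cell|lebesgue. complex_of_real (kern n t) * u t) - complex_of_real (kern_mass n) * u 0
          = (LINT t:cell|lebesgue. complex_of_real (kern n t) * (u t - u 0))"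
        unfolding kern_mass_def set_integral_of_real_complex[symmetric] set_integral_mult_left[symmetric]
        using set_integral_diff(2)[OF i1 i2] by (simp add: algebra_simps)
      also have "cmod \<dots> \<le> (LINT t:cell|lebesgue. cmod (complex_of_real (kern n t) * (u t - u 0)))"
        by (rule set_integral_norm_bound[OF i3])
      also have "\<dots> \<le> (LINT t:cell|lebesgue. kern n t * (e / 2) + \<rho> ^ n * B)"
      proof (rule set_integral_mono)
        show "set_integrable lebesgue cell (\<lambda>t. cmod (complex_of_real (kern n t) * (u t - u 0)))"
          "set_integrable lebesgue cell (\<lambda>t. kern n t * (e / 2) + \<rho> ^ n * B)"
          by (intro set_integrable_cell_continuous continuous_intros kern_cont u)+
        fix t assume t: "t \<in> cell"
        show "cmod (complex_of_real (kern n t) * (u t - u 0)) \<le> kern n t * (e / 2) + \<rho> ^ n * B"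
        proof (cases "t \<in> ball 0 d")
          case True
          then have "kern n t * cmod (u t - u 0) \<le> kern n t * (e / 2)"
            using d(2)[of t] kern_nonneg by (intro mult_left_mono) auto
          then show ?thesis using \<rho> B(1) by (simp add: norm_mult kern_nonneg add_increasing2)
        next
          case False
          then have "kern n t \<le> \<rho> ^ n"
            unfolding kern_power[of n] using \<rho>(3)[of t] t C(2) kern_nonneg by (intro power_mono) auto
          then have "kern n t * cmod (u t - u 0) \<le> \<rho> ^ n * B"
            using B(2)[of t] t C(2) \<rho>(1) by (intro mult_mono) auto
          then show ?thesis using e by (simp add: norm_mult kern_nonneg add_increasing)
        qed
      qed
      also have "\<dots> = kern_mass n * (e / 2) + \<rho> ^ n * B * (2 * pi)\<^sup>2"
      proof -
        have "(LINT t:cell|lebesgue. kern n t * (e / 2) + \<rho> ^ n * B) =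
            (LINT t:cell|lebesgue. kern n t * (e / 2)) + (LINT t:cell|lebesgue. \<rho> ^ n * B)"
          by (intro set_integral_add set_integrable_cell_continuous continuous_intros kern_cont)
        also have "(LINT t:cell|lebesgue. \<rho> ^ n * B) = \<rho> ^ n * B * (2 * pi)\<^sup>2"
          by (subst set_integral_const) (simp_all add: V measure_cell)
        finally show ?thesis by (simp add: kern_mass_def)
      qed
      finally have num: "cmod ((LINT t:cell|lebesgue. complex_of_real (kern n t) * u t) - complex_of_real (kern_mass n) * u 0)
          \<le> kern_mass n * (e / 2) + \<rho> ^ n * B * (2 * pi)\<^sup>2" .
      have "cmod ((LINT t:cell|lebesgue. complex_of_real (kern n t) * u t) / complex_of_real (kern_mass n) - u 0)
          = cmod ((LINT t:cell|lebesgue. complex_of_real (kern n t) * u t) - complex_of_real (kern_mass n) * u 0) / kern_mass n"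
      proof -
        have "I / complex_of_real c - w = (I - complex_of_real c * w) / complex_of_real c" if "0 < c" for I w c
          using that by (simp add: field_simps)
        then show ?thesis using pos[of n] by (simp add: norm_divide)
      qed
      also have "\<dots> \<le> (kern_mass n * (e / 2) + \<rho> ^ n * B * (2 * pi)\<^sup>2) / kern_mass n"
        using num pos[of n] by (intro divide_right_mono) auto
      also have "\<dots> = e / 2 + \<rho> ^ n * B * (2 * pi)\<^sup>2 / kern_mass n"
        using pos[of n] by (simp add: add_divide_distrib)
      also have "\<dots> \<le> e / 2 + \<rho> ^ n * B * (2 * pi)\<^sup>2 / (r ^ n * v)"
        using v r \<rho> B(1) pos[of n] by (intro add_left_mono divide_left_mono) auto
      finally show ?thesis by (simp add: power_divide field_simps)
    qed
    have "(\<lambda>n. B * (2 * pi)\<^sup>2 / v * (\<rho> / r) ^ n) \<longlonglongrightarrow> B * (2 * pi)\<^sup>2 / v * 0"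
      using \<rho> r by (intro tendsto_intros LIMSEQ_realpow_zero) auto
    then have "eventually (\<lambda>n. B * (2 * pi)\<^sup>2 / v * (\<rho> / r) ^ n < e / 2) sequentially"
      using e by (intro order_tendstoD(2)[of _ 0]) auto
    then show "eventually (\<lambda>n. dist ((LINT t:cell|lebesgue. complex_of_real (kern n t) * u t) /
        complex_of_real (kern_mass n)) (u 0) < e) sequentially"
    proof eventually_elim
      case (elim n)
      then show ?case using bound[of n] unfolding dist_norm by linarith
    qed
  qed
qed

section \<open>Parseval's identity\<close>

text \<open>
  If \<open>S\<close> contains all relevant shifts, this is the value at $0$ of the $2\pi\mathbb{Z}^2$-periodization
  of the autocorrelation of \<open>F\<close>, and up to the factor $(2\pi)^2$ the right-hand side of Parseval's
  identity for the periodization of \<open>F\<close>.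
\<close>

definition autocorr :: "plane set \<Rightarrow> (plane \<Rightarrow> complex) \<Rightarrow> complex"
  where "autocorr S F = (\<Sum>m\<in>S. (LINT x|lebesgue. cnj (F x) * F (x + (2 * pi) *\<^sub>R m)))"

lemma sum_weight_group:
  fixes c :: "plane \<Rightarrow> 'a::real_vector"
  shows "(\<Sum>p\<in>freq_index n. weight n p *\<^sub>R c (freq n p)) =
    (\<Sum>k\<in>freq n ` freq_index n. (\<Sum>p\<in>{p \<in> freq_index n. freq n p = k}. weight n p) *\<^sub>R c k)"
proof -
  have "(\<Sum>p\<in>freq_index n. weight n p *\<^sub>R c (freq n p)) =
    (\<Sum>k\<in>freq n ` freq_index n. \<Sum>p\<in>{p \<in> freq_index n. freq n p = k}. weight n p *\<^sub>R c (freq n p))"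
    by (rule sum.image_gen) simp
  also have "\<dots> = (\<Sum>k\<in>freq n ` freq_index n. (\<Sum>p\<in>{p \<in> freq_index n. freq n p = k}. weight n p) *\<^sub>R c k)"
    by (intro sum.cong refl) (simp add: scaleR_sum_left)
  finally show ?thesis .
qed

text \<open>
  The normalized Fourier coefficients of the kernel are bounded by $(2\pi)^{-2}$ because characters
  have modulus $1$, and converge to $(2\pi)^{-2}$ because a character equals $1$ at the origin, where
  the kernel concentrates. So they sum any series of nonnegative terms to its value.
\<close>

lemma kern_fourier_coefficient:
  assumes k: "k \<in> Z2"
  defines "A \<equiv> \<lambda>n. (\<Sum>p\<in>{p \<in> freq_index n. freq n p = k}. weight n p)"
  shows "(LINT t:cell|lebesgue. complex_of_real (kern n t) * character k t) = (2 * pi)\<^sup>2 * complex_of_real (A n)"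
    and "0 \<le> A n" and "A n / kern_mass n \<le> 1 / (2 * pi)\<^sup>2"
    and "(\<lambda>n. A n / kern_mass n) \<longlonglongrightarrow> 1 / (2 * pi)\<^sup>2"
proof -
  have eq: "complex_of_real (kern n t) * character k t =
      (\<Sum>p\<in>freq_index n. complex_of_real (weight n p) * character (k - freq n p) t)" for n t
  proof -
    have "complex_of_real (kern n t) = cnj (\<Sum>p\<in>freq_index n. complex_of_real (weight n p) * character (freq n p) t)"
      by (metis kern_expansion complex_cnj_complex_of_real)
    then show ?thesis
      by (simp add: sum_distrib_right cnj_character character_add_left[symmetric] mult.assoc add.commute)
  qed
  have coeff: "(LINT t:cell|lebesgue. complex_of_real (kern n t) * character k t) = (2 * pi)\<^sup>2 * complex_of_real (A n)" for n
  proof -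
    have "(LINT t:cell|lebesgue. complex_of_real (kern n t) * character k t) =
        (\<Sum>p\<in>freq_index n. (LINT t:cell|lebesgue. complex_of_real (weight n p) * character (k - freq n p) t))"
      unfolding eq set_lebesgue_integral_def scaleR_sum_right
    proof (rule Bochner_Integration.integral_sum)
      fix p
      have "set_integrable lebesgue cell (\<lambda>t. complex_of_real (weight n p) * character (k - freq n p) t)"
        by (intro set_integrable_cell_continuous continuous_intros)
      then show "integrable lebesgue (\<lambda>t. indicat_real cell t *\<^sub>R
          (complex_of_real (weight n p) * character (k - freq n p) t))"
        by (simp only: set_integrable_def)
    qed
    also have "\<dots> = (\<Sum>p\<in>freq_index n. complex_of_real (weight n p) * (if freq n p = k then (2 * pi)\<^sup>2 else 0))"
      using integral_character_cell[OF Z2_diff[OF k freq_Z2]]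
      by (intro sum.cong refl) auto
    also have "\<dots> = (2 * pi)\<^sup>2 * complex_of_real (A n)"
      by (simp add: A_def sum.inter_filter[symmetric] sum_distrib_left mult.commute if_distrib cong: if_cong)
    finally show ?thesis .
  qed
  show "(LINT t:cell|lebesgue. complex_of_real (kern n t) * character k t) = (2 * pi)\<^sup>2 * complex_of_real (A n)"
    by (rule coeff)
  show A0: "0 \<le> A n" by (simp add: A_def sum_nonneg weight_nonneg)
  have "(2 * pi)\<^sup>2 * A n = cmod (LINT t:cell|lebesgue. complex_of_real (kern n t) * character k t)"
    unfolding coeff using A0 by (simp add: norm_mult norm_power)
  also have "\<dots> \<le> (LINT t:cell|lebesgue. cmod (complex_of_real (kern n t) * character k t))"
    by (intro set_integral_norm_bound set_integrable_cell_continuous continuous_intros)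
  also have "\<dots> = kern_mass n"
    by (simp add: kern_mass_def norm_mult kern_nonneg)
  finally show "A n / kern_mass n \<le> 1 / (2 * pi)\<^sup>2"
    using kern_mass_pos[OF continuous_on_const, of n] by (simp add: field_simps)
  have "(\<lambda>n. (LINT t:cell|lebesgue. complex_of_real (kern n t) * character k t) / complex_of_real (kern_mass n))
      \<longlonglongrightarrow> 1"
    using kern_concentration[of "character k"] by (simp add: continuous_intros)
  then have "(\<lambda>n. complex_of_real ((2 * pi)\<^sup>2 * (A n / kern_mass n))) \<longlonglongrightarrow> complex_of_real 1"
    unfolding coeff by simp
  then have "(\<lambda>n. (2 * pi)\<^sup>2 * (A n / kern_mass n)) \<longlonglongrightarrow> 1"
    by (simp only: tendsto_of_real_iff)
  from tendsto_mult[OF tendsto_const this, of "1 / (2 * pi)\<^sup>2"]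
  show "(\<lambda>n. A n / kern_mass n) \<longlonglongrightarrow> 1 / (2 * pi)\<^sup>2"
    by simp
qed

lemma autocorr_cong:
  assumes S: "finite S" "finite S'"
    and eq: "\<And>m x. m \<in> S - S' \<union> (S' - S) \<Longrightarrow> F x \<noteq> 0 \<Longrightarrow> F (x + (2 * pi) *\<^sub>R m) = 0"
  shows "autocorr S F = autocorr S' F"
proof -
  have "(LINT x|lebesgue. cnj (F x) * F (x + (2 * pi) *\<^sub>R m)) = 0" if "m \<in> S - S' \<union> (S' - S)" for m
  proof -
    have *: "(\<lambda>x. cnj (F x) * F (x + (2 * pi) *\<^sub>R m)) = (\<lambda>x. 0)" using eq[OF that] by (fastforce simp: fun_eq_iff)
    show ?thesis unfolding * by simp
  qed
  then have "autocorr S F = autocorr (S \<inter> S') F" "autocorr S' F = autocorr (S \<inter> S') F"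
    unfolding autocorr_def by (intro sum.mono_neutral_right; use S in auto)+
  then show ?thesis by simp
qed

lemma inner_prod_character:
  "inner_prod F (character k) = (LINT x|lebesgue. F x * character (- k) x)"
  by (simp add: inner_prod_def cnj_character)

lemma test_function_integrable:
  assumes "F \<in> test_functions" "h \<in> borel_measurable lebesgue" "\<And>x. cmod (h x) \<le> C"
  shows "integrable lebesgue (\<lambda>x. F x * h x)"
proof -
  obtain a b where ab: "\<And>x. x \<notin> box a b \<Longrightarrow> F x = 0" using test_function_box_bound[OF assms(1)] by blast
  obtain B where B: "\<And>x. cmod (F x) \<le> B" using test_function_bounded[OF assms(1)] by blast
  note [measurable] = test_function_measurable[OF assms(1)] assms(2)
  have "0 \<le> B" using B[of 0] norm_ge_zero order_trans by blast
  then show ?thesis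
    using B ab assms(3)
    by (intro integrable_bounded_box[where B = "B * C" and a = a and b = b])
      (auto simp: norm_mult intro!: mult_mono)
qed

text \<open>
  The kernel is a finite sum of characters, so the double integral of
  $\overline{F(y)}\,F(x)$ against the kernel at $x - y$ splits, term by term, into products of two
  single integrals: the squared moduli of the Fourier coefficients of \<open>F\<close>.
\<close>

lemma parseval_kernel_sum:
  assumes F: "F \<in> test_functions"
  defines "H \<equiv> \<lambda>n y. (LINT t|lebesgue. F (t + y) * complex_of_real (kern n t))"
  shows "H n y = (\<Sum>p\<in>freq_index n. complex_of_real (weight n p) * inner_prod F (character (freq n p)) *
      character (freq n p) y)"
    and "(LINT y|lebesgue. cnj (F y) * H n y) =
      complex_of_real (\<Sum>p\<in>freq_index n. weight n p * (cmod (inner_prod F (character (freq n p))))\<^sup>2)"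
proof -
  have Hn: "H n y = (\<Sum>p\<in>freq_index n. complex_of_real (weight n p) * inner_prod F (character (freq n p)) *
      character (freq n p) y)" for y
  proof -
    have kern: "complex_of_real (kern n t) = (\<Sum>p\<in>freq_index n. complex_of_real (weight n p) * character (- freq n p) t)" for t
    proof -
      have "complex_of_real (kern n t) = cnj (\<Sum>p\<in>freq_index n. complex_of_real (weight n p) * character (freq n p) t)"
        by (metis kern_expansion complex_cnj_complex_of_real)
      then show ?thesis by (simp add: cnj_character)
    qed
    have int: "integrable lebesgue (\<lambda>x. F x * character k x)" for k
      by (rule test_function_integrable[OF F, where C = 1]) auto
    have m: "(\<lambda>x. F x * character k x) \<in> borel_measurable lebesgue" for k using int by auto
    have shift: "F (t + y) * (complex_of_real w * character (- k) t) =
        complex_of_real w * character k y * (F (t + y) * character (- k) (t + y))" for t w k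
    proof -
      have "character k y * character (- k) y = 1"
        by (simp add: character_add_left[symmetric])
      then show ?thesis by (simp add: character_add algebra_simps)
    qed
    have ints: "integrable lebesgue (\<lambda>t. F (t + y) * character (- k) (t + y))" for k
      using integrable_translation_iff[OF m, where t = y] int by simp
    have "H n y = (LINT t|lebesgue. (\<Sum>p\<in>freq_index n. complex_of_real (weight n p) * character (freq n p) y *
        (F (t + y) * character (- freq n p) (t + y))))"
      unfolding H_def kern sum_distrib_left shift ..
    also have "\<dots> = (\<Sum>p\<in>freq_index n. complex_of_real (weight n p) * character (freq n p) y *
        (LINT t|lebesgue. F (t + y) * character (- freq n p) (t + y)))"
      using ints by (subst Bochner_Integration.integral_sum) auto
    also have "\<dots> = (\<Sum>p\<in>freq_index n. complex_of_real (weight n p) * character (freq n p) y *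
        inner_prod F (character (freq n p)))"
      unfolding inner_prod_character using integral_translation[OF m] by simp
    finally show ?thesis by (simp add: mult_ac)
  qed
  then show "H n y = (\<Sum>p\<in>freq_index n. complex_of_real (weight n p) * inner_prod F (character (freq n p)) *
      character (freq n p) y)" .
  have int: "integrable lebesgue (\<lambda>y. cnj (F y) * character k y)" for k
  proof -
    have "(\<lambda>x. cnj (F x)) \<in> test_functions"
      using F Ck_cnj by (auto simp: test_functions_def)
    then show ?thesis by (rule test_function_integrable[where C = 1]) auto
  qed
  have cnj: "(LINT y|lebesgue. cnj (F y) * character k y) = cnj (inner_prod F (character k))" for k
    using Bochner_Integration.integral_cnj[of lebesgue "\<lambda>x. F x * cnj (character k x)"] by (simp add: inner_prod_def)
  have "(LINT y|lebesgue. cnj (F y) * H n y) = (LINT y|lebesgue. (\<Sum>p\<in>freq_index n.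
      complex_of_real (weight n p) * inner_prod F (character (freq n p)) * (cnj (F y) * character (freq n p) y)))"
    unfolding Hn sum_distrib_left by (simp add: mult_ac)
  also have "\<dots> = (\<Sum>p\<in>freq_index n. complex_of_real (weight n p) * inner_prod F (character (freq n p)) *
      (LINT y|lebesgue. cnj (F y) * character (freq n p) y))"
    using int by (subst Bochner_Integration.integral_sum) auto
  also have "\<dots> = complex_of_real (\<Sum>p\<in>freq_index n. weight n p * (cmod (inner_prod F (character (freq n p))))\<^sup>2)"
    unfolding cnj by (simp add: complex_norm_square[symmetric] mult.assoc)
  finally show "(LINT y|lebesgue. cnj (F y) * H n y) =
      complex_of_real (\<Sum>p\<in>freq_index n. weight n p * (cmod (inner_prod F (character (freq n p))))\<^sup>2)" .
qed

lemma continuous_translation: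
  fixes F :: "plane \<Rightarrow> complex"
  assumes "continuous_on UNIV F"
  shows "continuous_on UNIV (\<lambda>x. F (x + c))"
  by (rule continuous_on_compose2[OF assms]) (auto intro: continuous_intros)

text \<open>
  Folding the integral over the plane into the cell turns \<open>H n y\<close> into an average of the
  periodization \<open>P\<close> around \<open>y\<close>, which tends to \<open>P y\<close> after normalization.
  Integrating against $\overline{F}$ gives the autocorrelation sum.
\<close>

lemma parseval_limit:
  assumes F: "F \<in> test_functions" and supp: "\<And>x. x \<notin> box a b \<Longrightarrow> F x = 0"
    and S: "finite S" "S \<subseteq> Z2"
    and disj: "\<And>m x. m \<in> Z2 \<Longrightarrow> m \<notin> S \<Longrightarrow> x \<in> box a b \<Longrightarrow> x + (2 * pi) *\<^sub>R m \<notin> box a b"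
  shows "(\<lambda>n. complex_of_real ((\<Sum>p\<in>freq_index n. weight n p * (cmod (inner_prod F (character (freq n p))))\<^sup>2)
      / kern_mass n)) \<longlonglongrightarrow> autocorr S F"
proof -
  note cont = test_function_continuous[OF F]
  note [measurable] = test_function_measurable[OF F]
  obtain B where B: "\<And>x. cmod (F x) \<le> B" using test_function_bounded[OF F] by blast
  obtain R where R: "\<And>x. x \<in> box a b \<Longrightarrow> norm x \<le> R"
    using bounded_box[of a b] by (auto simp: bounded_iff)
  have mass: "0 < kern_mass n" for n using kern_mass_pos[OF cont] .
  define H where "H n y = (LINT t|lebesgue. F (t + y) * complex_of_real (kern n t))" for n y
  define C :: "plane set" where "C = cball 0 (R + 2 * pi)"
  have boxC: "y \<in> C" "t \<in> cell \<Longrightarrow> t + y \<in> C" if "y \<in> box a b" for t y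
    using R[OF that] norm_cell[of t] norm_triangle_ineq[of t y] by (auto simp: C_def intro: order_trans)
  define T where "T = overlaps C"
  have T: "finite T" "T \<subseteq> Z2"
    unfolding T_def by (simp_all add: finite_overlaps overlaps_subset C_def)
  define P where "P x = (\<Sum>m\<in>T. F (x + (2 * pi) *\<^sub>R m))" for x
  have Pcont: "continuous_on UNIV P"
    unfolding P_def by (intro continuous_intros continuous_translation cont)
  have PB: "cmod (P x) \<le> real (card T) * B" for x
    unfolding P_def by (rule sum_norm_bound) (rule B)
  have period: "complex_of_real (kern n (t + (2 * pi) *\<^sub>R m)) = complex_of_real (kern n t)" if "m \<in> Z2" for n t m
    unfolding kern_expansion by (simp add: character_period[OF freq_Z2 that])
  have H: "H n y = (LINT t:cell|lebesgue. complex_of_real (kern n t) * P (t + y))" if y: "y \<in> box a b" for n y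
  proof -
    have test: "(\<lambda>t. F (t + y) * complex_of_real (kern n t)) \<in> borel_measurable lebesgue"
      by (intro measurable_completion)
        (simp add: borel_measurable_continuous_onI continuous_intros continuous_translation cont)
    have int: "integrable lebesgue (\<lambda>t. F (t + y) * complex_of_real (kern n t))"
    proof (rule integrable_bounded_box[OF test, where a = "a - y" and b = "b - y"])
      have "kern n t \<le> 1" for t
        unfolding kern_def by (intro power_le_one prod_nonneg prod_le_1) (auto simp: abs_square_le_1)
      then show "cmod (F (t + y) * complex_of_real (kern n t)) \<le> B * 1" for t
        using B[of "t + y"] kern_nonneg[of n t] order_trans[OF norm_ge_zero B]
        unfolding norm_mult by (intro mult_mono) auto
      fix t assume "t \<notin> box (a - y) (b - y)"
      then have "t + y \<notin> box a b" by (auto simp: mem_box algebra_simps inner_diff_left inner_add_left)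
      then show "F (t + y) * complex_of_real (kern n t) = 0" by (simp add: supp)
    qed
    have "H n y = (\<Sum>m\<in>T. (LINT t:cell|lebesgue. F (t + (2 * pi) *\<^sub>R m + y) * complex_of_real (kern n (t + (2 * pi) *\<^sub>R m))))"
      unfolding H_def
    proof (rule integral_cell_tiling[OF int T])
      fix t m assume t: "t \<in> cell" "m \<in> Z2" "m \<notin> T"
      have "t + (2 * pi) *\<^sub>R m + y \<notin> box a b"
      proof
        assume "t + (2 * pi) *\<^sub>R m + y \<in> box a b"
        from boxC(1)[OF this] have "t + y + (2 * pi) *\<^sub>R m \<in> C" by (simp add: add_ac)
        then have "m \<in> T" unfolding T_def by (rule overlapsI[OF t(2) boxC(2)[OF y t(1)]])
        then show False using t(3) by simp
      qed
      then show "F (t + (2 * pi) *\<^sub>R m + y) * complex_of_real (kern n (t + (2 * pi) *\<^sub>R m)) = 0"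
        by (simp add: supp)
    qed
    also have "\<dots> = (\<Sum>m\<in>T. (LINT t:cell|lebesgue. complex_of_real (kern n t) * F (t + (y + (2 * pi) *\<^sub>R m))))"
    proof (rule sum.cong[OF refl])
      fix m assume "m \<in> T"
      then have m: "m \<in> Z2" using T by blast
      show "(LINT t:cell|lebesgue. F (t + (2 * pi) *\<^sub>R m + y) * complex_of_real (kern n (t + (2 * pi) *\<^sub>R m))) =
          (LINT t:cell|lebesgue. complex_of_real (kern n t) * F (t + (y + (2 * pi) *\<^sub>R m)))"
        unfolding period[OF m] by (simp add: add_ac mult.commute[of _ "complex_of_real _"])
    qed
    also have "\<dots> = (LINT t:cell|lebesgue. (\<Sum>m\<in>T. complex_of_real (kern n t) * F (t + (y + (2 * pi) *\<^sub>R m))))"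
      unfolding set_lebesgue_integral_def scaleR_sum_right
    proof (rule Bochner_Integration.integral_sum[symmetric])
      fix m
      have "set_integrable lebesgue cell (\<lambda>t. complex_of_real (kern n t) * F (t + (y + (2 * pi) *\<^sub>R m)))"
        by (intro set_integrable_cell_continuous continuous_intros continuous_translation cont)
      then show "integrable lebesgue (\<lambda>t. indicat_real cell t *\<^sub>R (complex_of_real (kern n t) * F (t + (y + (2 * pi) *\<^sub>R m))))"
        by (simp add: set_integrable_def)
    qed
    finally show ?thesis by (simp add: P_def sum_distrib_left add_ac)
  qed
  have lim: "(\<lambda>n. cnj (F y) * (H n y / complex_of_real (kern_mass n))) \<longlonglongrightarrow> cnj (F y) * P y" for y
  proof (cases "y \<in> box a b")
    case True
    have "(\<lambda>n. H n y / complex_of_real (kern_mass n)) \<longlonglongrightarrow> P (0 + y)"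
      unfolding H[OF True] by (rule kern_concentration[OF continuous_translation[OF Pcont]])
    then show ?thesis by (intro tendsto_intros) simp
  qed (simp add: supp)
  have Hmeas [measurable]: "H n \<in> borel_measurable lebesgue" for n
  proof -
    have "H n = (\<lambda>y. \<Sum>p\<in>freq_index n. complex_of_real (weight n p) * inner_prod F (character (freq n p)) *
      character (freq n p) y)"
      unfolding H_def parseval_kernel_sum(1)[OF F] ..
    then show ?thesis by simp
  qed
  have Pmeas [measurable]: "P \<in> borel_measurable lebesgue"
    by (intro measurable_completion) (simp add: borel_measurable_continuous_onI Pcont)
  have bound: "cmod (cnj (F y) * (H n y / complex_of_real (kern_mass n))) \<le> cmod (F y) * (real (card T) * B)" for n y
  proof (cases "y \<in> box a b")
    case True
    have "cmod (H n y) \<le> (LINT t:cell|lebesgue. cmod (complex_of_real (kern n t) * P (t + y)))"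
      unfolding H[OF True]
      by (intro set_integral_norm_bound set_integrable_cell_continuous continuous_intros continuous_translation Pcont)
    also have "\<dots> \<le> (LINT t:cell|lebesgue. kern n t * (real (card T) * B))"
      by (intro set_integral_mono set_integrable_cell_continuous continuous_intros continuous_translation Pcont)
        (simp add: norm_mult kern_nonneg mult_left_mono PB)
    also have "\<dots> = kern_mass n * (real (card T) * B)"
      by (simp add: kern_mass_def)
    finally have "cmod (H n y / complex_of_real (kern_mass n)) \<le> real (card T) * B"
      using mass[of n] by (simp add: norm_divide field_simps)
    then show ?thesis by (simp add: norm_mult mult_left_mono del: times_divide_eq_right)
  qed (simp add: supp)
  have "(\<lambda>n. LINT y|lebesgue. cnj (F y) * (H n y / complex_of_real (kern_mass n))) \<longlonglongrightarrow> (LINT y|lebesgue. cnj (F y) * P y)"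
  proof (rule integral_dominated_convergence[where w = "\<lambda>y. cmod (F y) * (real (card T) * B)"])
    show "integrable lebesgue (\<lambda>y. cmod (F y) * (real (card T) * B))"
      using test_function_integrable[OF F, of "\<lambda>_. 1" 1] by simp
  qed (use bound lim in \<open>auto intro!: AE_I2 borel_measurable_times measurable_compose[OF _ borel_measurable_cnj]\<close>)
  also have "(\<lambda>n. LINT y|lebesgue. cnj (F y) * (H n y / complex_of_real (kern_mass n))) =
      (\<lambda>n. complex_of_real ((\<Sum>p\<in>freq_index n. weight n p * (cmod (inner_prod F (character (freq n p))))\<^sup>2) / kern_mass n))"
    using parseval_kernel_sum(2)[OF F] unfolding H_def times_divide_eq_right by simp
  also have "(LINT y|lebesgue. cnj (F y) * P y) = autocorr T F"
    unfolding P_def autocorr_def sum_distrib_left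
  proof (rule Bochner_Integration.integral_sum)
    fix m
    have "integrable lebesgue (\<lambda>y. F y * cnj (F (y + (2 * pi) *\<^sub>R m)))"
    proof (rule test_function_integrable[OF F])
      have [measurable]: "(\<lambda>y. F (y + (2 * pi) *\<^sub>R m)) \<in> borel_measurable lebesgue"
        by (rule borel_measurable_translation) measurable
      show "(\<lambda>y. cnj (F (y + (2 * pi) *\<^sub>R m))) \<in> borel_measurable lebesgue" by measurable
      show "cmod (cnj (F (y + (2 * pi) *\<^sub>R m))) \<le> B" for y using B by simp
    qed
    from integrable_cnj[OF this]
    show "integrable lebesgue (\<lambda>y. cnj (F y) * F (y + (2 * pi) *\<^sub>R m))" by simp
  qed
  also have "autocorr T F = autocorr S F"
  proof (rule autocorr_cong[OF T(1) S(1)])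
    fix m x assume m: "m \<in> T - S \<union> (S - T)" and x: "F x \<noteq> 0"
    have xb: "x \<in> box a b" using x supp by blast
    have "x + (2 * pi) *\<^sub>R m \<notin> box a b"
    proof (cases "m \<in> S")
      case False
      then show ?thesis using m T xb by (intro disj) auto
    next
      case True
      then have mT: "m \<in> Z2" "m \<notin> T" using m S by auto
      show ?thesis
      proof
        assume "x + (2 * pi) *\<^sub>R m \<in> box a b"
        from boxC(1)[OF this] have "m \<in> T" unfolding T_def by (rule overlapsI[OF mT(1) boxC(1)[OF xb]])
        then show False using mT(2) by simp
      qed
    qed
    then show "F (x + (2 * pi) *\<^sub>R m) = 0" by (rule supp)
  qed
  finally show ?thesis .
qed

text \<open>
  Since the weights of the kernel are at most $(2\pi)^{-2}$ and tend to this value, the limit from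
  \<open>parseval_limit\<close> is, up to the factor $(2\pi)^{-2}$, bounded above by the full sum of squares
  and below by each of its finite partial sums.
\<close>

lemma parseval_test_function:
  assumes F: "F \<in> test_functions" and supp: "\<And>x. x \<notin> box a b \<Longrightarrow> F x = 0"
    and S: "finite S" "S \<subseteq> Z2"
    and disj: "\<And>m x. m \<in> Z2 \<Longrightarrow> m \<notin> S \<Longrightarrow> x \<in> box a b \<Longrightarrow> x + (2 * pi) *\<^sub>R m \<notin> box a b"
  shows "(\<Sum>\<^sub>\<infinity>k\<in>Z2. ennreal ((cmod (inner_prod F (character k)))\<^sup>2)) = ennreal ((2 * pi)\<^sup>2 * cmod (autocorr S F))"
    and "autocorr S F = complex_of_real (cmod (autocorr S F))"
proof -
  have mass: "0 < kern_mass n" for n using kern_mass_pos[OF continuous_on_const] .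
  define c where "c k = (cmod (inner_prod F (character k)))\<^sup>2" for k
  define A where "A n k = (\<Sum>p\<in>{p \<in> freq_index n. freq n p = k}. weight n p)" for n k
  note A = kern_fourier_coefficient[folded A_def]
  define L where "L n = (\<Sum>p\<in>freq_index n. weight n p * c (freq n p)) / kern_mass n" for n
  have L: "L n = (\<Sum>k\<in>freq n ` freq_index n. A n k / kern_mass n * c k)" for n
    using sum_weight_group[of n c] unfolding A_def[symmetric] L_def
    by (simp add: sum_divide_distrib)
  have L0: "0 \<le> L n" for n
    unfolding L_def c_def using mass[of n] by (intro divide_nonneg_pos sum_nonneg) (auto simp: weight_nonneg)
  have lim: "(\<lambda>n. complex_of_real (L n)) \<longlonglongrightarrow> autocorr S F"
    unfolding L_def c_def by (rule parseval_limit[OF F supp S disj])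
  have limr: "L \<longlonglongrightarrow> cmod (autocorr S F)"
    using tendsto_norm[OF lim] L0 by simp
  show "autocorr S F = complex_of_real (cmod (autocorr S F))"
    by (rule LIMSEQ_unique[OF lim tendsto_of_real[OF limr]])
  have fin: "(\<Sum>k\<in>G. c k) \<le> (2 * pi)\<^sup>2 * cmod (autocorr S F)" if G: "finite G" "G \<subseteq> Z2" for G
  proof -
    have "(\<Sum>k\<in>G. 1 / (2 * pi)\<^sup>2 * c k) \<le> cmod (autocorr S F)"
    proof (rule tendsto_le[OF _ limr])
      show "(\<lambda>n. \<Sum>k\<in>G. A n k / kern_mass n * c k) \<longlonglongrightarrow> (\<Sum>k\<in>G. 1 / (2 * pi)\<^sup>2 * c k)"
        using G by (intro tendsto_intros A(4)) auto
      have "(\<Sum>k\<in>G. A n k / kern_mass n * c k) \<le> L n" for n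
      proof -
        have zero: "A n k = 0" if "k \<notin> freq n ` freq_index n" for k
          unfolding A_def by (rule sum.neutral) (use that in auto)
        have "(\<Sum>k\<in>G. A n k / kern_mass n * c k) = (\<Sum>k\<in>G \<inter> freq n ` freq_index n. A n k / kern_mass n * c k)"
          using G by (intro sum.mono_neutral_right) (auto simp: zero)
        also have "\<dots> \<le> L n"
          unfolding L
        proof (rule sum_mono2)
          fix k assume "k \<in> freq n ` freq_index n - G \<inter> freq n ` freq_index n"
          then have "k \<in> Z2" using freq_Z2 by auto
          then show "0 \<le> A n k / kern_mass n * c k"
            using A(2) mass[of n] by (auto simp: c_def intro!: mult_nonneg_nonneg divide_nonneg_pos)
        qed auto
        finally show ?thesis .
      qed
      then show "eventually (\<lambda>n. (\<Sum>k\<in>G. A n k / kern_mass n * c k) \<le> L n) sequentially" by simp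
    qed simp
    moreover have "(\<Sum>k\<in>G. 1 / (2 * pi)\<^sup>2 * c k) = (\<Sum>k\<in>G. c k) / (2 * pi)\<^sup>2"
      by (simp add: sum_divide_distrib)
    ultimately have "(\<Sum>k\<in>G. c k) / (2 * pi)\<^sup>2 \<le> cmod (autocorr S F)" by (simp only:)
    then show ?thesis by (simp add: pos_divide_le_eq mult.commute)
  qed
  define s where "s = (\<Sum>\<^sub>\<infinity>k\<in>Z2. ennreal (c k))"
  have s_le: "s \<le> ennreal ((2 * pi)\<^sup>2 * cmod (autocorr S F))"
    unfolding s_def infsum_ennreal_le_iff using fin
    by (auto simp: c_def sum_ennreal intro!: ennreal_leI)
  obtain s' where s': "0 \<le> s'" "s = ennreal s'"
    using s_le by (cases s) (auto simp: top_unique)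
  have "cmod (autocorr S F) \<le> s' / (2 * pi)\<^sup>2"
  proof (rule LIMSEQ_le_const2[OF limr], intro exI allI impI)
    fix n
    have "L n \<le> (\<Sum>k\<in>freq n ` freq_index n. 1 / (2 * pi)\<^sup>2 * c k)"
      unfolding L using A(3) freq_Z2 by (intro sum_mono mult_right_mono) (auto simp: c_def)
    also have "\<dots> = (\<Sum>k\<in>freq n ` freq_index n. c k) / (2 * pi)\<^sup>2"
      by (simp add: sum_divide_distrib)
    also have "\<dots> \<le> s' / (2 * pi)\<^sup>2"
    proof (rule divide_right_mono)
      have "freq n ` freq_index n \<subseteq> Z2" using freq_Z2 by auto
      then have "ennreal (\<Sum>k\<in>freq n ` freq_index n. c k) \<le> s"
        unfolding s_def using sum_le_infsum_ennreal[of "freq n ` freq_index n" Z2 "\<lambda>k. ennreal (c k)"]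
        by (simp add: sum_ennreal c_def)
      then show "(\<Sum>k\<in>freq n ` freq_index n. c k) \<le> s'" using s' by simp
    qed simp
    finally show "L n \<le> s' / (2 * pi)\<^sup>2" .
  qed
  then have "(2 * pi)\<^sup>2 * cmod (autocorr S F) \<le> s'" by (simp add: field_simps)
  then have "s = ennreal ((2 * pi)\<^sup>2 * cmod (autocorr S F))"
    using s_le s' by (intro antisym) (auto intro: ennreal_leI)
  then show "(\<Sum>\<^sub>\<infinity>k\<in>Z2. ennreal ((cmod (inner_prod F (character k)))\<^sup>2)) = ennreal ((2 * pi)\<^sup>2 * cmod (autocorr S F))"
    by (simp add: s_def c_def)
qed

text \<open>
  The autocorrelation sum converges along dominated limits and is bounded by a multiple of the
  squared norm, so the identity extends from test functions.
\<close>

theorem parseval: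
  assumes F: "F \<in> L2" and supp: "\<And>x. x \<notin> box a b \<Longrightarrow> F x = 0"
    and S: "finite S" "S \<subseteq> Z2"
    and disj: "\<And>m x. m \<in> Z2 \<Longrightarrow> m \<notin> S \<Longrightarrow> x \<in> box a b \<Longrightarrow> x + (2 * pi) *\<^sub>R m \<notin> box a b"
  shows "(\<Sum>\<^sub>\<infinity>k\<in>Z2. ennreal ((cmod (inner_prod F (character k)))\<^sup>2)) = ennreal ((2 * pi)\<^sup>2 * cmod (autocorr S F))"
    and "autocorr S F = complex_of_real (cmod (autocorr S F))"
proof -
  \<comment> \<open>characters are not square-integrable; on functions supported in the box their restrictions act alike\<close>
  define h where "h k x = (if x \<in> box a b then character k x else 0)" for k x
  define q where "q F = complex_of_real ((2 * pi)\<^sup>2) * autocorr S F" for F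
  have cmod_q: "cmod (q F) = (2 * pi)\<^sup>2 * cmod (autocorr S F)" for F
    unfolding q_def norm_mult norm_of_real by simp
  have hm: "h k \<in> borel_measurable lebesgue" for k unfolding h_def by measurable
  have h: "h k \<in> L2" for k
    by (rule bounded_box_L2[OF hm, where B = 1 and a = a and b = b]) (auto simp: h_def)
  have ip: "inner_prod f (h k) = inner_prod f (character k)" if "\<And>x. x \<notin> box a b \<Longrightarrow> f x = 0" for f k
    unfolding inner_prod_def by (rule Bochner_Integration.integral_cong) (auto simp: h_def that)
  have shift: "(\<lambda>x. f (x + c)) \<in> borel_measurable lebesgue"
    "integrable lebesgue (\<lambda>x. (cmod (f (x + c)))\<^sup>2)" if "f \<in> L2" for f c
    using L2D[OF that] integrable_translation_iff[of "\<lambda>x. (cmod (f x))\<^sup>2" c]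
    by (auto intro: borel_measurable_translation)
  have "(\<Sum>\<^sub>\<infinity>k\<in>Z2. ennreal ((cmod (inner_prod F (h k)))\<^sup>2)) = ennreal (cmod (q F)) \<and>
    q F = complex_of_real (cmod (q F))"
  proof (rule square_sum_identity_extends[where S = "box a b" and C = "(2 * pi)\<^sup>2 * real (card S)"])
    show "\<exists>a' b'. box a b \<inter> box (- c) c = box a' b'" for c
      unfolding box_Int_box by blast
    fix f assume f: "f \<in> test_functions" "\<And>x. x \<notin> box a b \<Longrightarrow> f x = 0"
    show "(\<Sum>\<^sub>\<infinity>k\<in>Z2. ennreal ((cmod (inner_prod f (h k)))\<^sup>2)) = ennreal (cmod (q f)) \<and>
        q f = complex_of_real (cmod (q f))"
    proof -
      have "inner_prod f (h k) = inner_prod f (character k)" for k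
        by (rule ip) (rule f(2))
      then show ?thesis
        using parseval_test_function[OF f S disj] unfolding cmod_q by (simp add: q_def)
    qed
  next
    fix G f D
    assume G: "dominated_limit G f D"
    have "(\<lambda>n. autocorr S (G n)) \<longlonglongrightarrow> autocorr S f"
      unfolding autocorr_def
    proof (rule tendsto_sum)
      fix m
      note [measurable] = dominated_limitD(1-3)[OF G]
      have [measurable]: "(\<lambda>x. f (x + (2 * pi) *\<^sub>R m)) \<in> borel_measurable lebesgue"
        "(\<lambda>x. G n (x + (2 * pi) *\<^sub>R m)) \<in> borel_measurable lebesgue"
        "(\<lambda>x. D (x + (2 * pi) *\<^sub>R m)) \<in> borel_measurable lebesgue" for n
        using dominated_limitD(1-3)[OF G] by (auto intro: borel_measurable_translation)
      show "(\<lambda>n. LINT x|lebesgue. cnj (G n x) * G n (x + (2 * pi) *\<^sub>R m)) \<longlonglongrightarrow>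
          (LINT x|lebesgue. cnj (f x) * f (x + (2 * pi) *\<^sub>R m))"
      proof (rule integral_dominated_convergence[where w = "\<lambda>x. D x * D (x + (2 * pi) *\<^sub>R m)"])
        show "integrable lebesgue (\<lambda>x. D x * D (x + (2 * pi) *\<^sub>R m))"
          using dominated_limitD(4)[OF G] integrable_translation_iff[of "\<lambda>x. (D x)\<^sup>2" "(2 * pi) *\<^sub>R m"]
          by (intro integrable_mult_square) auto
        show "AE x in lebesgue. (\<lambda>n. cnj (G n x) * G n (x + (2 * pi) *\<^sub>R m)) \<longlonglongrightarrow> cnj (f x) * f (x + (2 * pi) *\<^sub>R m)"
          using dominated_limitD(7)[OF G] AE_translation[OF dominated_limitD(7)[OF G], of "(2 * pi) *\<^sub>R m"]
          by eventually_elim (intro tendsto_intros)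
        show "AE x in lebesgue. cmod (cnj (G n x) * G n (x + (2 * pi) *\<^sub>R m)) \<le> D x * D (x + (2 * pi) *\<^sub>R m)" for n
          using dominated_limitD(5,8)[OF G] by (auto simp: norm_mult intro!: AE_I2 mult_mono)
      qed measurable
    qed
    then show "(\<lambda>n. q (G n)) \<longlonglongrightarrow> q f"
      unfolding q_def by (intro tendsto_intros)
  next
    fix f assume f: "f \<in> L2"
    have "cmod (LINT x|lebesgue. cnj (f x) * f (x + (2 * pi) *\<^sub>R m)) \<le> norm2_sq f" for m
    proof -
      have "cmod (LINT x|lebesgue. cnj (f x) * f (x + (2 * pi) *\<^sub>R m)) \<le>
          (LINT x|lebesgue. ((cmod (f x))\<^sup>2 + (cmod (f (x + (2 * pi) *\<^sub>R m)))\<^sup>2) / 2)"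
      proof (rule Bochner_Integration.integral_norm_bound_integral)
        show "integrable lebesgue (\<lambda>x. cnj (f x) * f (x + (2 * pi) *\<^sub>R m))"
        proof -
          have "(\<lambda>x. f (x + (2 * pi) *\<^sub>R m)) \<in> L2" using shift[OF f] by (simp add: L2_def)
          from L2_integrable_mult[OF this f] show ?thesis by (simp add: mult.commute)
        qed
        show "integrable lebesgue (\<lambda>x. ((cmod (f x))\<^sup>2 + (cmod (f (x + (2 * pi) *\<^sub>R m)))\<^sup>2) / 2)"
          using L2D(2)[OF f] shift(2)[OF f] by simp
        show "cmod (cnj (f x) * f (x + (2 * pi) *\<^sub>R m)) \<le> ((cmod (f x))\<^sup>2 + (cmod (f (x + (2 * pi) *\<^sub>R m)))\<^sup>2) / 2" for x
          using sum_squares_bound[of "cmod (f x)" "cmod (f (x + (2 * pi) *\<^sub>R m))"] by (simp add: norm_mult)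
      qed
      also have "\<dots> = norm2_sq f"
      proof -
        have "(LINT x|lebesgue. (cmod (f (x + (2 * pi) *\<^sub>R m)))\<^sup>2) = norm2_sq f"
          unfolding norm2_sq_def using L2D(2)[OF f]
          by (intro integral_translation[of "\<lambda>x. (cmod (f x))\<^sup>2"]) auto
        then show ?thesis
          using L2D(2)[OF f] shift(2)[OF f] by (simp add: norm2_sq_def)
      qed
      finally show ?thesis .
    qed
    then have "cmod (autocorr S f) \<le> real (card S) * norm2_sq f"
      unfolding autocorr_def by (intro sum_norm_bound)
    then show "cmod (q f) \<le> (2 * pi)\<^sup>2 * real (card S) * norm2_sq f"
      unfolding cmod_q by (simp add: mult_left_mono mult.assoc)
  qed (use h F supp in auto)
  then have *: "(\<Sum>\<^sub>\<infinity>k\<in>Z2. ennreal ((cmod (inner_prod F (h k)))\<^sup>2)) = ennreal (cmod (q F))"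
    "q F = complex_of_real (cmod (q F))" by auto
  show "(\<Sum>\<^sub>\<infinity>k\<in>Z2. ennreal ((cmod (inner_prod F (character k)))\<^sup>2)) = ennreal ((2 * pi)\<^sup>2 * cmod (autocorr S F))"
  proof -
    have "inner_prod F (h k) = inner_prod F (character k)" for k
      by (rule ip) (rule supp)
    then show ?thesis using *(1) unfolding cmod_q by simp
  qed
  show "autocorr S F = complex_of_real (cmod (autocorr S F))"
    using *(2) unfolding cmod_q by (simp add: q_def)
qed

section \<open>Fiberization\<close>

text \<open>
  The function $\mathcal{I}^k$ belonging to a single generator \<open>g\<close>.
\<close>

definition shift_prod :: "(plane \<Rightarrow> complex) \<Rightarrow> plane \<Rightarrow> plane \<Rightarrow> complex"
  where "shift_prod g k \<xi> = (if k \<in> Z2 then cnj (g \<xi>) * g (\<xi> + (2 * pi) *\<^sub>R k) else 0)"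

text \<open>
  The sesquilinear form in \<open>f\<close> and \<open>h\<close> whose kernel on the shift by $2\pi k$ is
  $\overline{W_k}$. The sums of squared coefficients of the affine systems are such forms on the
  diagonal, with \<open>W\<close> built from \<^const>\<open>shift_prod\<close>.
\<close>

definition pairing ::
  "(plane \<Rightarrow> plane \<Rightarrow> complex) \<Rightarrow> plane set \<Rightarrow> (plane \<Rightarrow> complex) \<Rightarrow> (plane \<Rightarrow> complex) \<Rightarrow> complex"
  where "pairing W K f h =
    (\<Sum>k\<in>K. (LINT \<xi>|lebesgue. cnj (f \<xi>) * h (\<xi> + (2 * pi) *\<^sub>R k) * cnj (W k \<xi>)))"

lemma L2_locD:
  assumes "g \<in> L2_loc"
  shows "g \<in> borel_measurable lebesgue" "compact K \<Longrightarrow> set_integrable lebesgue K (\<lambda>x. (cmod (g x))\<^sup>2)"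
  using assms by (auto simp: L2_loc_def)

lemma L2_loc_linear:
  assumes U: "invertible (U :: matrix2)" and g: "g \<in> L2_loc"
  shows "(\<lambda>x. g (U *v x)) \<in> L2_loc"
  unfolding L2_loc_def
proof (intro CollectI conjI allI impI)
  note [measurable] = L2_locD(1)[OF g] borel_measurable_linear[OF U L2_locD(1)[OF g]]
  show "(\<lambda>x. g (U *v x)) \<in> borel_measurable lebesgue" by measurable
  fix K :: "plane set" assume K: "compact K"
  let ?K = "(*v) U ` K"
  have K': "compact ?K"
    by (intro compact_continuous_image K linear_continuous_on matrix_vector_mul_bounded_linear)
  have "integrable lebesgue (\<lambda>x. indicat_real ?K x *\<^sub>R (cmod (g x))\<^sup>2)"
    using L2_locD(2)[OF g K'] by (simp add: set_integrable_def)
  moreover have "(\<lambda>x. indicat_real ?K x *\<^sub>R (cmod (g x))\<^sup>2) \<in> borel_measurable lebesgue"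
    using calculation by auto
  ultimately have "integrable lebesgue (\<lambda>x. indicat_real ?K (U *v x) *\<^sub>R (cmod (g (U *v x)))\<^sup>2)"
    using integrable_linear_iff[OF U, of "\<lambda>x. indicat_real ?K x *\<^sub>R (cmod (g x))\<^sup>2"] by simp
  moreover have "indicat_real ?K (U *v x) = indicat_real K x" for x
  proof -
    have "inj ((*v) U)"
      using matrix_inv_mult(2)[OF U] by (metis injI matrix_vector_mul_assoc matrix_vector_mul_lid)
    then show ?thesis by (auto simp: indicator_def inj_def)
  qed
  ultimately show "set_integrable lebesgue K (\<lambda>x. (cmod (g (U *v x)))\<^sup>2)"
    by (simp add: set_integrable_def)
qed

lemma test_function_times_L2_loc:
  assumes f: "f \<in> test_functions" and g: "g \<in> L2_loc"
  shows "(\<lambda>x. f x * cnj (g x)) \<in> L2"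
proof -
  obtain a b where ab: "\<And>x. x \<notin> box a b \<Longrightarrow> f x = 0" using test_function_box_bound[OF f] by blast
  obtain B where B: "\<And>x. cmod (f x) \<le> B" using test_function_bounded[OF f] by blast
  note [measurable] = test_function_measurable[OF f] L2_locD(1)[OF g]
  have meas: "(\<lambda>x. f x * cnj (g x)) \<in> borel_measurable lebesgue" by measurable
  have "integrable lebesgue (\<lambda>x. B\<^sup>2 * (indicat_real (cbox a b) x *\<^sub>R (cmod (g x))\<^sup>2))"
    using L2_locD(2)[OF g compact_cbox, of a b] by (simp add: set_integrable_def)
  then have "integrable lebesgue (\<lambda>x. (cmod (f x * cnj (g x)))\<^sup>2)"
  proof (rule Bochner_Integration.integrable_bound)
    show "AE x in lebesgue. norm ((cmod (f x * cnj (g x)))\<^sup>2) \<le>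
        norm (B\<^sup>2 * (indicat_real (cbox a b) x *\<^sub>R (cmod (g x))\<^sup>2))"
    proof (rule AE_I2)
      fix x
      show "norm ((cmod (f x * cnj (g x)))\<^sup>2) \<le> norm (B\<^sup>2 * (indicat_real (cbox a b) x *\<^sub>R (cmod (g x))\<^sup>2))"
      proof (cases "x \<in> box a b")
        case True
        then have "x \<in> cbox a b" using box_subset_cbox by blast
        then show ?thesis
          using power_mono[OF B[of x] norm_ge_zero, of 2]
          by (simp add: norm_mult power_mult_distrib mult_right_mono)
      qed (simp add: ab)
    qed
  qed measurable
  then show ?thesis using meas by (simp add: L2_def)
qed

lemma L2_linear:
  assumes U: "invertible (U :: matrix2)" and f: "f \<in> L2"
  shows "(\<lambda>x. f (U *v x)) \<in> L2"
proof -
  note [measurable] = L2D(1)[OF f] borel_measurable_linear[OF U L2D(1)[OF f]]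
  have "integrable lebesgue (\<lambda>x. (cmod (f (U *v x)))\<^sup>2)"
    using integrable_linear_iff[OF U, of "\<lambda>x. (cmod (f x))\<^sup>2"] L2D(2)[OF f] by simp
  then show ?thesis by (simp add: L2_def)
qed

lemma L2_translation:
  assumes f: "f \<in> L2"
  shows "(\<lambda>x. f (x + c)) \<in> L2"
  using L2D[OF f] integrable_translation_iff[of "\<lambda>x. (cmod (f x))\<^sup>2" c]
  by (auto simp: L2_def intro: borel_measurable_translation)

lemma L2_cmult:
  assumes f: "f \<in> L2"
  shows "(\<lambda>x. c * f x) \<in> L2"
  using L2D[OF f] by (simp add: L2_def norm_mult power_mult_distrib)

lemma invertible_matrix_inv:
  assumes "invertible (U :: matrix2)"
  shows "invertible (matrix_inv U)"
  using matrix_inv_mult[OF assms] unfolding invertible_def by blast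

lemma matrix_inv_mult_vec:
  assumes "invertible (U :: matrix2)"
  shows "matrix_inv U *v (U *v x) = x" "U *v (matrix_inv U *v x) = x"
  using matrix_inv_mult[OF assms] by (simp_all add: matrix_vector_mul_assoc)

lemma integrable_pairing_term:
  assumes U: "invertible (U :: matrix2)" and g: "g \<in> L2_loc"
    and f: "f \<in> test_functions" and h: "h \<in> test_functions"
  shows "integrable lebesgue
    (\<lambda>\<xi>. cnj (f \<xi>) * h (\<xi> + (2 * pi) *\<^sub>R k) * cnj (shift_prod g (U *v k) (U *v \<xi>)))"
proof (cases "U *v k \<in> Z2")
  case True
  define u where "u x = f x * cnj (g (U *v x))" for x
  define v where "v x = h x * cnj (g (U *v x))" for x
  have "u \<in> L2" "v \<in> L2"
    unfolding u_def v_def by (intro test_function_times_L2_loc f h L2_loc_linear[OF U g])+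
  then have "integrable lebesgue (\<lambda>\<xi>. v (\<xi> + (2 * pi) *\<^sub>R k) * cnj (u \<xi>))"
    by (intro L2_integrable_mult L2_translation)
  then show ?thesis
    using True by (simp add: u_def v_def shift_prod_def matrix_vector_right_distrib
        matrix_vector_mult_scaleR mult_ac)
qed (simp add: shift_prod_def)

text \<open>
  After the substitution $x = U\xi$ the inner products of \<open>f\<close> with the functions
  $g_{U;0,k}$ are the Fourier coefficients of
  $F(x) = |\det U|^{-1/2} f(U^{-1}x)\,\overline{g(x)}$, a square-integrable function of bounded
  support. Parseval's identity expresses the sum of their squares by the autocorrelations of
  \<open>F\<close> at $2\pi m$, and substituting back turns these into the terms of the pairing with
  $k = U^{-1}m$. The set \<open>K\<close> may contain further points: there either \<^const>\<open>shift_prod\<close>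
  vanishes or the supports of \<open>f\<close> and its translate are disjoint.
\<close>

theorem coeff_sum_eq_pairing:
  assumes f: "f \<in> test_functions" and supp: "\<And>x. x \<notin> box a b \<Longrightarrow> f x = 0"
    and U: "invertible (U :: matrix2)" and g: "g \<in> L2_loc" and K: "finite K"
    and disj: "\<And>k x. U *v k \<in> Z2 \<Longrightarrow> k \<notin> K \<Longrightarrow> x \<in> box a b \<Longrightarrow> x + (2 * pi) *\<^sub>R k \<notin> box a b"
  defines "T \<equiv> pairing (\<lambda>k \<xi>. shift_prod g (U *v k) (U *v \<xi>)) K f f"
  shows "coeff_sum f U g = ennreal ((2 * pi)\<^sup>2 * cmod T)" and "T = complex_of_real (cmod T)"
proof -
  define V where "V = matrix_inv U"
  have V: "invertible V" using invertible_matrix_inv[OF U] by (simp add: V_def)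
  have VU [simp]: "V *v (U *v x) = x" "U *v (V *v x) = x" for x
    using matrix_inv_mult_vec[OF U] by (simp_all add: V_def)
  have d: "0 < \<bar>det U\<bar>" using U by (simp add: invertible_det_nz)
  define c where "c = complex_of_real (1 / sqrt \<bar>det U\<bar>)"
  have cc: "complex_of_real \<bar>det U\<bar> * (cnj c * c) = 1" "complex_of_real \<bar>det U\<bar> * c = complex_of_real (sqrt \<bar>det U\<bar>)"
  proof -
    have "\<bar>det U\<bar> = sqrt \<bar>det U\<bar> * sqrt \<bar>det U\<bar>" by simp
    then have "\<bar>det U\<bar> * (1 / sqrt \<bar>det U\<bar>) = sqrt \<bar>det U\<bar>"
      using d by (metis nonzero_eq_divide_eq mult.right_neutral real_sqrt_gt_0_iff times_divide_eq_right less_irrefl)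
    then show "complex_of_real \<bar>det U\<bar> * c = complex_of_real (sqrt \<bar>det U\<bar>)"
      unfolding c_def by (metis of_real_mult)
    then show "complex_of_real \<bar>det U\<bar> * (cnj c * c) = 1"
      using d by (simp add: c_def flip: of_real_mult)
  qed
  define F where "F x = c * (f (V *v x) * cnj (g x))" for x
  have F: "F \<in> L2"
  proof -
    have "(\<lambda>x. f x * cnj (g (U *v x))) \<in> L2"
      by (intro test_function_times_L2_loc f L2_loc_linear[OF U g])
    from L2_cmult[OF L2_linear[OF V this], of c] show ?thesis by (simp add: F_def[abs_def])
  qed
  have "bounded ((*v) U ` box a b)"
    by (intro bounded_linear_image bounded_box matrix_vector_mul_bounded_linear)
  then obtain b' where b': "(*v) U ` box a b \<subseteq> box (- b') b'"
    using bounded_subset_box_symmetric by blast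
  have Fsupp: "F x = 0" if "x \<notin> box (- b') b'" for x
  proof -
    have "V *v x \<notin> box a b" using b' that VU(2)[of x] by (metis imageI subsetD)
    then show ?thesis by (simp add: F_def supp)
  qed
  define S where "S = overlaps (box (- b') b')"
  have S: "finite S" "S \<subseteq> Z2" unfolding S_def
    by (simp_all add: finite_overlaps overlaps_subset)
  have Sdisj: "x + (2 * pi) *\<^sub>R m \<notin> box (- b') b'" if "m \<in> Z2" "m \<notin> S" "x \<in> box (- b') b'" for m x
    using that overlapsI unfolding S_def by blast
  have ip: "inner_prod f (dilmod U k g) = inner_prod F (character k)" for k
  proof -
    have "(\<lambda>x. F x * cnj (character k x)) \<in> borel_measurable lebesgue"
      using L2D(1)[OF F] by measurable
    then have "inner_prod F (character k) =
        complex_of_real \<bar>det U\<bar> * (LINT \<xi>|lebesgue. F (U *v \<xi>) * cnj (character k (U *v \<xi>)))"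
      unfolding inner_prod_def by (subst integral_linear[OF U]) (simp_all add: scaleR_conv_of_real)
    also have "\<dots> = (LINT \<xi>|lebesgue. complex_of_real \<bar>det U\<bar> * (F (U *v \<xi>) * cnj (character k (U *v \<xi>))))"
      by simp
    also have "\<dots> = inner_prod f (dilmod U k g)"
      unfolding inner_prod_def
    proof (rule Bochner_Integration.integral_cong[OF refl])
      fix \<xi>
      have "complex_of_real \<bar>det U\<bar> * (F (U *v \<xi>) * cnj (character k (U *v \<xi>))) =
          (complex_of_real \<bar>det U\<bar> * c) * (f \<xi> * cnj (g (U *v \<xi>)) * cnj (character k (U *v \<xi>)))"
        by (simp add: F_def)
      also have "\<dots> = f \<xi> * cnj (dilmod U k g \<xi>)"
        unfolding cc(2) by (simp add: dilmod_def character_def)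
      finally show "complex_of_real \<bar>det U\<bar> * (F (U *v \<xi>) * cnj (character k (U *v \<xi>))) =
          f \<xi> * cnj (dilmod U k g \<xi>)" .
    qed
    finally show ?thesis ..
  qed
  define t where "t k = (LINT \<xi>|lebesgue. cnj (f \<xi>) * f (\<xi> + (2 * pi) *\<^sub>R k) *
      cnj (shift_prod g (U *v k) (U *v \<xi>)))" for k
  have term_eq: "(LINT x|lebesgue. cnj (F x) * F (x + (2 * pi) *\<^sub>R m)) = t (V *v m)" if m: "m \<in> Z2" for m
  proof -
    have [measurable]: "F \<in> borel_measurable lebesgue" "(\<lambda>x. F (x + (2 * pi) *\<^sub>R m)) \<in> borel_measurable lebesgue"
      using L2D(1)[OF F] by (auto intro: borel_measurable_translation)
    have "(LINT x|lebesgue. cnj (F x) * F (x + (2 * pi) *\<^sub>R m)) =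
        complex_of_real \<bar>det U\<bar> * (LINT \<xi>|lebesgue. cnj (F (U *v \<xi>)) * F (U *v \<xi> + (2 * pi) *\<^sub>R m))"
      by (subst integral_linear[OF U]) (measurable, simp add: scaleR_conv_of_real[of "\<bar>det U\<bar>"])
    also have "\<dots> = (LINT \<xi>|lebesgue. complex_of_real \<bar>det U\<bar> * (cnj (F (U *v \<xi>)) * F (U *v \<xi> + (2 * pi) *\<^sub>R m)))"
      by simp
    also have "\<dots> = t (V *v m)"
      unfolding t_def
    proof (rule Bochner_Integration.integral_cong[OF refl])
      fix \<xi>
      have "V *v (U *v \<xi> + (2 * pi) *\<^sub>R m) = \<xi> + (2 * pi) *\<^sub>R (V *v m)"
        by (simp add: matrix_vector_right_distrib matrix_vector_mult_scaleR)
      then have "complex_of_real \<bar>det U\<bar> * (cnj (F (U *v \<xi>)) * F (U *v \<xi> + (2 * pi) *\<^sub>R m)) =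
         (complex_of_real \<bar>det U\<bar> * (cnj c * c)) * (cnj (f \<xi>) * f (\<xi> + (2 * pi) *\<^sub>R (V *v m)) *
            (g (U *v \<xi>) * cnj (g (U *v \<xi> + (2 * pi) *\<^sub>R m))))"
        by (simp add: F_def mult_ac)
      also have "\<dots> = cnj (f \<xi>) * f (\<xi> + (2 * pi) *\<^sub>R (V *v m)) *
            cnj (shift_prod g (U *v (V *v m)) (U *v \<xi>))"
        unfolding cc(1) using m by (simp add: shift_prod_def)
      finally show "complex_of_real \<bar>det U\<bar> * (cnj (F (U *v \<xi>)) * F (U *v \<xi> + (2 * pi) *\<^sub>R m)) =
        cnj (f \<xi>) * f (\<xi> + (2 * pi) *\<^sub>R (V *v m)) * cnj (shift_prod g (U *v (V *v m)) (U *v \<xi>))" .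
    qed
    finally show ?thesis .
  qed
  have T: "autocorr S F = T"
  proof -
    have "autocorr S F = (\<Sum>m\<in>S. t (V *v m))"
      unfolding autocorr_def using S term_eq by (intro sum.cong) auto
    also have "\<dots> = (\<Sum>k\<in>(*v) V ` S. t k)"
      by (subst sum.reindex) (auto simp: inj_on_def dest: arg_cong[where f = "(*v) U"])
    also have "\<dots> = (\<Sum>k\<in>(*v) V ` S \<inter> K. t k)"
    proof (rule sum.mono_neutral_right)
      show "\<forall>k\<in>(*v) V ` S - (*v) V ` S \<inter> K. t k = 0"
      proof
        fix k assume k: "k \<in> (*v) V ` S - (*v) V ` S \<inter> K"
        then have "U *v k \<in> Z2" "k \<notin> K" using S by auto
        then have "f \<xi> = 0 \<or> f (\<xi> + (2 * pi) *\<^sub>R k) = 0" for \<xi>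
          using disj[of k \<xi>] supp by blast
        then have *: "(\<lambda>\<xi>. cnj (f \<xi>) * f (\<xi> + (2 * pi) *\<^sub>R k) * cnj (shift_prod g (U *v k) (U *v \<xi>))) = (\<lambda>\<xi>. 0)"
          by (fastforce simp: fun_eq_iff)
        show "t k = 0" unfolding t_def * by simp
      qed
    qed (use S in auto)
    also have "\<dots> = (\<Sum>k\<in>K. t k)"
    proof (rule sum.mono_neutral_left[OF K])
      show "\<forall>k\<in>K - (*v) V ` S \<inter> K. t k = 0"
      proof
        fix k assume k: "k \<in> K - (*v) V ` S \<inter> K"
        have "U *v k \<notin> S"
        proof
          assume "U *v k \<in> S"
          then have "V *v (U *v k) \<in> (*v) V ` S" by (rule imageI)
          then show False using k by simp
        qed
        then have "f \<xi> = 0 \<or> f (\<xi> + (2 * pi) *\<^sub>R k) = 0 \<or> U *v k \<notin> Z2" for \<xi>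
        proof -
          have "U *v (\<xi> + (2 * pi) *\<^sub>R k) = U *v \<xi> + (2 * pi) *\<^sub>R (U *v k)"
            by (simp add: matrix_vector_right_distrib matrix_vector_mult_scaleR)
          then show ?thesis
            using Sdisj[of "U *v k" "U *v \<xi>"] \<open>U *v k \<notin> S\<close> supp b' by (metis imageI subsetD)
        qed
        then have *: "(\<lambda>\<xi>. cnj (f \<xi>) * f (\<xi> + (2 * pi) *\<^sub>R k) * cnj (shift_prod g (U *v k) (U *v \<xi>))) = (\<lambda>\<xi>. 0)"
          by (fastforce simp: fun_eq_iff shift_prod_def)
        show "t k = 0" unfolding t_def * by simp
      qed
    qed auto
    finally show ?thesis by (simp add: T_def pairing_def t_def)
  qed
  show "coeff_sum f U g = ennreal ((2 * pi)\<^sup>2 * cmod T)"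
    unfolding coeff_sum_def ip T[symmetric] by (rule parseval(1)[OF F Fsupp S Sdisj])
  show "T = complex_of_real (cmod T)"
    unfolding T[symmetric] by (rule parseval(2)[OF F Fsupp S Sdisj])
qed

section \<open>Polarization and localization\<close>

text \<open>
  Test functions approximate the phase of \<open>D\<close> boundedly almost everywhere, and integrating
  against the phase yields the integral of $|D|$.
\<close>

lemma AE_zero_on_box:
  assumes D: "integrable lebesgue (\<lambda>x. indicat_real (box a b) x *\<^sub>R D x)"
    and orth: "\<And>f. f \<in> test_functions \<Longrightarrow> (\<And>x. x \<notin> box a b \<Longrightarrow> f x = 0) \<Longrightarrow>
      (LINT x|lebesgue. cnj (f x) * cnj (D x)) = 0"
  shows "AE x in lebesgue. x \<in> box a b \<longrightarrow> D x = (0::complex)"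
proof -
  define E where "E x = indicat_real (box a b) x *\<^sub>R D x" for x
  have E: "integrable lebesgue E" using D by (simp add: E_def[abs_def])
  then have [measurable]: "E \<in> borel_measurable lebesgue" by auto
  define u where "u x = cnj (E x) / complex_of_real (cmod (E x))" for x
  have um: "u \<in> borel_measurable lebesgue" unfolding u_def by measurable
  have u1: "cmod (u x) \<le> 1" for x by (simp add: u_def norm_divide)
  have u0: "u x = 0" if "x \<notin> box a b" for x using that by (simp add: u_def E_def)
  obtain f where f: "\<And>n. f n \<in> test_functions" "\<And>n x. x \<notin> box a b \<Longrightarrow> f n x = 0"
    "\<And>n x. cmod (f n x) \<le> 1 + 1" "AE x in lebesgue. (\<lambda>n. f n x) \<longlonglongrightarrow> u x"
    using bounded_box_approx[OF um u1 u0] by blast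
  have zero: "(LINT x|lebesgue. cnj (f n x) * cnj (E x)) = 0" for n
  proof -
    have "(LINT x|lebesgue. cnj (f n x) * cnj (E x)) = (LINT x|lebesgue. cnj (f n x) * cnj (D x))"
      using f(2)[of _ n] by (intro Bochner_Integration.integral_cong) (auto simp: E_def indicator_def)
    then show ?thesis using orth[OF f(1,2)] by simp
  qed
  have "(\<lambda>n. LINT x|lebesgue. cnj (f n x) * cnj (E x)) \<longlonglongrightarrow> (LINT x|lebesgue. cnj (u x) * cnj (E x))"
  proof (rule integral_dominated_convergence[where w = "\<lambda>x. 2 * cmod (E x)"])
    note [measurable] = um test_function_measurable[OF f(1)]
    show "(\<lambda>x. cnj (u x) * cnj (E x)) \<in> borel_measurable lebesgue"
      "(\<lambda>x. cnj (f n x) * cnj (E x)) \<in> borel_measurable lebesgue" for n by measurable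
    show "integrable lebesgue (\<lambda>x. 2 * cmod (E x))" using E by simp
    show "AE x in lebesgue. (\<lambda>n. cnj (f n x) * cnj (E x)) \<longlonglongrightarrow> cnj (u x) * cnj (E x)"
      using f(4) by eventually_elim (intro tendsto_intros)
    show "AE x in lebesgue. cmod (cnj (f n x) * cnj (E x)) \<le> 2 * cmod (E x)" for n
      using f(3) by (auto simp: norm_mult intro!: AE_I2 mult_right_mono)
  qed
  then have "(LINT x|lebesgue. cnj (u x) * cnj (E x)) = 0"
    unfolding zero by (simp add: LIMSEQ_const_iff)
  moreover have "cnj (u x) * cnj (E x) = complex_of_real (cmod (E x))" for x
  proof (cases "E x = 0")
    case False
    have "cnj (u x) * cnj (E x) = (E x * cnj (E x)) / complex_of_real (cmod (E x))"
      by (simp add: u_def)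
    also have "\<dots> = complex_of_real ((cmod (E x))\<^sup>2 / cmod (E x))"
      unfolding of_real_divide complex_norm_square ..
    also have "(cmod (E x))\<^sup>2 / cmod (E x) = cmod (E x)"
      using False by (simp add: power2_eq_square)
    finally show ?thesis .
  qed (simp add: u_def)
  ultimately have "complex_of_real (LINT x|lebesgue. cmod (E x)) = 0"
    by (simp only: integral_complex_of_real)
  then have "(LINT x|lebesgue. cmod (E x)) = 0" by simp
  then have "AE x in lebesgue. cmod (E x) = 0"
    using E by (subst (asm) integral_nonneg_eq_0_iff_AE) auto
  then show ?thesis
    by eventually_elim (auto simp: E_def)
qed

lemma countable_Z2: "countable Z2"
proof -
  have "Z2 \<subseteq> (\<Union>n. Z2 \<inter> cball 0 (real n))"
  proof
    fix x assume "x \<in> Z2"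
    moreover obtain n where "norm x \<le> real n" using real_arch_simple by blast
    ultimately show "x \<in> (\<Union>n. Z2 \<inter> cball 0 (real n))"
      by (intro UN_I[of n]) auto
  qed
  moreover have "countable (\<Union>n. Z2 \<inter> cball 0 (real n))"
    by (intro countable_UN countableI_type countable_finite[OF finite_Z2_bounded] bounded_cball)
  ultimately show ?thesis by (rule countable_subset)
qed

text \<open>
  The boxes around the points of the scaled lattice are countably many and cover the plane.
\<close>

lemma AE_from_small_boxes:
  assumes e: "0 < e"
    and local: "\<And>c. AE x in lebesgue. x \<in> box (c - e *\<^sub>R 1) (c + e *\<^sub>R 1) \<longrightarrow> P x"
  shows "AE x::plane in lebesgue. P x"
proof -
  have "AE x in lebesgue. \<forall>m\<in>Z2. x \<in> box (e *\<^sub>R m - e *\<^sub>R 1) (e *\<^sub>R m + e *\<^sub>R 1) \<longrightarrow> P x"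
    unfolding AE_ball_countable[OF countable_Z2] using local by blast
  then show ?thesis
  proof eventually_elim
    case (elim x)
    define m :: plane where "m = (\<chi> i. of_int (round (x $ i / e)))"
    have "m \<in> Z2" by (simp add: m_def Z2_def)
    moreover have "x \<in> box (e *\<^sub>R m - e *\<^sub>R 1) (e *\<^sub>R m + e *\<^sub>R 1)"
    proof -
      have "e * m $ i - e < x $ i \<and> x $ i < e * m $ i + e" for i
      proof -
        have "\<bar>of_int (round (x $ i / e)) - x $ i / e\<bar> < 1"
          using of_int_round_abs_le[of "x $ i / e"] by linarith
        then have "e * \<bar>of_int (round (x $ i / e)) - x $ i / e\<bar> < e" using e by simp
        moreover have "\<bar>e * of_int (round (x $ i / e)) - x $ i\<bar> < e"
          if "e * \<bar>of_int (round (x $ i / e)) - x $ i / e\<bar> < e"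
        proof -
          have "e * of_int (round (x $ i / e)) - x $ i = e * (of_int (round (x $ i / e)) - x $ i / e)"
            using e by (simp add: field_simps)
          then show ?thesis using that e by (simp add: abs_mult)
        qed
        ultimately have "\<bar>e * of_int (round (x $ i / e)) - x $ i\<bar> < e" by blast
        then show ?thesis by (simp add: m_def abs_less_iff)
      qed
      then show ?thesis by (simp add: mem_box_cart)
    qed
    ultimately show ?case using elim by blast
  qed
qed

text \<open>
  Expanding the form at $f + c h$ leaves $c\,B(f,h) + \bar c\,B(h,f) = 0$; the choices $c = 1$
  and $c = i$ together force $B(f,h) = 0$.
\<close>

lemma pairing_polarization:
  assumes int: "\<And>f h k. f \<in> test_functions \<Longrightarrow> h \<in> test_functions \<Longrightarrow> k \<in> K \<Longrightarrow>
      integrable lebesgue (\<lambda>\<xi>. cnj (f \<xi>) * h (\<xi> + (2 * pi) *\<^sub>R k) * cnj (W k \<xi>))"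
    and diag: "\<And>f. f \<in> test_functions \<Longrightarrow> (\<And>x. x \<notin> B \<Longrightarrow> f x = 0) \<Longrightarrow> pairing W K f f = 0"
    and f: "f \<in> test_functions" "\<And>x. x \<notin> B \<Longrightarrow> f x = 0"
    and h: "h \<in> test_functions" "\<And>x. x \<notin> B \<Longrightarrow> h x = 0"
  shows "pairing W K f h = 0"
proof -
  have expand: "pairing W K (\<lambda>x. f x + c * h x) (\<lambda>x. f x + c * h x) =
      pairing W K f f + c * pairing W K f h + cnj c * pairing W K h f + cnj c * c * pairing W K h h" for c
  proof -
    have "(LINT \<xi>|lebesgue. cnj (f \<xi> + c * h \<xi>) * (f (\<xi> + (2 * pi) *\<^sub>R k) + c * h (\<xi> + (2 * pi) *\<^sub>R k)) * cnj (W k \<xi>)) =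
        (LINT \<xi>|lebesgue. cnj (f \<xi>) * f (\<xi> + (2 * pi) *\<^sub>R k) * cnj (W k \<xi>)) +
        c * (LINT \<xi>|lebesgue. cnj (f \<xi>) * h (\<xi> + (2 * pi) *\<^sub>R k) * cnj (W k \<xi>)) +
        cnj c * (LINT \<xi>|lebesgue. cnj (h \<xi>) * f (\<xi> + (2 * pi) *\<^sub>R k) * cnj (W k \<xi>)) +
        cnj c * c * (LINT \<xi>|lebesgue. cnj (h \<xi>) * h (\<xi> + (2 * pi) *\<^sub>R k) * cnj (W k \<xi>))"
      (is "?L = ?R") if "k \<in> K" for k
    proof -
      note i = int[OF f(1) f(1) that] int[OF f(1) h(1) that] int[OF h(1) f(1) that] int[OF h(1) h(1) that]
      have "?R = (LINT \<xi>|lebesgue. cnj (f \<xi>) * f (\<xi> + (2 * pi) *\<^sub>R k) * cnj (W k \<xi>) +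
          c * (cnj (f \<xi>) * h (\<xi> + (2 * pi) *\<^sub>R k) * cnj (W k \<xi>)) +
          cnj c * (cnj (h \<xi>) * f (\<xi> + (2 * pi) *\<^sub>R k) * cnj (W k \<xi>)) +
          cnj c * c * (cnj (h \<xi>) * h (\<xi> + (2 * pi) *\<^sub>R k) * cnj (W k \<xi>)))"
        using i by simp
      also have "\<dots> = ?L"
        by (rule Bochner_Integration.integral_cong[OF refl]) (simp add: algebra_simps)
      finally show ?thesis ..
    qed
    then show ?thesis
      unfolding pairing_def by (simp add: sum.distrib sum_distrib_left)
  qed
  have zero: "c * pairing W K f h + cnj c * pairing W K h f = 0" for c
  proof -
    have "pairing W K (\<lambda>x. f x + c * h x) (\<lambda>x. f x + c * h x) = 0"
      by (intro diag test_functions_add test_functions_cmult f h) (simp add: f h)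
    then show ?thesis
      unfolding expand using diag[OF f] diag[OF h] by simp
  qed
  from zero[of 1] zero[of "\<i>"] show ?thesis
    by (simp add: algebra_simps)
qed

lemma finite_lattice_bounded:
  assumes U: "invertible (U :: matrix2)" and "bounded B"
  shows "finite {k \<in> B. U *v k \<in> Z2}"
proof -
  have "bounded ((*v) U ` B)"
    by (intro bounded_linear_image assms matrix_vector_mul_bounded_linear)
  then have "finite (Z2 \<inter> (*v) U ` B)" by (rule finite_Z2_bounded)
  moreover have "{k \<in> B. U *v k \<in> Z2} \<subseteq> (*v) (matrix_inv U) ` (Z2 \<inter> (*v) U ` B)"
  proof
    fix k assume "k \<in> {k \<in> B. U *v k \<in> Z2}"
    then have "U *v k \<in> Z2 \<inter> (*v) U ` B" "k = matrix_inv U *v (U *v k)"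
      by (auto simp: matrix_inv_mult_vec[OF U])
    then show "k \<in> (*v) (matrix_inv U) ` (Z2 \<inter> (*v) U ` B)" by blast
  qed
  ultimately show ?thesis by (blast intro: finite_subset finite_imageI)
qed

text \<open>
  By polarization the form vanishes off the diagonal as well. As \<open>\<Lambda>\<close> is discrete, a
  function \<open>f\<close> supported near a point and a bump \<open>h\<close> near that point shifted by
  $2\pi k_0$ see only the single shift $k_0$, so that the kernel \<open>W k0\<close> annihilates all such
  \<open>f\<close>.
\<close>

lemma AE_zero_of_pairing_zero:
  assumes int: "\<And>f h k. f \<in> test_functions \<Longrightarrow> h \<in> test_functions \<Longrightarrow>
      integrable lebesgue (\<lambda>\<xi>. cnj (f \<xi>) * h (\<xi> + (2 * pi) *\<^sub>R k) * cnj (W k \<xi>))"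
    and discrete: "\<And>B. bounded B \<Longrightarrow> finite (\<Lambda> \<inter> B)"
    and zero: "\<And>f c K. f \<in> test_functions \<Longrightarrow> (\<And>x. x \<notin> box (- c) c \<Longrightarrow> f x = 0) \<Longrightarrow> finite K \<Longrightarrow> K \<subseteq> \<Lambda> \<Longrightarrow>
      (\<And>k x. k \<in> \<Lambda> \<Longrightarrow> k \<notin> K \<Longrightarrow> x \<in> box (- c) c \<Longrightarrow> x + (2 * pi) *\<^sub>R k \<notin> box (- c) c) \<Longrightarrow>
      pairing W K f f = 0"
    and k0: "k0 \<in> \<Lambda>"
  shows "AE \<xi> in lebesgue. W k0 \<xi> = 0"
proof -
  obtain e where e: "0 < e" "\<And>k. k \<in> \<Lambda> \<Longrightarrow> k \<noteq> k0 \<Longrightarrow> e \<le> norm (k - k0)"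
  proof -
    have fin: "finite ((\<lambda>k. norm (k - k0)) ` (\<Lambda> \<inter> cball k0 1 - {k0}))"
      using discrete[of "cball k0 1"] by simp
    define e where "e = Min (insert 1 ((\<lambda>k. norm (k - k0)) ` (\<Lambda> \<inter> cball k0 1 - {k0})))"
    show ?thesis
    proof (rule that[of e])
      show "0 < e" unfolding e_def using fin by (subst Min_gr_iff) auto
      show "e \<le> norm (k - k0)" if "k \<in> \<Lambda>" "k \<noteq> k0" for k
      proof (cases "norm (k - k0) \<le> 1")
        case True
        then show ?thesis
          unfolding e_def using fin that by (intro Min_le) (auto simp: dist_norm norm_minus_commute)
      next
        case False
        moreover have "e \<le> 1" unfolding e_def using fin by (intro Min_le) auto
        ultimately show ?thesis by linarith
      qed
    qed
  qed
  show ?thesis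
  proof (rule AE_from_small_boxes[OF e(1)])
    fix c :: plane
    define c' where "c' = c + (2 * pi) *\<^sub>R k0"
    \<comment> \<open>\<open>f\<close> lives on \<open>?B\<close>; the bump \<open>h\<close> is $1$ on its shift by $2\pi k_0$ and $0$ off \<open>?B'\<close>.
      Another $k$ in \<open>\<Lambda>\<close> would need $2\pi|k - k_0| < 6e$, but $e \le |k - k_0|$ and $3 < \pi$.\<close>
    let ?B = "box (c - e *\<^sub>R 1) (c + e *\<^sub>R 1)"
    let ?B' = "box (c' - (2 * e) *\<^sub>R 1) (c' + (2 * e) *\<^sub>R 1)"
    define h where "h x = complex_of_real (box_bump (1 / e) (c' - (2 * e) *\<^sub>R 1) (c' + (2 * e) *\<^sub>R 1) x)" for x
    have h: "h \<in> test_functions" unfolding h_def using e by (intro box_bump_test_function) simp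
    have h0: "h x = 0" if "x \<notin> ?B'" for x
      unfolding h_def using e that by (subst box_bump_eq_0) auto
    have h1: "h (x + (2 * pi) *\<^sub>R k0) = 1" if "x \<in> ?B" for x
    proof -
      have x: "c $ i - e < x $ i" "x $ i < c $ i + e" for i
        using that by (auto simp: mem_box_cart)
      have "box_bump (1 / e) (c' - (2 * e) *\<^sub>R 1) (c' + (2 * e) *\<^sub>R 1) (x + (2 * pi) *\<^sub>R k0) = 1"
      proof (rule box_bump_eq_1)
        fix i
        show "1 \<le> 1 / e * ((x + (2 * pi) *\<^sub>R k0) $ i - (c' - (2 * e) *\<^sub>R 1) $ i)"
          using x(1)[of i] e(1) by (simp add: c'_def field_simps)
        show "1 \<le> 1 / e * ((c' + (2 * e) *\<^sub>R 1) $ i - (x + (2 * pi) *\<^sub>R k0) $ i)"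
          using x(2)[of i] e(1) by (simp add: c'_def field_simps)
      qed
      then show ?thesis by (simp add: h_def)
    qed
    define b where "b = complex_of_real \<circ> box_bump (1 / e) (c - (2 * e) *\<^sub>R 1) (c + (2 * e) *\<^sub>R 1)"
    have b: "b \<in> test_functions" unfolding b_def o_def using e by (intro box_bump_test_function) simp
    have b1: "b x = 1" if "x \<in> ?B" for x
    proof -
      have x: "c $ i - e < x $ i" "x $ i < c $ i + e" for i
        using that by (auto simp: mem_box_cart)
      have "box_bump (1 / e) (c - (2 * e) *\<^sub>R 1) (c + (2 * e) *\<^sub>R 1) x = 1"
      proof (rule box_bump_eq_1)
        fix i
        show "1 \<le> 1 / e * (x $ i - (c - (2 * e) *\<^sub>R 1) $ i)" "1 \<le> 1 / e * ((c + (2 * e) *\<^sub>R 1) $ i - x $ i)"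
          using x[of i] e(1) by (simp_all add: field_simps)
      qed
      then show ?thesis by (simp add: b_def)
    qed
    show "AE \<xi> in lebesgue. \<xi> \<in> ?B \<longrightarrow> W k0 \<xi> = 0"
    proof (rule AE_zero_on_box)
      have "integrable lebesgue (\<lambda>\<xi>. indicat_real ?B \<xi> *\<^sub>R (cnj (b \<xi>) * h (\<xi> + (2 * pi) *\<^sub>R k0) * cnj (W k0 \<xi>)))"
        using int[OF b h, of k0] by (intro integrable_mult_indicator) auto
      then have "integrable lebesgue (\<lambda>\<xi>. cnj (indicat_real ?B \<xi> *\<^sub>R (cnj (b \<xi>) * h (\<xi> + (2 * pi) *\<^sub>R k0) * cnj (W k0 \<xi>))))"
        by (rule integrable_cnj)
      also have "(\<lambda>\<xi>. cnj (indicat_real ?B \<xi> *\<^sub>R (cnj (b \<xi>) * h (\<xi> + (2 * pi) *\<^sub>R k0) * cnj (W k0 \<xi>)))) =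
          (\<lambda>\<xi>. indicat_real ?B \<xi> *\<^sub>R W k0 \<xi>)"
        using b1 h1 by (auto simp: fun_eq_iff indicator_def)
      finally show "integrable lebesgue (\<lambda>\<xi>. indicat_real ?B \<xi> *\<^sub>R W k0 \<xi>)" .
      fix f assume f: "f \<in> test_functions" "\<And>x. x \<notin> ?B \<Longrightarrow> f x = 0"
      have "bounded (?B \<union> ?B')" by simp
      then obtain d where d: "?B \<union> ?B' \<subseteq> box (- d) d"
        using bounded_subset_box_symmetric by blast
      define D where "D = {k. \<exists>x\<in>box (- d) d. x + (2 * pi) *\<^sub>R k \<in> box (- d) d}"
      have D: "bounded D"
        unfolding D_def by (rule bounded_overlapping_shifts) simp
      define K where "K = insert k0 (\<Lambda> \<inter> D)"
      have K: "finite K" "K \<subseteq> \<Lambda>" using discrete[OF D] k0 by (auto simp: K_def)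
      have "pairing W K f h = 0"
      proof (rule pairing_polarization[where B = "box (- d) d"])
        fix u assume u: "u \<in> test_functions" "\<And>x. x \<notin> box (- d) d \<Longrightarrow> u x = 0"
        show "pairing W K u u = 0"
          by (rule zero[OF u K]) (auto simp: K_def D_def)
      next
        show "f x = 0" "h x = 0" if "x \<notin> box (- d) d" for x
          using that d f(2)[of x] h0[of x] by blast+
      qed (use int f(1) h in auto)
      moreover have "pairing W K f h = (LINT \<xi>|lebesgue. cnj (f \<xi>) * cnj (W k0 \<xi>))"
      proof -
        have other: "(LINT \<xi>|lebesgue. cnj (f \<xi>) * h (\<xi> + (2 * pi) *\<^sub>R k) * cnj (W k \<xi>)) = 0"
          if k: "k \<in> K - {k0}" for k
        proof -
          have "f \<xi> = 0 \<or> h (\<xi> + (2 * pi) *\<^sub>R k) = 0" for \<xi>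
          proof (rule ccontr)
            assume "\<not> (f \<xi> = 0 \<or> h (\<xi> + (2 * pi) *\<^sub>R k) = 0)"
            then have "\<xi> \<in> ?B" "\<xi> + (2 * pi) *\<^sub>R k \<in> ?B'" using f(2) h0 by blast+
            then have "\<bar>2 * pi * (k $ i - k0 $ i)\<bar> < 3 * e" for i
            proof -
              have "c $ i - e < \<xi> $ i" "\<xi> $ i < c $ i + e"
                using \<open>\<xi> \<in> ?B\<close> by (auto simp: mem_box_cart)
              moreover have "c $ i + 2 * pi * k0 $ i - 2 * e < \<xi> $ i + 2 * pi * k $ i"
                "\<xi> $ i + 2 * pi * k $ i < c $ i + 2 * pi * k0 $ i + 2 * e"
                using \<open>\<xi> + (2 * pi) *\<^sub>R k \<in> ?B'\<close> by (auto simp: mem_box_cart c'_def)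
              ultimately have "\<bar>2 * pi * k $ i - 2 * pi * k0 $ i\<bar> < 3 * e" by linarith
              then show ?thesis by (simp add: right_diff_distrib)
            qed
            then have comp: "2 * pi * \<bar>k $ i - k0 $ i\<bar> < 3 * e" for i by (simp add: abs_mult)
            have "2 * pi * (\<bar>k $ 1 - k0 $ 1\<bar> + \<bar>k $ 2 - k0 $ 2\<bar>) < 6 * e"
              using comp[of 1] comp[of 2] by (simp add: distrib_left)
            moreover have "norm (k - k0) \<le> \<bar>k $ 1 - k0 $ 1\<bar> + \<bar>k $ 2 - k0 $ 2\<bar>"
              using norm_le_l1_cart[of "k - k0"] by (simp add: sum_2)
            then have "2 * pi * norm (k - k0) \<le> 2 * pi * (\<bar>k $ 1 - k0 $ 1\<bar> + \<bar>k $ 2 - k0 $ 2\<bar>)"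
              by (intro mult_left_mono) auto
            moreover have "2 * pi * e \<le> 2 * pi * norm (k - k0)"
              using e(2)[of k] k K by (intro mult_left_mono) auto
            moreover have "6 * e \<le> 2 * pi * e" using e(1) pi_gt3 by simp
            ultimately show False by linarith
          qed
          then have *: "(\<lambda>\<xi>. cnj (f \<xi>) * h (\<xi> + (2 * pi) *\<^sub>R k) * cnj (W k \<xi>)) = (\<lambda>\<xi>. 0)"
            by (fastforce simp: fun_eq_iff)
          show ?thesis unfolding * by simp
        qed
        have "pairing W K f h = (LINT \<xi>|lebesgue. cnj (f \<xi>) * h (\<xi> + (2 * pi) *\<^sub>R k0) * cnj (W k0 \<xi>))"
          unfolding pairing_def using K(1)
          by (subst sum.remove[of _ k0]) (auto simp: K_def intro!: sum.neutral other)
        also have "\<dots> = (LINT \<xi>|lebesgue. cnj (f \<xi>) * cnj (W k0 \<xi>))"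
        proof (rule Bochner_Integration.integral_cong[OF refl])
          fix \<xi>
          show "cnj (f \<xi>) * h (\<xi> + (2 * pi) *\<^sub>R k0) * cnj (W k0 \<xi>) = cnj (f \<xi>) * cnj (W k0 \<xi>)"
            using f(2)[of \<xi>] h1[of \<xi>] by (cases "\<xi> \<in> ?B") auto
        qed
        finally show ?thesis .
      qed
      ultimately show "(LINT \<xi>|lebesgue. cnj (f \<xi>) * cnj (W k0 \<xi>)) = 0" by simp
    qed
  qed
qed

section \<open>Energy identities and pointwise identities\<close>

lemma pairing_sum:
  assumes "\<And>i k. i \<in> I \<Longrightarrow> k \<in> K \<Longrightarrow>
      integrable lebesgue (\<lambda>\<xi>. cnj (f \<xi>) * h (\<xi> + (2 * pi) *\<^sub>R k) * cnj (W i k \<xi>))"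
  shows "pairing (\<lambda>k \<xi>. \<Sum>i\<in>I. W i k \<xi>) K f h = (\<Sum>i\<in>I. pairing (W i) K f h)"
proof -
  have "pairing (\<lambda>k \<xi>. \<Sum>i\<in>I. W i k \<xi>) K f h =
      (\<Sum>k\<in>K. \<Sum>i\<in>I. (LINT \<xi>|lebesgue. cnj (f \<xi>) * h (\<xi> + (2 * pi) *\<^sub>R k) * cnj (W i k \<xi>)))"
    unfolding pairing_def using assms
    by (intro sum.cong refl) (simp add: sum_distrib_left Bochner_Integration.integral_sum)
  also have "\<dots> = (\<Sum>i\<in>I. pairing (W i) K f h)"
    unfolding pairing_def by (rule sum.swap)
  finally show ?thesis .
qed

lemma pairing_diff:
  assumes "\<And>k. k \<in> K \<Longrightarrow> integrable lebesgue (\<lambda>\<xi>. cnj (f \<xi>) * h (\<xi> + (2 * pi) *\<^sub>R k) * cnj (W k \<xi>))"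
    "\<And>k. k \<in> K \<Longrightarrow> integrable lebesgue (\<lambda>\<xi>. cnj (f \<xi>) * h (\<xi> + (2 * pi) *\<^sub>R k) * cnj (W' k \<xi>))"
  shows "pairing (\<lambda>k \<xi>. W k \<xi> - W' k \<xi>) K f h = pairing W K f h - pairing W' K f h"
  unfolding pairing_def sum_subtractf[symmetric]
  using assms by (intro sum.cong refl) (simp add: right_diff_distrib)

text \<open>
  By \<open>coeff_sum_eq_pairing\<close> the difference of the two sides of the energy identity is the
  diagonal value of a pairing whose kernel is the difference of the two sides of the pointwise
  identity. The kernel lives on the union \<open>\<Lambda>\<close> of the lattices involved; if it vanishes
  almost everywhere then so does the form, and the converse is \<open>AE_zero_of_pairing_zero\<close>.
\<close>

theorem energy_identity_iff_AE:
  fixes U :: "'i \<Rightarrow> matrix2" and h :: "'i \<Rightarrow> plane \<Rightarrow> complex"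
  assumes I: "finite I" and U: "\<And>i. i \<in> I \<Longrightarrow> invertible (U i)" and h: "\<And>i. i \<in> I \<Longrightarrow> h i \<in> L2_loc"
    and U0: "invertible U0" and h0: "h0 \<in> L2_loc"
  shows "(\<forall>f\<in>test_functions. coeff_sum f U0 h0 = (\<Sum>i\<in>I. coeff_sum f (U i) (h i))) \<longleftrightarrow>
    (\<forall>k. U0 *v k \<in> Z2 \<or> (\<exists>i\<in>I. U i *v k \<in> Z2) \<longrightarrow>
      (AE \<xi> in lebesgue. (\<Sum>i\<in>I. shift_prod (h i) (U i *v k) (U i *v \<xi>)) = shift_prod h0 (U0 *v k) (U0 *v \<xi>)))"
proof -
  define \<Lambda> where "\<Lambda> = {k. U0 *v k \<in> Z2 \<or> (\<exists>i\<in>I. U i *v k \<in> Z2)}"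
  define W where "W i k \<xi> = shift_prod (h i) (U i *v k) (U i *v \<xi>)" for i k \<xi>
  define W0 where "W0 k \<xi> = shift_prod h0 (U0 *v k) (U0 *v \<xi>)" for k \<xi>
  have discrete: "finite (\<Lambda> \<inter> B)" if "bounded B" for B
  proof -
    have "\<Lambda> \<inter> B \<subseteq> {k \<in> B. U0 *v k \<in> Z2} \<union> (\<Union>i\<in>I. {k \<in> B. U i *v k \<in> Z2})"
      by (auto simp: \<Lambda>_def)
    moreover have "finite ({k \<in> B. U0 *v k \<in> Z2} \<union> (\<Union>i\<in>I. {k \<in> B. U i *v k \<in> Z2}))"
      using finite_lattice_bounded[OF U0 that] finite_lattice_bounded[OF U that] I by auto
    ultimately show ?thesis by (rule finite_subset)
  qed
  have intW: "integrable lebesgue (\<lambda>\<xi>. cnj (f \<xi>) * u (\<xi> + (2 * pi) *\<^sub>R k) * cnj (W i k \<xi>))"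
    if "i \<in> I" "f \<in> test_functions" "u \<in> test_functions" for i k f u
    unfolding W_def by (rule integrable_pairing_term[OF U[OF that(1)] h[OF that(1)] that(2,3)])
  have intW0: "integrable lebesgue (\<lambda>\<xi>. cnj (f \<xi>) * u (\<xi> + (2 * pi) *\<^sub>R k) * cnj (W0 k \<xi>))"
    if "f \<in> test_functions" "u \<in> test_functions" for k f u
    unfolding W0_def by (rule integrable_pairing_term[OF U0 h0 that])
  have intS: "integrable lebesgue (\<lambda>\<xi>. cnj (f \<xi>) * u (\<xi> + (2 * pi) *\<^sub>R k) * cnj (\<Sum>i\<in>I. W i k \<xi>))"
    if "f \<in> test_functions" "u \<in> test_functions" for k f u
    using intW[OF _ that] by (simp add: sum_distrib_left)
  have key: "coeff_sum f U0 h0 = (\<Sum>i\<in>I. coeff_sum f (U i) (h i)) \<longleftrightarrow>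
      pairing (\<lambda>k \<xi>. (\<Sum>i\<in>I. W i k \<xi>) - W0 k \<xi>) K f f = 0"
    if f: "f \<in> test_functions" "\<And>x. x \<notin> box (- c) c \<Longrightarrow> f x = 0"
      and K: "finite K"
      and sep: "\<And>k x. k \<in> \<Lambda> \<Longrightarrow> k \<notin> K \<Longrightarrow> x \<in> box (- c) c \<Longrightarrow> x + (2 * pi) *\<^sub>R k \<notin> box (- c) c"
    for f c K
  proof -
    have e0: "coeff_sum f U0 h0 = ennreal ((2 * pi)\<^sup>2 * cmod (pairing W0 K f f))"
      "pairing W0 K f f = complex_of_real (cmod (pairing W0 K f f))"
    proof -
      have "x + (2 * pi) *\<^sub>R k \<notin> box (- c) c" if "U0 *v k \<in> Z2" "k \<notin> K" "x \<in> box (- c) c" for k x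
        using that by (intro sep) (auto simp: \<Lambda>_def)
      from coeff_sum_eq_pairing[OF f U0 h0 K this]
      show "coeff_sum f U0 h0 = ennreal ((2 * pi)\<^sup>2 * cmod (pairing W0 K f f))"
        "pairing W0 K f f = complex_of_real (cmod (pairing W0 K f f))"
        unfolding W0_def[abs_def] by simp_all
    qed
    have ei: "coeff_sum f (U i) (h i) = ennreal ((2 * pi)\<^sup>2 * cmod (pairing (W i) K f f))"
      "pairing (W i) K f f = complex_of_real (cmod (pairing (W i) K f f))" if "i \<in> I" for i
    proof -
      have "x + (2 * pi) *\<^sub>R k \<notin> box (- c) c" if "U i *v k \<in> Z2" "k \<notin> K" "x \<in> box (- c) c" for k x
        using that \<open>i \<in> I\<close> by (intro sep) (auto simp: \<Lambda>_def)
      from coeff_sum_eq_pairing[OF f U[OF that] h[OF that] K this]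
      show "coeff_sum f (U i) (h i) = ennreal ((2 * pi)\<^sup>2 * cmod (pairing (W i) K f f))"
        "pairing (W i) K f f = complex_of_real (cmod (pairing (W i) K f f))"
        unfolding W_def[abs_def] by simp_all
    qed
    have sum: "(\<Sum>i\<in>I. coeff_sum f (U i) (h i)) = ennreal ((2 * pi)\<^sup>2 * (\<Sum>i\<in>I. cmod (pairing (W i) K f f)))"
    proof -
      have "(\<Sum>i\<in>I. coeff_sum f (U i) (h i)) = (\<Sum>i\<in>I. ennreal ((2 * pi)\<^sup>2 * cmod (pairing (W i) K f f)))"
        using ei(1) by (rule sum.cong[OF refl])
      then show ?thesis by (simp add: sum_ennreal sum_distrib_left)
    qed
    have "coeff_sum f U0 h0 = (\<Sum>i\<in>I. coeff_sum f (U i) (h i)) \<longleftrightarrow>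
        (2 * pi)\<^sup>2 * cmod (pairing W0 K f f) = (2 * pi)\<^sup>2 * (\<Sum>i\<in>I. cmod (pairing (W i) K f f))"
      unfolding e0(1) sum by (intro ennreal_inj mult_nonneg_nonneg sum_nonneg) auto
    also have "\<dots> \<longleftrightarrow> complex_of_real (cmod (pairing W0 K f f)) = (\<Sum>i\<in>I. complex_of_real (cmod (pairing (W i) K f f)))"
      unfolding of_real_sum[symmetric] of_real_eq_iff by simp
    also have "\<dots> \<longleftrightarrow> pairing W0 K f f = (\<Sum>i\<in>I. pairing (W i) K f f)"
      unfolding e0(2)[symmetric] using ei(2) by (metis (no_types, lifting) sum.cong)
    also have "(\<Sum>i\<in>I. pairing (W i) K f f) = pairing (\<lambda>k \<xi>. \<Sum>i\<in>I. W i k \<xi>) K f f"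
      using intW f(1) by (intro pairing_sum[symmetric]) auto
    also have "pairing W0 K f f = \<dots> \<longleftrightarrow> pairing (\<lambda>k \<xi>. (\<Sum>i\<in>I. W i k \<xi>) - W0 k \<xi>) K f f = 0"
      using intS[OF f(1) f(1)] intW0[OF f(1) f(1)] by (subst pairing_diff) auto
    finally show ?thesis .
  qed
  have "(\<forall>f\<in>test_functions. coeff_sum f U0 h0 = (\<Sum>i\<in>I. coeff_sum f (U i) (h i))) \<longleftrightarrow>
    (\<forall>k\<in>\<Lambda>. AE \<xi> in lebesgue. (\<Sum>i\<in>I. W i k \<xi>) - W0 k \<xi> = 0)"
  proof
    assume E: "\<forall>f\<in>test_functions. coeff_sum f U0 h0 = (\<Sum>i\<in>I. coeff_sum f (U i) (h i))"
    show "\<forall>k\<in>\<Lambda>. AE \<xi> in lebesgue. (\<Sum>i\<in>I. W i k \<xi>) - W0 k \<xi> = 0"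
    proof
      fix k0 assume k0: "k0 \<in> \<Lambda>"
      show "AE \<xi> in lebesgue. (\<Sum>i\<in>I. W i k0 \<xi>) - W0 k0 \<xi> = 0"
      proof (rule AE_zero_of_pairing_zero[where W = "\<lambda>k \<xi>. (\<Sum>i\<in>I. W i k \<xi>) - W0 k \<xi>", OF _ discrete _ k0])
        fix f u k assume "f \<in> test_functions" "u \<in> test_functions"
        from Bochner_Integration.integrable_diff[OF intS[OF this] intW0[OF this]]
        show "integrable lebesgue (\<lambda>\<xi>. cnj (f \<xi>) * u (\<xi> + (2 * pi) *\<^sub>R k) * cnj ((\<Sum>i\<in>I. W i k \<xi>) - W0 k \<xi>))"
          by (simp add: right_diff_distrib)
      next
        fix f c K
        assume f: "f \<in> test_functions" "\<And>x. x \<notin> box (- c) c \<Longrightarrow> f x = 0" and K: "finite K"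
          and sep: "\<And>k x. k \<in> \<Lambda> \<Longrightarrow> k \<notin> K \<Longrightarrow> x \<in> box (- c) c \<Longrightarrow> x + (2 * pi) *\<^sub>R k \<notin> box (- c) c"
        show "pairing (\<lambda>k \<xi>. (\<Sum>i\<in>I. W i k \<xi>) - W0 k \<xi>) K f f = 0"
          using key[OF f K sep] E f(1) by blast
      qed
    qed
  next
    assume AE: "\<forall>k\<in>\<Lambda>. AE \<xi> in lebesgue. (\<Sum>i\<in>I. W i k \<xi>) - W0 k \<xi> = 0"
    show "\<forall>f\<in>test_functions. coeff_sum f U0 h0 = (\<Sum>i\<in>I. coeff_sum f (U i) (h i))"
    proof
      fix f assume f: "f \<in> test_functions"
      obtain a b where "\<And>x. x \<notin> box a b \<Longrightarrow> f x = 0" using test_function_box_bound[OF f] by blast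
      moreover obtain c where "box a b \<subseteq> box (- c) c"
        using bounded_subset_box_symmetric[OF bounded_box] by blast
      ultimately have supp: "\<And>x. x \<notin> box (- c) c \<Longrightarrow> f x = 0" by blast
      define D where "D = {k. \<exists>x\<in>box (- c) c. x + (2 * pi) *\<^sub>R k \<in> box (- c) c}"
      have D: "bounded D"
        unfolding D_def by (rule bounded_overlapping_shifts) simp
      have fin: "finite (\<Lambda> \<inter> D)" by (rule discrete[OF D])
      have "pairing (\<lambda>k \<xi>. (\<Sum>i\<in>I. W i k \<xi>) - W0 k \<xi>) (\<Lambda> \<inter> D) f f = 0"
        unfolding pairing_def
      proof (rule sum.neutral, intro ballI)
        fix k assume "k \<in> \<Lambda> \<inter> D"
        then have "AE \<xi> in lebesgue. (\<Sum>i\<in>I. W i k \<xi>) - W0 k \<xi> = 0" using AE by blast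
        then have "AE \<xi> in lebesgue. cnj (f \<xi>) * f (\<xi> + (2 * pi) *\<^sub>R k) * cnj ((\<Sum>i\<in>I. W i k \<xi>) - W0 k \<xi>) = 0"
          by eventually_elim simp
        then show "(LINT \<xi>|lebesgue. cnj (f \<xi>) * f (\<xi> + (2 * pi) *\<^sub>R k) * cnj ((\<Sum>i\<in>I. W i k \<xi>) - W0 k \<xi>)) = 0"
          by (rule integral_eq_zero_AE)
      qed
      then show "coeff_sum f U0 h0 = (\<Sum>i\<in>I. coeff_sum f (U i) (h i))"
        using key[OF f supp fin] by (auto simp: D_def)
    qed
  qed
  then show ?thesis by (simp add: \<Lambda>_def W_def W0_def)
qed

section \<open>The scaling limit\<close>

lemma coeff_sum_no_overlap:
  assumes f: "f \<in> test_functions" and supp: "\<And>x. x \<notin> box a b \<Longrightarrow> f x = 0"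
    and U: "invertible (U :: matrix2)" and g: "g \<in> L2_loc"
    and sparse: "\<And>k x. U *v k \<in> Z2 \<Longrightarrow> k \<noteq> 0 \<Longrightarrow> x \<in> box a b \<Longrightarrow> x + (2 * pi) *\<^sub>R k \<notin> box a b"
  shows "coeff_sum f U g = ennreal ((2 * pi)\<^sup>2 * (LINT \<xi>|lebesgue. (cmod (f \<xi>))\<^sup>2 * (cmod (g (U *v \<xi>)))\<^sup>2))"
proof -
  define T where "T = pairing (\<lambda>k \<xi>. shift_prod g (U *v k) (U *v \<xi>)) {0} f f"
  have "coeff_sum f U g = ennreal ((2 * pi)\<^sup>2 * cmod T)"
    unfolding T_def by (rule coeff_sum_eq_pairing(1)[OF f supp U g]) (use sparse in auto)
  moreover have "T = complex_of_real (LINT \<xi>|lebesgue. (cmod (f \<xi>))\<^sup>2 * (cmod (g (U *v \<xi>)))\<^sup>2)"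
  proof -
    have "cnj (f \<xi>) * f \<xi> * cnj (shift_prod g 0 (U *v \<xi>)) =
        complex_of_real ((cmod (f \<xi>))\<^sup>2 * (cmod (g (U *v \<xi>)))\<^sup>2)" for \<xi>
      unfolding of_real_mult complex_norm_square by (simp add: shift_prod_def)
    then show ?thesis
      unfolding T_def pairing_def integral_complex_of_real[symmetric] by simp
  qed
  moreover have "0 \<le> (LINT \<xi>|lebesgue. (cmod (f \<xi>))\<^sup>2 * (cmod (g (U *v \<xi>)))\<^sup>2)"
    by (intro Bochner_Integration.integral_nonneg) simp
  ultimately show ?thesis by simp
qed

lemma integrable_test_function_weight:
  assumes U: "invertible (U :: matrix2)" and g: "g \<in> L2_loc" and f: "f \<in> test_functions"
  shows "integrable lebesgue (\<lambda>\<xi>. (cmod (f \<xi>))\<^sup>2 * (cmod (g (U *v \<xi>)))\<^sup>2)"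
  using L2D(2)[OF test_function_times_L2_loc[OF f L2_loc_linear[OF U g]]]
  by (simp add: norm_mult power_mult_distrib)

lemma integral_combination4:
  fixes p q r s :: "'a \<Rightarrow> complex"
  assumes "integrable M p" "integrable M q" "integrable M r" "integrable M s"
  shows "(LINT x|M. p x - q x + c * r x - c * s x) =
    (LINT x|M. p x) - (LINT x|M. q x) + c * (LINT x|M. r x) - c * (LINT x|M. s x)"
  using assms by simp

text \<open>
  The polarization identity for $|\cdot|^2$ writes an integral against $\overline{h}$ as a
  combination of integrals against squared moduli of test functions; since \<open>\<eta>\<close> is $1$
  wherever \<open>h\<close> does not vanish, $\eta\overline{h} = \overline{h}$.
\<close>

lemma weighted_polarization:
  fixes w :: "plane \<Rightarrow> real"
  defines "A \<equiv> \<lambda>f. (LINT \<xi>|lebesgue. (cmod (f \<xi>))\<^sup>2 * w \<xi>)"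
  assumes w: "\<And>f. f \<in> test_functions \<Longrightarrow> integrable lebesgue (\<lambda>\<xi>. (cmod (f \<xi>))\<^sup>2 * w \<xi>)"
    and h: "h \<in> test_functions" and \<eta>: "\<eta> \<in> test_functions" and \<eta>1: "\<And>x. h x \<noteq> 0 \<Longrightarrow> \<eta> x = 1"
  shows "4 * inner_prod (\<lambda>\<xi>. complex_of_real (w \<xi>)) h =
    complex_of_real (A (\<lambda>x. \<eta> x + 1 * h x)) - complex_of_real (A (\<lambda>x. \<eta> x + (- 1) * h x)) +
    \<i> * complex_of_real (A (\<lambda>x. \<eta> x + \<i> * h x)) - \<i> * complex_of_real (A (\<lambda>x. \<eta> x + (- \<i>) * h x))"
proof -
  have i: "integrable lebesgue (\<lambda>\<xi>. complex_of_real ((cmod (\<eta> \<xi> + c * h \<xi>))\<^sup>2 * w \<xi>))" for c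
    by (intro integrable_of_real w test_functions_add \<eta> test_functions_cmult h)
  have A: "complex_of_real (A (\<lambda>x. \<eta> x + c * h x)) =
      (LINT \<xi>|lebesgue. complex_of_real ((cmod (\<eta> \<xi> + c * h \<xi>))\<^sup>2 * w \<xi>))" for c
    unfolding A_def by (rule integral_complex_of_real[symmetric])
  have pointwise: "4 * (complex_of_real (w \<xi>) * cnj (h \<xi>)) =
      complex_of_real ((cmod (\<eta> \<xi> + 1 * h \<xi>))\<^sup>2 * w \<xi>) - complex_of_real ((cmod (\<eta> \<xi> + (- 1) * h \<xi>))\<^sup>2 * w \<xi>) +
      \<i> * complex_of_real ((cmod (\<eta> \<xi> + \<i> * h \<xi>))\<^sup>2 * w \<xi>) - \<i> * complex_of_real ((cmod (\<eta> \<xi> + (- \<i>) * h \<xi>))\<^sup>2 * w \<xi>)"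
    for \<xi>
  proof -
    have "\<eta> \<xi> * cnj (h \<xi>) = cnj (h \<xi>)" using \<eta>1[of \<xi>] by (cases "h \<xi> = 0") auto
    then have "4 * (complex_of_real (w \<xi>) * cnj (h \<xi>)) = complex_of_real (w \<xi>) * (4 * (\<eta> \<xi> * cnj (h \<xi>)))"
      by simp
    also have "4 * (\<eta> \<xi> * cnj (h \<xi>)) =
      complex_of_real ((cmod (\<eta> \<xi> + 1 * h \<xi>))\<^sup>2) - complex_of_real ((cmod (\<eta> \<xi> + (- 1) * h \<xi>))\<^sup>2) +
      \<i> * complex_of_real ((cmod (\<eta> \<xi> + \<i> * h \<xi>))\<^sup>2) - \<i> * complex_of_real ((cmod (\<eta> \<xi> + (- \<i>) * h \<xi>))\<^sup>2)"
      unfolding complex_norm_square by (simp add: algebra_simps)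
    finally show ?thesis by (simp add: algebra_simps)
  qed
  have "4 * inner_prod (\<lambda>\<xi>. complex_of_real (w \<xi>)) h = (LINT \<xi>|lebesgue. 4 * (complex_of_real (w \<xi>) * cnj (h \<xi>)))"
    unfolding inner_prod_def by simp
  also have "\<dots> = complex_of_real (A (\<lambda>x. \<eta> x + 1 * h x)) - complex_of_real (A (\<lambda>x. \<eta> x + (- 1) * h x)) +
    \<i> * complex_of_real (A (\<lambda>x. \<eta> x + \<i> * h x)) - \<i> * complex_of_real (A (\<lambda>x. \<eta> x + (- \<i>) * h x))"
    unfolding A pointwise by (rule integral_combination4[OF i i i i])
  finally show ?thesis .
qed

lemma test_function_norm_square:
  assumes "f \<in> test_functions"
  shows "(\<lambda>x. complex_of_real ((cmod (f x))\<^sup>2)) \<in> test_functions"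
  unfolding complex_norm_square using assms
  by (intro test_functions_mult Ck_cnj) (auto simp: test_functions_def)

lemma tendsto_ennreal_iff_real:
  assumes "\<And>x. 0 \<le> f x" "0 \<le> l"
  shows "((\<lambda>x. ennreal (f x)) \<longlongrightarrow> ennreal l) F \<longleftrightarrow> (f \<longlongrightarrow> l) F"
  using assms tendsto_ennrealD[of f l F] by (auto intro: tendsto_ennrealI)

text \<open>
  For large \<open>j\<close> no nonzero lattice point is small enough to make the support of \<open>f\<close> meet
  its translate, so the energy at level \<open>j\<close> is $(2\pi)^2$ times the integral of $|f|^2$
  against the weight $|\varphi^j(U_j\cdot)|^2$. Convergence of these integrals for all \<open>f\<close> is
  weak convergence of the weights: $|f|^2$ is itself a test function, and conversely polarization
  reaches every test function.
\<close>

theorem energy_limit_iff: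
  fixes U :: "int \<Rightarrow> matrix2"
  assumes U: "\<And>j. invertible (U j)" and \<phi>: "\<And>j. j \<ge> J0 \<Longrightarrow> \<phi> j \<in> L2_loc"
    and sparse: "\<And>R. eventually (\<lambda>j. \<forall>k. U j *v k \<in> Z2 \<longrightarrow> k \<noteq> 0 \<longrightarrow> R < norm k) at_top"
  shows "(\<forall>f\<in>test_functions. ((\<lambda>j. coeff_sum f (U j) (\<phi> j)) \<longlongrightarrow> ennreal ((2 * pi)\<^sup>2 * norm2_sq f)) at_top) \<longleftrightarrow>
    (\<forall>h\<in>test_functions. ((\<lambda>j. inner_prod (\<lambda>\<xi>. complex_of_real ((cmod (\<phi> j (U j *v \<xi>)))\<^sup>2)) h) \<longlongrightarrow>
      inner_prod (\<lambda>_. 1) h) at_top)"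
proof -
  define A where "A j f = (LINT \<xi>|lebesgue. (cmod (f \<xi>))\<^sup>2 * (cmod (\<phi> j (U j *v \<xi>)))\<^sup>2)" for j f
  have A0: "0 \<le> A j f" for j f
    unfolding A_def by (intro Bochner_Integration.integral_nonneg) simp
  have energy: "((\<lambda>j. coeff_sum f (U j) (\<phi> j)) \<longlongrightarrow> ennreal ((2 * pi)\<^sup>2 * norm2_sq f)) at_top \<longleftrightarrow>
      ((\<lambda>j. A j f) \<longlongrightarrow> norm2_sq f) at_top" if f: "f \<in> test_functions" for f
  proof -
    obtain a b where supp: "\<And>x. x \<notin> box a b \<Longrightarrow> f x = 0" using test_function_box_bound[OF f] by blast
    obtain R where R: "\<And>k. k \<in> {k. \<exists>x\<in>box a b. x + (2 * pi) *\<^sub>R k \<in> box a b} \<Longrightarrow> norm k \<le> R"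
      using bounded_overlapping_shifts[OF bounded_box[of a b]] unfolding bounded_iff by blast
    have "eventually (\<lambda>j. coeff_sum f (U j) (\<phi> j) = ennreal ((2 * pi)\<^sup>2 * A j f)) at_top"
      using sparse[of R] eventually_ge_at_top[of J0]
    proof eventually_elim
      case (elim j)
      show ?case
        unfolding A_def
      proof (rule coeff_sum_no_overlap[OF f supp U \<phi>[OF elim(2)]])
        fix k x assume k: "U j *v k \<in> Z2" "k \<noteq> 0" "x \<in> box a b"
        then have "\<not> norm k \<le> R" using elim(1) by (simp add: not_le)
        then show "x + (2 * pi) *\<^sub>R k \<notin> box a b" using R[of k] k(3) by blast
      qed
    qed
    then have "((\<lambda>j. coeff_sum f (U j) (\<phi> j)) \<longlongrightarrow> ennreal ((2 * pi)\<^sup>2 * norm2_sq f)) at_top \<longleftrightarrow>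
        ((\<lambda>j. ennreal ((2 * pi)\<^sup>2 * A j f)) \<longlongrightarrow> ennreal ((2 * pi)\<^sup>2 * norm2_sq f)) at_top"
      by (rule tendsto_cong)
    also have "\<dots> \<longleftrightarrow> ((\<lambda>j. (2 * pi)\<^sup>2 * A j f) \<longlongrightarrow> (2 * pi)\<^sup>2 * norm2_sq f) at_top"
      using A0 norm2_sq_nonneg by (intro tendsto_ennreal_iff_real) auto
    also have "\<dots> \<longleftrightarrow> ((\<lambda>j. A j f) \<longlongrightarrow> norm2_sq f) at_top"
      using tendsto_mult_left_iff[of "(2 * pi)\<^sup>2" "\<lambda>j. A j f" "norm2_sq f" at_top] by simp
    finally show ?thesis .
  qed
  have square: "inner_prod (\<lambda>\<xi>. complex_of_real (w \<xi>)) (\<lambda>x. complex_of_real ((cmod (f x))\<^sup>2)) =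
      complex_of_real (LINT \<xi>|lebesgue. (cmod (f \<xi>))\<^sup>2 * w \<xi>)" for w f
    unfolding inner_prod_def integral_complex_of_real[symmetric] by (simp add: mult.commute)
  have "(\<forall>f\<in>test_functions. ((\<lambda>j. A j f) \<longlongrightarrow> norm2_sq f) at_top) \<longleftrightarrow>
    (\<forall>h\<in>test_functions. ((\<lambda>j. inner_prod (\<lambda>\<xi>. complex_of_real ((cmod (\<phi> j (U j *v \<xi>)))\<^sup>2)) h) \<longlongrightarrow>
      inner_prod (\<lambda>_. 1) h) at_top)"
  proof (intro iffI ballI)
    fix f assume lim: "\<forall>h\<in>test_functions. ((\<lambda>j. inner_prod (\<lambda>\<xi>. complex_of_real ((cmod (\<phi> j (U j *v \<xi>)))\<^sup>2)) h) \<longlongrightarrow>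
      inner_prod (\<lambda>_. 1) h) at_top" and f: "f \<in> test_functions"
    have "((\<lambda>j. complex_of_real (A j f)) \<longlongrightarrow> complex_of_real (norm2_sq f)) at_top"
    proof -
      have "inner_prod (\<lambda>_. 1) (\<lambda>x. complex_of_real ((cmod (f x))\<^sup>2)) = complex_of_real (norm2_sq f)"
        using square[of "\<lambda>_. 1" f] by (simp only: of_real_1 mult_1_right norm2_sq_def)
      then show ?thesis
        using bspec[OF lim test_function_norm_square[OF f]] unfolding square A_def by (simp only:)
    qed
    then show "((\<lambda>j. A j f) \<longlongrightarrow> norm2_sq f) at_top" by (simp only: tendsto_of_real_iff)
  next
    fix h assume lim: "\<forall>f\<in>test_functions. ((\<lambda>j. A j f) \<longlongrightarrow> norm2_sq f) at_top" and h: "h \<in> test_functions"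
    obtain a b where supp: "\<And>x. x \<notin> box a b \<Longrightarrow> h x = 0" using test_function_box_bound[OF h] by blast
    define \<eta> where "\<eta> x = complex_of_real (box_bump 1 (a - 1) (b + 1) x)" for x
    have \<eta>: "\<eta> \<in> test_functions" unfolding \<eta>_def by (intro box_bump_test_function) simp
    have \<eta>1: "\<eta> x = 1" if "h x \<noteq> 0" for x
    proof -
      have "x \<in> box a b" using that supp by blast
      then show ?thesis
        unfolding \<eta>_def by (subst box_bump_eq_1) (auto simp: mem_box_cart less_imp_le)
    qed
    define P where "P a = complex_of_real (a (\<lambda>x. \<eta> x + 1 * h x)) - complex_of_real (a (\<lambda>x. \<eta> x + (- 1) * h x)) +
      \<i> * complex_of_real (a (\<lambda>x. \<eta> x + \<i> * h x)) - \<i> * complex_of_real (a (\<lambda>x. \<eta> x + (- \<i>) * h x))"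
      for a :: "(plane \<Rightarrow> complex) \<Rightarrow> real"
    have l: "((\<lambda>j. A j (\<lambda>x. \<eta> x + c * h x)) \<longlongrightarrow> norm2_sq (\<lambda>x. \<eta> x + c * h x)) at_top" for c
      using lim test_functions_add[OF \<eta> test_functions_cmult[OF h]] by blast
    have "((\<lambda>j. P (A j) / 4) \<longlongrightarrow> P norm2_sq / 4) at_top"
      unfolding P_def by (intro tendsto_intros l) simp
    also have "P norm2_sq / 4 = inner_prod (\<lambda>_. 1) h"
      using weighted_polarization[where w = "\<lambda>_. 1", OF _ h \<eta> \<eta>1] L2D(2)[OF test_function_L2]
      by (simp add: P_def norm2_sq_def mult.commute[of _ 4])
    finally have "((\<lambda>j. P (A j) / 4) \<longlongrightarrow> inner_prod (\<lambda>_. 1) h) at_top" .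
    moreover have "eventually (\<lambda>j. P (A j) / 4 =
        inner_prod (\<lambda>\<xi>. complex_of_real ((cmod (\<phi> j (U j *v \<xi>)))\<^sup>2)) h) at_top"
      using eventually_ge_at_top[of J0]
    proof eventually_elim
      case (elim j)
      have "4 * inner_prod (\<lambda>\<xi>. complex_of_real ((cmod (\<phi> j (U j *v \<xi>)))\<^sup>2)) h = P (A j)"
        unfolding P_def A_def
        by (rule weighted_polarization[OF integrable_test_function_weight[OF U \<phi>[OF elim]] h \<eta> \<eta>1])
      then show ?case by (simp add: mult.commute[of _ 4])
    qed
    ultimately show "((\<lambda>j. inner_prod (\<lambda>\<xi>. complex_of_real ((cmod (\<phi> j (U j *v \<xi>)))\<^sup>2)) h) \<longlongrightarrow>
      inner_prod (\<lambda>_. 1) h) at_top"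
      by (rule Lim_transform_eventually)
  qed
  then show ?thesis using energy by auto
qed

section \<open>The dilation matrices\<close>

definition diag2 :: "real \<Rightarrow> real \<Rightarrow> matrix2"
  where "diag2 a b = vector [vector [a, 0], vector [0, b]]"

lemma diag2_mult: "diag2 a b ** diag2 c d = diag2 (a * c) (b * d)"
  by (simp add: diag2_def matrix_matrix_mult_def vec_eq_iff forall_2 sum_2)

lemma diag2_mult_vec: "(diag2 a b *v x) $ 1 = a * x $ 1" "(diag2 a b *v x) $ 2 = b * x $ 2"
  by (simp_all add: diag2_def matrix_vector_mult_def sum_2)

lemma diag2_1: "diag2 1 1 = mat 1"
  by (simp add: diag2_def vec_eq_iff forall_2 mat_def)

lemma matrix_inv_diag2:
  assumes "a \<noteq> 0" "b \<noteq> 0"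
  shows "matrix_inv (diag2 a b) = diag2 (inverse a) (inverse b)"
proof -
  have "invertible (diag2 a b)"
    unfolding invertible_def using assms
    by (intro exI[of _ "diag2 (inverse a) (inverse b)"]) (simp add: diag2_mult diag2_1)
  then have "matrix_inv (diag2 a b) ** diag2 a b = mat 1" by (rule matrix_inv_mult)
  then have "(matrix_inv (diag2 a b) ** diag2 a b) ** diag2 (inverse a) (inverse b) = diag2 (inverse a) (inverse b)"
    by simp
  then show ?thesis
    using assms by (simp add: matrix_mul_assoc[symmetric] diag2_mult diag2_1)
qed

lemma mat_powi_diag2:
  assumes "a \<noteq> 0" "b \<noteq> 0"
  shows "mat_powi (diag2 a b) j = diag2 (a powi j) (b powi j)"
proof -
  have pow: "((\<lambda>X. diag2 c d ** X) ^^ n) (mat 1) = diag2 (c ^ n) (d ^ n)" for c d n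
    by (induction n) (simp_all add: diag2_mult diag2_1)
  show ?thesis
    by (simp add: mat_powi_def pow matrix_inv_diag2[OF assms] power_int_def)
qed

lemma dilation_powers:
  assumes "lam \<noteq> 0"
  shows "mat_powi (N_mat lam) j = diag2 (lam powi (- 2 * j)) (lam powi (- 2 * j))"
    and "mat_powi (M_mat lam) j = diag2 (lam powi (2 * j)) (lam powi (2 * j))"
    and "mat_powi (A_mat lam) j = diag2 (lam powi (2 * j)) (lam powi j)"
    and "mat_powi (B_mat lam) j = diag2 (lam powi (- 2 * j)) (lam powi (- j))"
proof -
  have "N_mat lam = diag2 (lam powi (-2)) (lam powi (-2))" "M_mat lam = diag2 (lam powi 2) (lam powi 2)"
    "A_mat lam = diag2 (lam powi 2) lam" "B_mat lam = diag2 (lam powi (-2)) (lam powi (-1))"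
    by (simp_all add: N_mat_def M_mat_def A_mat_def B_mat_def diag2_def vec_eq_iff forall_2 mat_def)
  note eqs = this
  have pow: "mat_powi (diag2 (lam powi m) (lam powi n)) j = diag2 (lam powi (m * j)) (lam powi (n * j))" for m n
    using assms by (subst mat_powi_diag2) (simp_all add: power_int_mult)
  show "mat_powi (N_mat lam) j = diag2 (lam powi (- 2 * j)) (lam powi (- 2 * j))"
    and "mat_powi (M_mat lam) j = diag2 (lam powi (2 * j)) (lam powi (2 * j))"
    and "mat_powi (A_mat lam) j = diag2 (lam powi (2 * j)) (lam powi j)"
    and "mat_powi (B_mat lam) j = diag2 (lam powi (- 2 * j)) (lam powi (- j))"
    unfolding eqs pow using pow[of 2 1] by simp_all
qed

lemma E_mat_involution: "E_mat ** E_mat = mat 1"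
  by (simp add: E_mat_def matrix_matrix_mult_def vec_eq_iff forall_2 sum_2 mat_def)

lemma dilation_inverses:
  assumes lam: "lam \<noteq> 0"
  shows "mat_powi (N_mat lam) j ** mat_powi (M_mat lam) j = mat 1"
    and "mat_powi (M_mat lam) j ** mat_powi (N_mat lam) j = mat 1"
    and "mat_powi (B_mat lam) j ** mat_powi (A_mat lam) j = mat 1"
    and "mat_powi (A_mat lam) j ** mat_powi (B_mat lam) j = mat 1"
    and "(mat_powi (B_mat lam) j ** E_mat) ** (E_mat ** mat_powi (A_mat lam) j) = mat 1"
    and "(E_mat ** mat_powi (A_mat lam) j) ** (mat_powi (B_mat lam) j ** E_mat) = mat 1"
proof -
  have c: "lam powi (- 2 * j) * lam powi (2 * j) = 1" "lam powi (2 * j) * lam powi (- 2 * j) = 1"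
    "lam powi (- j) * lam powi j = 1" "lam powi j * lam powi (- j) = 1"
    using lam by (simp_all flip: power_int_add)
  show "mat_powi (N_mat lam) j ** mat_powi (M_mat lam) j = mat 1"
    "mat_powi (M_mat lam) j ** mat_powi (N_mat lam) j = mat 1"
    and BA: "mat_powi (B_mat lam) j ** mat_powi (A_mat lam) j = mat 1"
    and AB: "mat_powi (A_mat lam) j ** mat_powi (B_mat lam) j = mat 1"
    unfolding dilation_powers[OF lam] diag2_mult c diag2_1 by simp_all
  have "(mat_powi (B_mat lam) j ** E_mat) ** (E_mat ** mat_powi (A_mat lam) j) =
      mat_powi (B_mat lam) j ** (E_mat ** E_mat) ** mat_powi (A_mat lam) j"
    by (simp add: matrix_mul_assoc)
  then show "(mat_powi (B_mat lam) j ** E_mat) ** (E_mat ** mat_powi (A_mat lam) j) = mat 1"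
    by (simp add: E_mat_involution BA)
  have "(E_mat ** mat_powi (A_mat lam) j) ** (mat_powi (B_mat lam) j ** E_mat) =
      E_mat ** (mat_powi (A_mat lam) j ** mat_powi (B_mat lam) j) ** E_mat"
    by (simp add: matrix_mul_assoc)
  then show "(E_mat ** mat_powi (A_mat lam) j) ** (mat_powi (B_mat lam) j ** E_mat) = mat 1"
    by (simp add: E_mat_involution AB)
qed

lemma dilation_invertible:
  assumes "lam \<noteq> 0"
  shows "invertible (mat_powi (N_mat lam) j)" "invertible (mat_powi (B_mat lam) j)"
    "invertible (mat_powi (B_mat lam) j ** E_mat)"
  unfolding invertible_def using dilation_inverses[OF assms] by blast+

lemma mem_image_Z2_iff:
  assumes "P ** Q = mat 1" "Q ** P = (mat 1 :: matrix2)"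
  shows "k \<in> (*v) P ` Z2 \<longleftrightarrow> Q *v k \<in> Z2"
proof
  assume "Q *v k \<in> Z2"
  then have "P *v (Q *v k) \<in> (*v) P ` Z2" by (rule imageI)
  then show "k \<in> (*v) P ` Z2" using assms by (simp add: matrix_vector_mul_assoc)
qed (use assms in \<open>auto simp: matrix_vector_mul_assoc\<close>)

text \<open>
  The nonzero points of the lattice at level \<open>j\<close> have norm at least $\lambda^{2j}$.
\<close>

lemma isotropic_lattice_sparse:
  assumes lam: "lam > 1"
  shows "eventually (\<lambda>j. \<forall>k. mat_powi (N_mat lam) j *v k \<in> Z2 \<longrightarrow> k \<noteq> 0 \<longrightarrow> R < norm k) at_top"
proof -
  obtain n where n: "R < lam ^ n" using real_arch_pow[OF lam] by blast
  show ?thesis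
    using eventually_ge_at_top[of "int n"]
  proof eventually_elim
    case (elim j)
    show ?case
    proof (intro allI impI)
      fix k assume k: "mat_powi (N_mat lam) j *v k \<in> Z2" "k \<noteq> 0"
      define c where "c = lam powi (2 * j)"
      have cn: "lam ^ n \<le> c"
      proof -
        have "lam ^ n \<le> lam ^ nat (2 * j)" using lam elim by (intro power_increasing) auto
        also have "\<dots> = c" unfolding c_def using elim by (simp add: power_int_def)
        finally show ?thesis .
      qed
      have c: "0 < c" using lam by (simp add: c_def)
      obtain i where i: "k $ i \<noteq> 0" using k(2) by (auto simp: vec_eq_iff)
      have "(mat_powi (N_mat lam) j *v k) $ i = k $ i / c"
        using exhaust_2[of i] lam
        by (auto simp: dilation_powers diag2_mult_vec c_def power_int_minus field_simps)
      then have "k $ i / c \<in> \<int>" using k(1) by (auto simp: Z2_def dest: spec[of _ i])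
      then have "1 \<le> \<bar>k $ i / c\<bar>" using i c by (intro Ints_nonzero_abs_ge1) auto
      then have "c \<le> \<bar>k $ i\<bar>" using c by (simp add: field_simps)
      then show "R < norm k" using n cn component_le_norm_cart[of k i] by linarith
    qed
  qed
qed

section \<open>Shears\<close>

lemma S_mat_mult_vec: "(S_mat \<tau> *v x) $ 1 = x $ 1" "(S_mat \<tau> *v x) $ 2 = \<tau> * x $ 1 + x $ 2"
  by (simp_all add: S_mat_def matrix_vector_mult_def sum_2)

lemma det_S_mat: "det (S_mat \<tau>) = 1"
  by (simp add: S_mat_def det_2)

lemma S_mat_invertible: "invertible (S_mat \<tau>)"
  by (simp add: invertible_det_nz det_S_mat)

text \<open>
  A shear with integer parameter has determinant $1$, and its transpose permutes the lattice of
  frequencies; so shearing the dilation matrix or the generator yields the same coefficients in a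
  different order.
\<close>

lemma coeff_sum_shear:
  "coeff_sum f (S_mat (of_int l) ** U) g = coeff_sum f U (\<lambda>x. g (S_mat (of_int l) *v x))"
proof -
  define \<sigma> where "\<sigma> l k = (vector [k $ 1 + of_int l * k $ 2, k $ 2] :: plane)" for l :: int and k :: plane
  have bij: "bij_betw (\<sigma> l) Z2 Z2"
    by (rule bij_betw_byWitness[where f' = "\<sigma> (- l)"])
      (auto simp: \<sigma>_def Z2_def forall_2 vec_eq_iff)
  have "dilmod (S_mat (of_int l) ** U) k g = dilmod U (\<sigma> l k) (\<lambda>x. g (S_mat (of_int l) *v x))" for k
  proof
    fix \<xi>
    have "k \<bullet> (S_mat (of_int l) *v (U *v \<xi>)) = \<sigma> l k \<bullet> (U *v \<xi>)"
      by (simp add: \<sigma>_def inner_vec_def sum_2 S_mat_mult_vec algebra_simps)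
    then show "dilmod (S_mat (of_int l) ** U) k g \<xi> = dilmod U (\<sigma> l k) (\<lambda>x. g (S_mat (of_int l) *v x)) \<xi>"
      by (simp add: dilmod_def det_mul det_S_mat matrix_vector_mul_assoc)
  qed
  then have "coeff_sum f (S_mat (of_int l) ** U) g =
      (\<Sum>\<^sub>\<infinity>k\<in>Z2. ennreal ((cmod (inner_prod f (dilmod U (\<sigma> l k) (\<lambda>x. g (S_mat (of_int l) *v x)))))\<^sup>2))"
    by (simp add: coeff_sum_def)
  also have "\<dots> = coeff_sum f U (\<lambda>x. g (S_mat (of_int l) *v x))"
    unfolding coeff_sum_def by (rule infsum_reindex_bij_betw[OF bij])
  finally show ?thesis .
qed

lemma infsum_pair_coeff_sum:
  "(\<Sum>\<^sub>\<infinity>k\<in>Z2. ennreal ((cmod (inner_prod f (dilmod U k g)))\<^sup>2 + (cmod (inner_prod f (dilmod V k h)))\<^sup>2)) =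
    coeff_sum f U g + coeff_sum f V h"
  unfolding coeff_sum_def
  by (subst infsum_add[symmetric]) (auto intro: nonneg_summable_on_complete)

section \<open>Bessel bounds and square integrability\<close>

lemma dilmod_character: "dilmod U k g \<xi> = complex_of_real (sqrt \<bar>det U\<bar>) * g (U *v \<xi>) * character k (U *v \<xi>)"
  by (simp add: dilmod_def character_def)

lemma dilmod_L2:
  assumes U: "invertible (U :: matrix2)" and g: "g \<in> L2"
  shows "dilmod U k g \<in> L2"
proof -
  have "(\<lambda>x. g x * character k x) \<in> L2"
    using L2D[OF g] by (simp add: L2_def norm_mult)
  from L2_cmult[OF L2_linear[OF U this]] show ?thesis
    by (simp add: dilmod_character[abs_def] mult.assoc)
qed

lemma L2_of_dilmod:
  assumes U: "invertible (U :: matrix2)" and g: "dilmod U 0 g \<in> L2"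
  shows "g \<in> L2"
proof -
  have d: "sqrt \<bar>det U\<bar> \<noteq> 0" using U by (simp add: invertible_det_nz)
  have "(\<lambda>x. complex_of_real (1 / sqrt \<bar>det U\<bar>) * dilmod U 0 g (matrix_inv U *v x)) \<in> L2"
    by (intro L2_cmult L2_linear invertible_matrix_inv U g)
  then show ?thesis
    using d by (simp add: dilmod_character matrix_inv_mult_vec[OF U])
qed

lemma L2_loc_cmult:
  assumes g: "g \<in> L2_loc"
  shows "(\<lambda>x. c * g x) \<in> L2_loc"
  unfolding L2_loc_def
proof (intro CollectI conjI allI impI)
  note [measurable] = L2_locD(1)[OF g]
  show "(\<lambda>x. c * g x) \<in> borel_measurable lebesgue" by measurable
  fix K :: "plane set" assume "compact K"
  then have "set_integrable lebesgue K (\<lambda>x. (cmod c)\<^sup>2 * (cmod (g x))\<^sup>2)"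
    using L2_locD(2)[OF g] by (intro set_integrable_mult_right) auto
  then show "set_integrable lebesgue K (\<lambda>x. (cmod (c * g x))\<^sup>2)"
    by (simp add: norm_mult power_mult_distrib)
qed

text \<open>
  The bound extends from test functions to a truncation \<open>u\<close> of \<open>G\<close>. There it reads
  $\|u\|^4 \le C\|u\|^2$, hence $\|u\|^2 \le C$, and monotone convergence gives the same
  bound for \<open>G\<close>.
\<close>

lemma Bessel_bound_L2:
  assumes G: "G \<in> L2_loc" and C: "0 \<le> C"
    and bound: "\<And>f. f \<in> test_functions \<Longrightarrow> (cmod (inner_prod f G))\<^sup>2 \<le> C * norm2_sq f"
  shows "G \<in> L2"
proof -
  note [measurable] = L2_locD(1)[OF G]
  define u where "u = truncation G"
  have um: "u n \<in> borel_measurable lebesgue" and ub: "cmod (u n x) \<le> real n" for n x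
    by (simp_all add: u_def truncation_measurable cmod_truncation_le)
  have u0: "u n x = 0" if "x \<notin> sym_box n" for n x using that by (simp add: u_def truncation_def)
  have uL2: "u n \<in> L2" for n
    using bounded_box_L2[OF um ub u0[unfolded sym_box_def]] .
  have le: "norm2_sq (u n) \<le> C" for n
  proof -
    obtain F D where F: "\<And>m. F m \<in> test_functions" "\<And>m x. x \<notin> sym_box n \<Longrightarrow> F m x = 0" "dominated_limit F (u n) D"
      using bounded_box_dominated_limit[OF um ub u0[unfolded sym_box_def]] unfolding sym_box_def by metis
    define H where "H x = (if x \<in> sym_box n then G x else 0)" for x
    have "H \<in> L2"
    proof -
      have m: "H \<in> borel_measurable lebesgue" unfolding H_def sym_box_def by measurable
      have "integrable lebesgue (\<lambda>x. indicat_real (cbox (- (real n *\<^sub>R 1)) (real n *\<^sub>R 1)) x *\<^sub>R (cmod (G x))\<^sup>2)"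
        using L2_locD(2)[OF G compact_cbox] by (simp add: set_integrable_def)
      then have "integrable lebesgue (\<lambda>x. (cmod (H x))\<^sup>2)"
        by (rule Bochner_Integration.integrable_bound)
          (use m in \<open>auto simp: H_def sym_box_def subsetD[OF box_subset_cbox] intro!: AE_I2\<close>)
      then show ?thesis using m by (simp add: L2_def)
    qed
    from dominated_limit_inner_prod[OF F(3) this]
    have lim: "(\<lambda>m. (cmod (inner_prod (F m) H))\<^sup>2) \<longlonglongrightarrow> (cmod (inner_prod (u n) H))\<^sup>2"
      by (intro tendsto_intros)
    have "inner_prod (F m) H = inner_prod (F m) G" for m
      unfolding inner_prod_def using F(2)[of _ m]
      by (intro Bochner_Integration.integral_cong) (auto simp: H_def)
    then have "(cmod (inner_prod (F m) H))\<^sup>2 \<le> C * norm2_sq (F m)" for m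
      using bound[OF F(1)] by simp
    then have "(cmod (inner_prod (u n) H))\<^sup>2 \<le> C * norm2_sq (u n)"
      by (intro LIMSEQ_le[OF lim tendsto_mult[OF tendsto_const dominated_limit_norm2_sq[OF F(3)]]]) auto
    moreover have "inner_prod (u n) H = complex_of_real (norm2_sq (u n))"
      unfolding inner_prod_def norm2_sq_def integral_complex_of_real[symmetric] complex_norm_square
      by (rule Bochner_Integration.integral_cong) (auto simp: u_def truncation_def H_def)
    ultimately have "norm2_sq (u n) * norm2_sq (u n) \<le> C * norm2_sq (u n)"
      by (simp add: power2_eq_square)
    then show ?thesis
      using C norm2_sq_nonneg[of "u n"] by (cases "norm2_sq (u n) = 0") auto
  qed
  have mono: "(cmod (u n x))\<^sup>2 \<le> (cmod (u m x))\<^sup>2" if "n \<le> m" for n m x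
    unfolding u_def by (intro power_mono cmod_truncation_mono that) simp
  have lim: "(\<lambda>n. (cmod (u n x))\<^sup>2) \<longlonglongrightarrow> (cmod (G x))\<^sup>2" for x
    unfolding u_def by (intro tendsto_intros truncation_tendsto)
  have inc: "incseq (\<lambda>n. norm2_sq (u n))"
  proof (rule incseq_SucI)
    fix n
    show "norm2_sq (u n) \<le> norm2_sq (u (Suc n))"
      unfolding norm2_sq_def using mono[of n "Suc n"] L2D(2)[OF uL2[of n]] L2D(2)[OF uL2[of "Suc n"]]
      by (intro integral_mono) auto
  qed
  obtain c where c: "(\<lambda>n. norm2_sq (u n)) \<longlonglongrightarrow> c"
    using incseq_convergent[OF inc, of C] le by blast
  have "integrable lebesgue (\<lambda>x. (cmod (G x))\<^sup>2)"
  proof (rule integrable_monotone_convergence)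
    show "integrable lebesgue (\<lambda>x. (cmod (u n x))\<^sup>2)" for n using L2D(2)[OF uL2] .
    show "AE x in lebesgue. mono (\<lambda>n. (cmod (u n x))\<^sup>2)"
      using mono by (auto intro!: AE_I2 monoI)
    show "(\<lambda>n. LINT x|lebesgue. (cmod (u n x))\<^sup>2) \<longlonglongrightarrow> c"
      using c by (simp add: norm2_sq_def)
  qed (use lim in \<open>auto intro!: AE_I2\<close>)
  then show ?thesis by (simp add: L2_def)
qed

text \<open>
  The coefficient at $k = 0$ alone provides the bound required by \<open>Bessel_bound_L2\<close>.
\<close>

lemma L2_of_energy_bound:
  assumes U: "invertible (U :: matrix2)" and g: "g \<in> L2_loc" and C: "0 \<le> C"
    and bound: "\<And>f. f \<in> test_functions \<Longrightarrow> coeff_sum f U g \<le> ennreal (C * norm2_sq f)"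
  shows "g \<in> L2"
proof (rule L2_of_dilmod[OF U Bessel_bound_L2[OF _ C]])
  show "dilmod U 0 g \<in> L2_loc"
    using L2_loc_cmult[OF L2_loc_linear[OF U g]] by (simp add: dilmod_character[abs_def])
  fix f assume f: "f \<in> test_functions"
  have "ennreal ((cmod (inner_prod f (dilmod U 0 g)))\<^sup>2) \<le> coeff_sum f U g"
    unfolding coeff_sum_def
    using sum_le_infsum_ennreal[of "{0}" Z2 "\<lambda>k. ennreal ((cmod (inner_prod f (dilmod U k g)))\<^sup>2)"] by simp
  also have "\<dots> \<le> ennreal (C * norm2_sq f)" by (rule bound[OF f])
  finally show "(cmod (inner_prod f (dilmod U 0 g)))\<^sup>2 \<le> C * norm2_sq f"
    using C norm2_sq_nonneg[of f] by (simp add: ennreal_le_iff)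
qed

section \<open>Telescoping\<close>

lemma telescoping_limit:
  fixes A D :: "int \<Rightarrow> ennreal"
  assumes step: "\<And>j. j \<ge> J \<Longrightarrow> A (j + 1) = A j + D j"
  shows "(A \<longlongrightarrow> A J + infsum D {J..}) at_top"
proof -
  have eq: "A j = A J + sum D {J..<j}" if "j \<ge> J" for j
    using that
  proof (induction j rule: int_ge_induct)
    case (step i)
    have "{J..<i + 1} = insert i {J..<i}" using step.hyps by auto
    then show ?case using step assms[OF step.hyps] by (simp add: add_ac)
  qed simp
  have "(D has_sum infsum D {J..}) {J..}"
    by (intro has_sum_infsum nonneg_summable_on_complete) simp
  moreover have "filterlim (\<lambda>j. {J..<j}) (finite_subsets_at_top {J..}) at_top"
    unfolding filterlim_finite_subsets_at_top
  proof (intro allI impI)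
    fix X :: "int set" assume X: "finite X \<and> X \<subseteq> {J..}"
    then obtain m where m: "\<And>x. x \<in> X \<Longrightarrow> x \<le> m"
      using bdd_above_finite[of X] unfolding bdd_above_def by blast
    show "eventually (\<lambda>j. finite {J..<j} \<and> X \<subseteq> {J..<j} \<and> {J..<j} \<subseteq> {J..}) at_top"
      using eventually_gt_at_top[of m]
    proof eventually_elim
      case (elim j)
      have "X \<subseteq> {J..<j}"
      proof
        fix x assume "x \<in> X"
        then show "x \<in> {J..<j}" using X m[of x] elim by auto
      qed
      then show ?case by auto
    qed
  qed
  ultimately have "((\<lambda>j. sum D {J..<j}) \<longlongrightarrow> infsum D {J..}) at_top"
    unfolding has_sum_def by (rule filterlim_compose)
  then have "((\<lambda>j. A J + sum D {J..<j}) \<longlongrightarrow> A J + infsum D {J..}) at_top"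
    by (intro tendsto_add tendsto_const)
  moreover have "eventually (\<lambda>j. A J + sum D {J..<j} = A j) at_top"
    using eventually_ge_at_top[of J] by eventually_elim (rule eq[symmetric])
  ultimately show ?thesis by (rule Lim_transform_eventually)
qed

lemma infsum_atLeast_int:
  fixes D :: "int \<Rightarrow> ennreal"
  shows "infsum D {J..} = D J + infsum D {J + 1..}"
proof -
  have "{J..} = {J} \<union> {J + 1..}" by auto
  then have "infsum D {J..} = infsum D {J} + infsum D {J + 1..}"
    by (simp only:, intro infsum_Un_disjoint nonneg_summable_on_complete) auto
  then show ?thesis by simp
qed

section \<open>The tight frame identity\<close>

text \<open>
  Arranging all coefficients of the affine system in one family makes the right-hand side a single
  sum of squares, to which \<open>square_sum_identity_extends\<close> applies with a multiple of the squared
  norm as quadratic expression.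
\<close>

lemma tight_frame_identity_extends:
  fixes \<phi> :: "plane \<Rightarrow> complex" and g :: "int \<Rightarrow> int \<Rightarrow> plane \<Rightarrow> complex" and L :: "int \<Rightarrow> int set"
  assumes N: "invertible (N :: matrix2)" and B: "\<And>j. invertible (B j :: matrix2)"
    and B': "\<And>j. invertible (B' j :: matrix2)"
    and \<phi>: "\<phi> \<in> L2" and g: "\<And>j l. j \<ge> J \<Longrightarrow> l \<in> L j \<Longrightarrow> g j l \<in> L2" and L: "\<And>j. finite (L j)"
    and c: "0 \<le> c"
  defines "E \<equiv> \<lambda>f. coeff_sum f N \<phi> +
      (\<Sum>\<^sub>\<infinity>j\<in>{J..}. \<Sum>l\<in>L j. coeff_sum f (B j) (g j l) + coeff_sum f (B' j) (g j l))"
  assumes base: "\<And>f. f \<in> test_functions \<Longrightarrow> E f = ennreal (c * norm2_sq f)"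
    and f: "f \<in> L2"
  shows "E f = ennreal (c * norm2_sq f)"
proof -
  define I :: "(plane + (int \<times> int \<times> bool \<times> plane)) set"
    where "I = Inl ` Z2 \<union> Inr ` (SIGMA j:{J..}. SIGMA l:L j. (UNIV :: bool set) \<times> Z2)"
  define h where "h i = (case i of Inl k \<Rightarrow> dilmod N k \<phi>
      | Inr (j, l, b, k) \<Rightarrow> dilmod (if b then B j else B' j) k (g j l))" for i
  define q where "q f = complex_of_real (c * norm2_sq f)" for f
  have hL2: "h i \<in> L2" if "i \<in> I" for i
    using that unfolding I_def h_def by (auto intro!: dilmod_L2 N B B' \<phi> g)
  have flat: "(\<Sum>\<^sub>\<infinity>i\<in>I. ennreal ((cmod (inner_prod u (h i)))\<^sup>2)) = E u" for u
  proof -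
    define e where "e i = ennreal ((cmod (inner_prod u (h i)))\<^sup>2)" for i
    have sm: "X summable_on Y" for X :: "_ \<Rightarrow> ennreal" and Y
      by (intro nonneg_summable_on_complete) simp
    have "infsum e I = infsum e (Inl ` Z2) +
        infsum e (Inr ` (SIGMA j:{J..}. SIGMA l:L j. (UNIV :: bool set) \<times> Z2))"
      unfolding I_def by (intro infsum_Un_disjoint sm) auto
    also have "infsum e (Inl ` Z2) = coeff_sum u N \<phi>"
      by (subst infsum_reindex) (auto simp: coeff_sum_def e_def h_def o_def)
    also have "infsum e (Inr ` (SIGMA j:{J..}. SIGMA l:L j. (UNIV :: bool set) \<times> Z2)) =
        infsum (\<lambda>x. e (Inr x)) (SIGMA j:{J..}. SIGMA l:L j. (UNIV :: bool set) \<times> Z2)"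
      by (subst infsum_reindex) (auto simp: o_def)
    also have "\<dots> = (\<Sum>\<^sub>\<infinity>j\<in>{J..}. \<Sum>\<^sub>\<infinity>l\<in>L j. \<Sum>\<^sub>\<infinity>b\<in>UNIV. \<Sum>\<^sub>\<infinity>k\<in>Z2. e (Inr (j, l, b, k)))"
      unfolding infsum_Sigma_ennreal ..
    also have "\<dots> = (\<Sum>\<^sub>\<infinity>j\<in>{J..}. \<Sum>l\<in>L j. coeff_sum u (B j) (g j l) + coeff_sum u (B' j) (g j l))"
      using L by (intro infsum_cong) (simp add: UNIV_bool coeff_sum_def e_def h_def add.commute)
    finally show ?thesis by (simp add: E_def e_def)
  qed
  have cq: "cmod (q u) = c * norm2_sq u" for u
    unfolding q_def norm_of_real using c norm2_sq_nonneg[of u] by simp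
  have "(\<Sum>\<^sub>\<infinity>i\<in>I. ennreal ((cmod (inner_prod f (h i)))\<^sup>2)) = ennreal (cmod (q f)) \<and>
    q f = complex_of_real (cmod (q f))"
  proof (rule square_sum_identity_extends[where S = UNIV and C = c])
    show "\<exists>a b. UNIV \<inter> box (- d) d = box a b" for d by auto
    show "(\<Sum>\<^sub>\<infinity>i\<in>I. ennreal ((cmod (inner_prod f (h i)))\<^sup>2)) = ennreal (cmod (q f)) \<and>
      q f = complex_of_real (cmod (q f))" if "f \<in> test_functions" for f
      using base[OF that] unfolding flat cq by (simp add: q_def)
    show "(\<lambda>n. q (F n)) \<longlonglongrightarrow> q u" if "dominated_limit F u D" for F u D
      unfolding q_def by (intro tendsto_intros dominated_limit_norm2_sq[OF that])
  qed (use hL2 f c in \<open>auto simp: cq\<close>)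
  then show ?thesis unfolding flat cq by simp
qed

text \<open>
  On test functions the statements differ by telescoping only. Subtracting the frame identities at
  $J$ and $J+1$, which is legitimate since all terms are finite, gives the relation between
  consecutive levels. Conversely these relations identify the limit of \<open>A f\<close> with the frame sum
  starting at any level. This bounds the energy of each generator by a multiple of
  $\|f\|^2$, so that the generators are square-integrable and the identity extends to all
  of \<^const>\<open>L2\<close>.
\<close>

theorem tight_frames_iff_mra:
  fixes \<phi> :: "int \<Rightarrow> plane \<Rightarrow> complex" and g :: "int \<Rightarrow> int \<Rightarrow> plane \<Rightarrow> complex"
  assumes N: "\<And>j. invertible (N j :: matrix2)" and B: "\<And>j. invertible (B j :: matrix2)"
    and B': "\<And>j. invertible (B' j :: matrix2)"
    and \<phi>: "\<And>j. j \<ge> J0 \<Longrightarrow> \<phi> j \<in> L2_loc"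
    and g: "\<And>j l. j \<ge> J0 \<Longrightarrow> l \<in> L j \<Longrightarrow> g j l \<in> L2_loc" and L: "\<And>j. finite (L j)"
    and c: "0 \<le> c"
  defines "A \<equiv> \<lambda>f j. coeff_sum f (N j) (\<phi> j)"
    and "D \<equiv> \<lambda>f j. \<Sum>l\<in>L j. coeff_sum f (B j) (g j l) + coeff_sum f (B' j) (g j l)"
  shows "(\<forall>J\<ge>J0. \<phi> J \<in> L2 \<and> (\<forall>j\<ge>J. \<forall>l\<in>L j. g j l \<in> L2) \<and>
      (\<forall>f\<in>L2. ennreal (c * norm2_sq f) = A f J + infsum (D f) {J..})) \<longleftrightarrow>
    (\<forall>f\<in>test_functions. (A f \<longlongrightarrow> ennreal (c * norm2_sq f)) at_top) \<and>
    (\<forall>j\<ge>J0. \<forall>f\<in>test_functions. A f (j + 1) = A f j + D f j)"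
    (is "?frames \<longleftrightarrow> ?limit \<and> ?step")
proof (intro iffI)
  assume frames: ?frames
  have eq: "A f J + infsum (D f) {J..} = ennreal (c * norm2_sq f)" if "f \<in> test_functions" "J \<ge> J0" for f J
    using frames that test_function_L2 by metis
  have step: "A f (j + 1) = A f j + D f j" if f: "f \<in> test_functions" and j: "j \<ge> J0" for f j
  proof -
    have "A f (j + 1) + infsum (D f) {j + 1..} = A f j + D f j + infsum (D f) {j + 1..}"
      using eq[OF f j] eq[OF f, of "j + 1"] j infsum_atLeast_int[of "D f" j] by (simp add: add.assoc)
    moreover have "infsum (D f) {j + 1..} \<le> ennreal (c * norm2_sq f)"
      using eq[OF f, of "j + 1"] j add_increasing[of "A f (j + 1)" "infsum (D f) {j + 1..}" "infsum (D f) {j + 1..}"] by simp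
    then have "infsum (D f) {j + 1..} \<noteq> \<infinity>"
      by (auto simp: top_unique)
    ultimately show ?thesis
      using ennreal_add_left_cancel by (simp add: add.commute)
  qed
  moreover have ?limit
  proof
    fix f assume f: "f \<in> test_functions"
    have "(A f \<longlongrightarrow> A f J0 + infsum (D f) {J0..}) at_top"
      by (rule telescoping_limit) (rule step[OF f])
    then show "(A f \<longlongrightarrow> ennreal (c * norm2_sq f)) at_top"
      using eq[OF f, of J0] by simp
  qed
  ultimately show "?limit \<and> ?step" by blast
next
  assume "?limit \<and> ?step"
  then have limit: ?limit and step: ?step by auto
  have eq: "A f J + infsum (D f) {J..} = ennreal (c * norm2_sq f)" if f: "f \<in> test_functions" and J: "J \<ge> J0" for f J
  proof (rule tendsto_unique)
    show "(A f \<longlongrightarrow> A f J + infsum (D f) {J..}) at_top"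
      by (rule telescoping_limit) (use step f J in auto)
  qed (use limit f in auto)
  have \<phi>L2: "\<phi> J \<in> L2" if J: "J \<ge> J0" for J
  proof (rule L2_of_energy_bound[OF N \<phi>[OF J] c])
    fix f assume f: "f \<in> test_functions"
    have "coeff_sum f (N J) (\<phi> J) \<le> A f J + infsum (D f) {J..}"
      unfolding A_def by (rule add_increasing2) auto
    then show "coeff_sum f (N J) (\<phi> J) \<le> ennreal (c * norm2_sq f)"
      using eq[OF f J] by simp
  qed
  have gL2: "g j l \<in> L2" if j: "j \<ge> J0" and l: "l \<in> L j" for j l
  proof (rule L2_of_energy_bound[OF B g[OF j l] c])
    fix f assume f: "f \<in> test_functions"
    have "coeff_sum f (B j) (g j l) \<le> coeff_sum f (B j) (g j l) + coeff_sum f (B' j) (g j l)"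
      by (rule add_increasing2) auto
    also have "\<dots> \<le> D f j"
      unfolding D_def by (rule member_le_sum) (use l L in auto)
    also have "\<dots> \<le> infsum (D f) {j..}"
      using sum_le_infsum_ennreal[of "{j}" "{j..}" "D f"] by simp
    also have "\<dots> \<le> A f j + infsum (D f) {j..}"
      by (rule add_increasing) auto
    finally show "coeff_sum f (B j) (g j l) \<le> ennreal (c * norm2_sq f)"
      using eq[OF f j] by simp
  qed
  show ?frames
  proof (intro allI impI conjI ballI)
    fix J assume J: "J \<ge> J0"
    show "\<phi> J \<in> L2" by (rule \<phi>L2[OF J])
    show "g j l \<in> L2" if "j \<ge> J" "l \<in> L j" for j l using that J by (intro gL2) auto
    fix f assume f: "f \<in> L2"
    show "ennreal (c * norm2_sq f) = A f J + infsum (D f) {J..}"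
      unfolding A_def D_def
    proof (rule tight_frame_identity_extends[OF N B B' \<phi>L2[OF J] _ L c _ f, symmetric])
      show "g j l \<in> L2" if "j \<ge> J" "l \<in> L j" for j l using that J by (intro gL2) auto
      show "coeff_sum u (N J) (\<phi> J) +
          (\<Sum>\<^sub>\<infinity>j\<in>{J..}. \<Sum>l\<in>L j. coeff_sum u (B j) (g j l) + coeff_sum u (B' j) (g j l)) =
          ennreal (c * norm2_sq u)" if "u \<in> test_functions" for u
        using eq[OF that J] unfolding A_def D_def .
    qed
  qed
qed

section \<open>The three descriptions of tight frames\<close>

theorem theorem2:
  fixes lam :: real and J0 :: int
    and r s :: "int \<Rightarrow> int"
    and \<phi> :: "int \<Rightarrow> plane \<Rightarrow> complex"
    and \<psi> :: "plane \<Rightarrow> complex"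
    and \<psi>s g :: "int \<Rightarrow> int \<Rightarrow> plane \<Rightarrow> complex"
  assumes lam: "lam > 1"
    and rs: "\<And>j. j \<ge> J0 \<Longrightarrow> 0 \<le> r j \<and> r j \<le> s j"
    and phi_loc: "\<And>j. j \<ge> J0 \<Longrightarrow> \<phi> j \<in> L2_loc"
    and psi_loc: "\<psi> \<in> L2_loc"
    and psis_loc: "\<And>j l. j \<ge> J0 \<Longrightarrow> r j + 1 \<le> \<bar>l\<bar> \<Longrightarrow> \<bar>l\<bar> \<le> s j \<Longrightarrow> \<psi>s j l \<in> L2_loc"
    and g: "g = shear_gen r \<psi> \<psi>s"
  defines "tight_frames \<equiv> (\<forall>J\<ge>J0. FAS_tight_frame lam s \<phi> g J)"
    and "mra_identities \<equiv>
      (\<forall>f\<in>test_functions.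
        ((\<lambda>j. coeff_sum f (mat_powi (N_mat lam) j) (\<phi> j)) \<longlongrightarrow>
          ennreal ((2 * pi)\<^sup>2 * norm2_sq f)) at_top) \<and>
      (\<forall>j\<ge>J0. \<forall>f\<in>test_functions.
        coeff_sum f (mat_powi (N_mat lam) (j + 1)) (\<phi> (j + 1)) =
        coeff_sum f (mat_powi (N_mat lam) j) (\<phi> j) +
        (\<Sum>l\<in>{- s j..s j}. \<Sum>\<^sub>\<infinity>k\<in>Z2.
          ennreal
            ((cmod (inner_prod f
                (dilmod (S_mat (of_int l) ** mat_powi (B_mat lam) j) k (g j l))))\<^sup>2 +
             (cmod (inner_prod f
                (dilmod (S_mat (of_int l) ** mat_powi (B_mat lam) j ** E_mat) k (g j l))))\<^sup>2)))"
    and "pointwise_identities \<equiv>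
      (\<forall>h\<in>test_functions.
        ((\<lambda>j. inner_prod
            (\<lambda>\<xi>. complex_of_real ((cmod (\<phi> j (mat_powi (N_mat lam) j *v \<xi>)))\<^sup>2)) h) \<longlongrightarrow>
          inner_prod (\<lambda>_. 1) h) at_top) \<and>
      (\<forall>j\<ge>J0.
        \<forall>k \<in> (*v) (mat_powi (M_mat lam) j) ` Z2 \<union>
              (*v) (mat_powi (M_mat lam) (j + 1)) ` Z2 \<union>
              (*v) (mat_powi (A_mat lam) j) ` Z2 \<union>
              (*v) (E_mat ** mat_powi (A_mat lam) j) ` Z2.
          AE \<xi> in lebesgue.
            I_phi \<phi> j (mat_powi (N_mat lam) j *v k) (mat_powi (N_mat lam) j *v \<xi>) +
            I_Psi s g j (mat_powi (B_mat lam) j *v k) (mat_powi (B_mat lam) j *v \<xi>) +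
            I_Psi s g j ((mat_powi (B_mat lam) j ** E_mat) *v k)
              ((mat_powi (B_mat lam) j ** E_mat) *v \<xi>) =
            I_phi \<phi> (j + 1) (mat_powi (N_mat lam) (j + 1) *v k)
              (mat_powi (N_mat lam) (j + 1) *v \<xi>))"
  shows "(tight_frames \<longleftrightarrow> mra_identities) \<and> (mra_identities \<longleftrightarrow> pointwise_identities)"
proof -
  define N where "N = mat_powi (N_mat lam)"
  define B where "B = mat_powi (B_mat lam)"
  define L where "L j = {- s j..s j}" for j
  have lam0: "lam \<noteq> 0" using lam by simp
  note inv = dilation_invertible[OF lam0, folded N_def B_def]
  have finL: "finite (L j)" for j by (simp add: L_def)
  have gen_loc: "Psi g j l \<in> L2_loc" if "j \<ge> J0" "l \<in> L j" for j l
  proof -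
    have "g j l \<in> L2_loc"
      unfolding g shear_gen_def using that psi_loc psis_loc[of j l] by (auto simp: L_def)
    then show ?thesis unfolding Psi_def by (rule L2_loc_linear[OF S_mat_invertible])
  qed
  define D where "D f j = (\<Sum>l\<in>L j. coeff_sum f (B j) (Psi g j l) + coeff_sum f (B j ** E_mat) (Psi g j l))" for f j
  have sheared: "(\<Sum>l\<in>{- s j..s j}. \<Sum>\<^sub>\<infinity>k\<in>Z2.
          ennreal
            ((cmod (inner_prod f
                (dilmod (S_mat (of_int l) ** mat_powi (B_mat lam) j) k (g j l))))\<^sup>2 +
             (cmod (inner_prod f
                (dilmod (S_mat (of_int l) ** mat_powi (B_mat lam) j ** E_mat) k (g j l))))\<^sup>2)) = D f j" for f j
    unfolding infsum_pair_coeff_sum D_def L_def B_def Psi_def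
    by (simp add: coeff_sum_shear flip: matrix_mul_assoc)
  have mra: "mra_identities \<longleftrightarrow>
      (\<forall>f\<in>test_functions. ((\<lambda>j. coeff_sum f (N j) (\<phi> j)) \<longlongrightarrow> ennreal ((2 * pi)\<^sup>2 * norm2_sq f)) at_top) \<and>
      (\<forall>j\<ge>J0. \<forall>f\<in>test_functions. coeff_sum f (N (j + 1)) (\<phi> (j + 1)) = coeff_sum f (N j) (\<phi> j) + D f j)"
    unfolding mra_identities_def sheared N_def ..
  have tight: "tight_frames \<longleftrightarrow> (\<forall>J\<ge>J0. \<phi> J \<in> L2 \<and> (\<forall>j\<ge>J. \<forall>l\<in>L j. Psi g j l \<in> L2) \<and>
      (\<forall>f\<in>L2. ennreal ((2 * pi)\<^sup>2 * norm2_sq f) = coeff_sum f (N J) (\<phi> J) + infsum (D f) {J..}))"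
    unfolding tight_frames_def FAS_tight_frame_def infsum_pair_coeff_sum D_def L_def N_def B_def ..
  have "tight_frames \<longleftrightarrow> mra_identities"
    unfolding tight mra D_def
    by (rule tight_frames_iff_mra[OF inv phi_loc gen_loc finL]) auto
  moreover have "mra_identities \<longleftrightarrow> pointwise_identities"
  proof -
    have limit: "(\<forall>f\<in>test_functions. ((\<lambda>j. coeff_sum f (N j) (\<phi> j)) \<longlongrightarrow> ennreal ((2 * pi)\<^sup>2 * norm2_sq f)) at_top) \<longleftrightarrow>
      (\<forall>h\<in>test_functions. ((\<lambda>j. inner_prod (\<lambda>\<xi>. complex_of_real ((cmod (\<phi> j (N j *v \<xi>)))\<^sup>2)) h) \<longlongrightarrow>
        inner_prod (\<lambda>_. 1) h) at_top)"
      by (rule energy_limit_iff[OF inv(1) phi_loc isotropic_lattice_sparse[OF lam, folded N_def]])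
    have step: "(\<forall>f\<in>test_functions. coeff_sum f (N (j + 1)) (\<phi> (j + 1)) = coeff_sum f (N j) (\<phi> j) + D f j) \<longleftrightarrow>
      (\<forall>k \<in> (*v) (mat_powi (M_mat lam) j) ` Z2 \<union>
              (*v) (mat_powi (M_mat lam) (j + 1)) ` Z2 \<union>
              (*v) (mat_powi (A_mat lam) j) ` Z2 \<union>
              (*v) (E_mat ** mat_powi (A_mat lam) j) ` Z2.
          AE \<xi> in lebesgue.
            I_phi \<phi> j (N j *v k) (N j *v \<xi>) +
            I_Psi s g j (B j *v k) (B j *v \<xi>) +
            I_Psi s g j ((B j ** E_mat) *v k) ((B j ** E_mat) *v \<xi>) =
            I_phi \<phi> (j + 1) (N (j + 1) *v k) (N (j + 1) *v \<xi>))" if j: "j \<ge> J0" for j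
    proof -
      \<comment> \<open>$(0,0)$ stands for the scaling function, $(1,\ell)$ and $(2,\ell)$ for the generators of the two cones\<close>
      define I :: "(nat \<times> int) set" where "I = insert (0, 0) ({1, 2} \<times> L j)"
      define U where "U i = (if fst i = 0 then N j else if fst i = 1 then B j else B j ** E_mat)" for i :: "nat \<times> int"
      define h where "h i = (if fst i = 0 then \<phi> j else Psi g j (snd i))" for i :: "nat \<times> int"
      have sumI: "(\<Sum>i\<in>I. F i) = F (0, 0) + (\<Sum>l\<in>L j. F (1, l) + F (2, l))"
        for F :: "nat \<times> int \<Rightarrow> 'x::comm_monoid_add"
      proof -
        have "(\<Sum>i\<in>I. F i) = F (0, 0) + (\<Sum>i\<in>{1, 2} \<times> L j. F i)"
          unfolding I_def using finL by (subst sum.insert) auto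
        also have "(\<Sum>i\<in>{1, 2} \<times> L j. F i) = (\<Sum>t\<in>{1, 2}. \<Sum>l\<in>L j. F (t, l))"
          by (simp add: sum.cartesian_product)
        finally show ?thesis by (simp add: sum.distrib)
      qed
      \<comment> \<open>without a generator at level \<open>j\<close> the lattices of the two cones would be absent from \<open>I\<close>\<close>
      have "0 \<in> L j" using rs[OF j] by (simp add: L_def)
      then have lattices: "N (j + 1) *v k \<in> Z2 \<or> (\<exists>i\<in>I. U i *v k \<in> Z2) \<longleftrightarrow>
          k \<in> (*v) (mat_powi (M_mat lam) j) ` Z2 \<union>
              (*v) (mat_powi (M_mat lam) (j + 1)) ` Z2 \<union>
              (*v) (mat_powi (A_mat lam) j) ` Z2 \<union>
              (*v) (E_mat ** mat_powi (A_mat lam) j) ` Z2" for k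
        unfolding Un_iff mem_image_Z2_iff[OF dilation_inverses(2,1)[OF lam0]]
          mem_image_Z2_iff[OF dilation_inverses(4,3)[OF lam0]]
          mem_image_Z2_iff[OF dilation_inverses(6,5)[OF lam0]]
        by (auto simp: I_def U_def N_def B_def)
      have I_phi: "I_phi \<phi> i k \<xi> = shift_prod (\<phi> i) k \<xi>" for i k \<xi>
        by (simp add: I_phi_def shift_prod_def)
      have I_Psi: "I_Psi s g j k \<xi> = (\<Sum>l\<in>L j. shift_prod (Psi g j l) k \<xi>)" for k \<xi>
        by (simp add: I_Psi_def shift_prod_def Psi_def L_def)
      have "(\<forall>f\<in>test_functions. coeff_sum f (N (j + 1)) (\<phi> (j + 1)) = (\<Sum>i\<in>I. coeff_sum f (U i) (h i))) \<longleftrightarrow>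
        (\<forall>k. N (j + 1) *v k \<in> Z2 \<or> (\<exists>i\<in>I. U i *v k \<in> Z2) \<longrightarrow>
          (AE \<xi> in lebesgue. (\<Sum>i\<in>I. shift_prod (h i) (U i *v k) (U i *v \<xi>)) =
            shift_prod (\<phi> (j + 1)) (N (j + 1) *v k) (N (j + 1) *v \<xi>)))"
      proof (rule energy_identity_iff_AE)
        show "finite I" using finL by (simp add: I_def)
        show "invertible (U i)" for i using inv by (simp add: U_def)
        show "h i \<in> L2_loc" if "i \<in> I" for i
          using that phi_loc[OF j] gen_loc[OF j] by (auto simp: I_def h_def)
      qed (use inv phi_loc j in auto)
      then show ?thesis
        unfolding lattices sumI I_phi I_Psi
        by (simp add: U_def h_def D_def sum.distrib add.assoc Ball_def)
    qed
    show ?thesis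
      unfolding mra pointwise_identities_def N_def[symmetric] B_def[symmetric]
      using limit step by (intro conj_cong) auto
  qed
  ultimately show ?thesis ..
qed

end
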